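(* For any $\lambda\in\mathcal{P}^k$ and $1\le t\le k$, \[ \widetilde{g}^{(k)}_{R_t\cup\lambda}=\widetilde{g}^{(k)}_{R_t}\,\widetilde{g}^{(k)}_{\lambda}. \]
   Context: Fix a positive integer $k$. Let $I=\mathbb{Z}/(k+1)\mathbb{Z}=\{0,1,\dots,k\}$ and let $W=\tilde S_{k+1}$ be the affine symmetric group with Coxeter generators $s_i$ ($i\in I$), relations $s_i^2=1$, $s_is_{i+1}s_i=s_{i+1}s_is_{i+1}$, and $s_is_j=s_js_i$ when $i-j\not\equiv 0,\pm1 \pmod{k+1}$. Let $l$ be the length function and $\le$ the strong (Bruhat) order. Let $W^\circ\subset W$ be the set of affine Grassmannian elements, i.e. $w$ with $ws_i>w$ for all $i\in\{1,\dots,k\}$. For $A\subsetneq I$, $d_A=s_{i_1}\cdots s_{i_m}$ where $A=\{i_1,\dots,i_m\}$ and the word $i_1\cdots i_m$ is cyclically decreasing (distinct letters, and no $j$ occurs to the left of $j+1$, indices mod $k+1$). $\mathcal{P}^k$ is the set of partitions $\lambda$ with $\lambda_1\le k$. The residue of the cell in row $i$, column $j$ is $j-i \bmod (k+1)$. For $\lambda\in\mathcal{P}^k$, $w_\lambda=s_{i_1}\cdots s_{i_l}$ where $(i_1,\dots,i_l)$ are the residues of the cells of $\lambda$ read from the shortest row to the longest, each row from right to left; $\lambda\mapsto w_\lambda$ is a bijection $\mathcal{P}^k\to W^\circ$, and $\mathcal P^k$ carries the strong order $\mu\le\lambda\iff w_\mu\le w_\lambda$. The $k$-rectangle is $R_t=(t^{k+1-t})=(t,\dots,t)$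 ($k+1-t$ parts), and $R_t\cup\lambda$ is the partition obtained by concatenating the parts of $R_t$ and $\lambda$ and sorting them in weakly decreasing order. Demazure action: for $s=s_i$, $\phi_s(x)=sx$ if $sx>x$ and $\phi_s(x)=x$ otherwise; for $x=t_1\cdots t_n$ reduced, $x*y=\phi_{t_1}\cdots\phi_{t_n}(y)$. Let $h_r$ be the complete homogeneous symmetric functions and $\Lambda^{(k)}=\mathbb{Z}[h_1,\dots,h_k]$. The $K$-$k$-Schur functions $\{g^{(k)}_w\}_{w\in W^\circ}$ are the family (a basis of $\Lambda^{(k)}$) determined by $g^{(k)}_e=1$ and, for $w\in W^\circ$ and $1\le r\le k$, $h_r\,g^{(k)}_w=\sum (-1)^{r+l(w)-l(d_A*w)} g^{(k)}_{d_A*w}$, summed over $A\subsetneq I$ with $|A|=r$ and $d_A*w\in W^\circ$. Write $g^{(k)}_\lambda=g^{(k)}_{w_\lambda}$ and $\widetilde{g}^{(k)}_{\lambda}=\sum_{\mu\in\mathcal{P}^k,\ \mu\le\lambda} g^{(k)}_{\mu}$. *)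

theory Defs
  imports "HOL-Algebra.Group" "HOL-Library.Multiset"
begin

section \<open>The affine symmetric group\<close>

text \<open>The index set \<open>\<int>/(k+1)\<int>\<close> is represented by the residues \<open>0, \<dots>, k\<close>.\<close>

definition index_set :: "nat \<Rightarrow> int set" where
  "index_set k = {0..int k}"

text \<open>
  The congruence on words presenting the Coxeter group. For \<open>k = 1\<close> the elements \<open>i\<close>, \<open>i + 1\<close>
  and \<open>i - 1\<close> are not three distinct indices and the group is the infinite dihedral group, i.e.\
  there is no braid relation.
\<close>

inductive cox_equiv :: "nat \<Rightarrow> int list \<Rightarrow> int list \<Rightarrow> bool" for k :: nat where
  cox_refl: "cox_equiv k u u"
| cox_sym: "cox_equiv k u v \<Longrightarrow> cox_equiv k v u"
| cox_trans: "cox_equiv k u v \<Longrightarrow> cox_equiv k v w \<Longrightarrow> cox_equiv k u w"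
| cox_square: "i \<in> index_set k \<Longrightarrow> cox_equiv k (u @ [i, i] @ v) (u @ v)"
| cox_braid: "2 \<le> k \<Longrightarrow> i \<in> index_set k \<Longrightarrow> j = (i + 1) mod (int k + 1) \<Longrightarrow>
    cox_equiv k (u @ [i, j, i] @ v) (u @ [j, i, j] @ v)"
| cox_comm: "i \<in> index_set k \<Longrightarrow> j \<in> index_set k \<Longrightarrow> (i - j) mod (int k + 1) \<notin> {0, 1, int k} \<Longrightarrow>
    cox_equiv k (u @ [i, j] @ v) (u @ [j, i] @ v)"

definition cox_rel :: "nat \<Rightarrow> (int list \<times> int list) set" where
  "cox_rel k = {(u, v). u \<in> lists (index_set k) \<and> v \<in> lists (index_set k) \<and> cox_equiv k u v}"

definition word_class :: "nat \<Rightarrow> int list \<Rightarrow> int list set" where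
  "word_class k u = cox_rel k `` {u}"

text \<open>An element of the group is the set of all words in the generators that represent it.\<close>

definition affine_sym :: "nat \<Rightarrow> int list set monoid" where
  "affine_sym k =
     \<lparr> carrier = lists (index_set k) // cox_rel k,
       monoid.mult = (\<lambda>x y. \<Union>u\<in>x. \<Union>v\<in>y. word_class k (u @ v)),
       monoid.one = word_class k [] \<rparr>"

definition gen :: "nat \<Rightarrow> int \<Rightarrow> int list set" where
  "gen k i = word_class k [i]"

lemma equiv_cox_rel: "equiv (lists (index_set k)) (cox_rel k)"
  by (rule equivI) (auto simp: cox_rel_def refl_on_def sym_def trans_def
      intro: cox_refl cox_sym cox_trans)

lemma cox_equiv_append_left: "cox_equiv k u v \<Longrightarrow> cox_equiv k (w @ u) (w @ v)"
proof (induction rule: cox_equiv.induct)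
  case (cox_square i u v)
  then show ?case using cox_equiv.cox_square[of i k "w @ u" v] by simp
next
  case (cox_braid i j u v)
  then show ?case using cox_equiv.cox_braid[of k i j "w @ u" v] by simp
next
  case (cox_comm i j u v)
  then show ?case using cox_equiv.cox_comm[of i k j "w @ u" v] by simp
qed (blast intro: cox_equiv.cox_refl cox_equiv.cox_sym cox_equiv.cox_trans)+

lemma cox_equiv_append_right: "cox_equiv k u v \<Longrightarrow> cox_equiv k (u @ w) (v @ w)"
proof (induction rule: cox_equiv.induct)
  case (cox_square i u v)
  then show ?case using cox_equiv.cox_square[of i k u "v @ w"] by simp
next
  case (cox_braid i j u v)
  then show ?case using cox_equiv.cox_braid[of k i j u "v @ w"] by simp
next
  case (cox_comm i j u v)
  then show ?case using cox_equiv.cox_comm[of i k j u "v @ w"] by simp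
qed (blast intro: cox_equiv.cox_refl cox_equiv.cox_sym cox_equiv.cox_trans)+

lemma cox_equiv_append:
  "cox_equiv k u u' \<Longrightarrow> cox_equiv k v v' \<Longrightarrow> cox_equiv k (u @ v) (u' @ v')"
  by (meson cox_equiv_append_left cox_equiv_append_right cox_trans)

lemma word_class_eq_iff:
  "u \<in> lists (index_set k) \<Longrightarrow> v \<in> lists (index_set k) \<Longrightarrow>
   word_class k u = word_class k v \<longleftrightarrow> cox_equiv k u v"
  unfolding word_class_def
  using eq_equiv_class_iff[OF equiv_cox_rel, of u k v] by (auto simp: cox_rel_def)

lemma carrier_affine_sym:
  "carrier (affine_sym k) = word_class k ` lists (index_set k)"
  by (auto simp: affine_sym_def quotient_def word_class_def)

lemma one_affine_sym: "\<one>\<^bsub>affine_sym k\<^esub> = word_class k []"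
  by (simp add: affine_sym_def)

lemma mult_word_class:
  assumes "u \<in> lists (index_set k)" "v \<in> lists (index_set k)"
  shows "word_class k u \<otimes>\<^bsub>affine_sym k\<^esub> word_class k v = word_class k (u @ v)"
proof -
  have mem: "x \<in> word_class k w \<longleftrightarrow> x \<in> lists (index_set k) \<and> cox_equiv k w x"
    if "w \<in> lists (index_set k)" for x w
    using that by (auto simp: word_class_def cox_rel_def)
  have eq: "word_class k (a @ b) = word_class k (u @ v)"
    if a: "a \<in> word_class k u" and b: "b \<in> word_class k v" for a b
  proof -
    have "a @ b \<in> lists (index_set k)" "u @ v \<in> lists (index_set k)"
      using a b assms unfolding mem[OF assms(1)] mem[OF assms(2)] by auto
    moreover have "cox_equiv k (a @ b) (u @ v)"
      using a b unfolding mem[OF assms(1)] mem[OF assms(2)]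
      by (blast intro: cox_sym cox_equiv_append)
    ultimately show ?thesis by (simp only: word_class_eq_iff)
  qed
  have "u \<in> word_class k u" "v \<in> word_class k v"
    using assms by (simp_all only: mem cox_refl simp_thms)
  with eq have "(\<Union>a\<in>word_class k u. \<Union>b\<in>word_class k v. word_class k (a @ b)) = word_class k (u @ v)"
    by blast
  then show ?thesis by (simp add: affine_sym_def)
qed

lemma group_affine_sym: "group (affine_sym k)"
proof (rule groupI)
  fix x assume "x \<in> carrier (affine_sym k)"
  then obtain u where u: "u \<in> lists (index_set k)" "x = word_class k u"
    by (auto simp: carrier_affine_sym)
  have "cox_equiv k (rev u @ u) []"
    using u(1)
  proof (induction u)
    case (Cons i u)
    then have "cox_equiv k (rev u @ [i, i] @ u) (rev u @ u)"
      by (intro cox_square) auto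
    with Cons show ?case by (auto intro: cox_trans)
  qed (simp add: cox_refl)
  moreover have ru: "rev u \<in> lists (index_set k)" "rev u @ u \<in> lists (index_set k)"
    using u(1) by auto
  ultimately have "word_class k (rev u @ u) = word_class k []"
    by (simp add: word_class_eq_iff)
  then have "word_class k (rev u) \<otimes>\<^bsub>affine_sym k\<^esub> x = \<one>\<^bsub>affine_sym k\<^esub>"
    unfolding u(2) mult_word_class[OF ru(1) u(1)] one_affine_sym .
  moreover have "word_class k (rev u) \<in> carrier (affine_sym k)"
    unfolding carrier_affine_sym using ru(1) by (rule imageI)
  ultimately show "\<exists>y\<in>carrier (affine_sym k). y \<otimes>\<^bsub>affine_sym k\<^esub> x = \<one>\<^bsub>affine_sym k\<^esub>"
    by blast
next
  show "\<one>\<^bsub>affine_sym k\<^esub> \<in> carrier (affine_sym k)"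
    by (auto simp: carrier_affine_sym one_affine_sym)
next
  fix x y assume "x \<in> carrier (affine_sym k)" "y \<in> carrier (affine_sym k)"
  then obtain u v where uv: "u \<in> lists (index_set k)" "v \<in> lists (index_set k)"
    and xy: "x = word_class k u" "y = word_class k v"
    unfolding carrier_affine_sym by blast
  have uv': "u @ v \<in> lists (index_set k)" using uv by auto
  show "x \<otimes>\<^bsub>affine_sym k\<^esub> y \<in> carrier (affine_sym k)"
    unfolding xy mult_word_class[OF uv] carrier_affine_sym using uv' by (rule imageI)
  fix z assume "z \<in> carrier (affine_sym k)"
  then obtain w where w: "w \<in> lists (index_set k)" and z: "z = word_class k w"
    unfolding carrier_affine_sym by blast
  have vw: "v @ w \<in> lists (index_set k)" using uv w by auto
  show "x \<otimes>\<^bsub>affine_sym k\<^esub> y \<otimes>\<^bsub>affine_sym k\<^esub> z =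
      x \<otimes>\<^bsub>affine_sym k\<^esub> (y \<otimes>\<^bsub>affine_sym k\<^esub> z)"
    unfolding xy z mult_word_class[OF uv] mult_word_class[OF uv(2) w]
      mult_word_class[OF uv' w] mult_word_class[OF uv(1) vw] by simp
next
  fix x assume "x \<in> carrier (affine_sym k)"
  then obtain u where u: "u \<in> lists (index_set k)" and x: "x = word_class k u"
    unfolding carrier_affine_sym by blast
  show "\<one>\<^bsub>affine_sym k\<^esub> \<otimes>\<^bsub>affine_sym k\<^esub> x = x"
    unfolding x one_affine_sym by (subst mult_word_class[OF _ u]) auto
qed

definition len :: "int list set \<Rightarrow> nat" where
  "len w = (LEAST n. n \<in> length ` w)"

definition reflections :: "nat \<Rightarrow> int list set set" where
  "reflections k = {x \<otimes>\<^bsub>affine_sym k\<^esub> gen k i \<otimes>\<^bsub>affine_sym k\<^esub> inv\<^bsub>affine_sym k\<^esub> x | x i.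
     x \<in> carrier (affine_sym k) \<and> i \<in> index_set k}"

definition bruhat_step :: "nat \<Rightarrow> int list set \<Rightarrow> int list set \<Rightarrow> bool" where
  "bruhat_step k u v \<longleftrightarrow> u \<in> carrier (affine_sym k) \<and>
     (\<exists>t\<in>reflections k. v = u \<otimes>\<^bsub>affine_sym k\<^esub> t) \<and> len u < len v"

definition bruhat_le :: "nat \<Rightarrow> int list set \<Rightarrow> int list set \<Rightarrow> bool" where
  "bruhat_le k = (bruhat_step k)\<^sup>*\<^sup>*"

definition bruhat_less :: "nat \<Rightarrow> int list set \<Rightarrow> int list set \<Rightarrow> bool" where
  "bruhat_less k u v \<longleftrightarrow> bruhat_le k u v \<and> u \<noteq> v"

definition affine_grassmannian :: "nat \<Rightarrow> int list set set" where
  "affine_grassmannian k = {w \<in> carrier (affine_sym k).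
     \<forall>i\<in>{1..int k}. bruhat_less k w (w \<otimes>\<^bsub>affine_sym k\<^esub> gen k i)}"

section \<open>Cyclically decreasing elements and the Demazure action\<close>

definition cyc_decreasing :: "nat \<Rightarrow> int list \<Rightarrow> bool" where
  "cyc_decreasing k u \<longleftrightarrow> distinct u \<and>
     (\<forall>p q. p < q \<longrightarrow> q < length u \<longrightarrow> u ! q \<noteq> (u ! p + 1) mod (int k + 1))"

text \<open>
  The element does not depend on the choice of the cyclically decreasing word with letter set \<open>A\<close>.
\<close>

definition cyc_dec_elem :: "nat \<Rightarrow> int set \<Rightarrow> int list set" where
  "cyc_dec_elem k A = word_class k (SOME u. set u = A \<and> cyc_decreasing k u)"

definition demazure_gen :: "nat \<Rightarrow> int \<Rightarrow> int list set \<Rightarrow> int list set" where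
  "demazure_gen k i x =
     (if bruhat_less k x (gen k i \<otimes>\<^bsub>affine_sym k\<^esub> x) then gen k i \<otimes>\<^bsub>affine_sym k\<^esub> x else x)"

text \<open>The value does not depend on the choice of the reduced word of \<open>x\<close>.\<close>

definition demazure :: "nat \<Rightarrow> int list set \<Rightarrow> int list set \<Rightarrow> int list set" where
  "demazure k x y = foldr (demazure_gen k) (SOME u. u \<in> x \<and> length u = len x) y"

section \<open>Bounded partitions\<close>

definition bounded_partitions :: "nat \<Rightarrow> nat list set" where
  "bounded_partitions k = {p. sorted_wrt (\<ge>) p \<and> set p \<subseteq> {1..k}}"

text \<open>Rows and columns are counted from 0 here, which does not change the residues.\<close>

definition residue_word :: "nat \<Rightarrow> nat list \<Rightarrow> int list" where
  "residue_word k p =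
     concat (map (\<lambda>i. map (\<lambda>j. (int j - int i) mod (int k + 1)) (rev [0..<p ! i]))
       (rev [0..<length p]))"

definition part_elem :: "nat \<Rightarrow> nat list \<Rightarrow> int list set" where
  "part_elem k p = word_class k (residue_word k p)"

definition part_le :: "nat \<Rightarrow> nat list \<Rightarrow> nat list \<Rightarrow> bool" where
  "part_le k p q \<longleftrightarrow> bruhat_le k (part_elem k p) (part_elem k q)"

definition k_rectangle :: "nat \<Rightarrow> nat \<Rightarrow> nat list" where
  "k_rectangle k t = replicate (k + 1 - t) t"

definition part_union :: "nat list \<Rightarrow> nat list \<Rightarrow> nat list" where
  "part_union p q = rev (sort (p @ q))"

section \<open>The ring of symmetric functions\<close>

text \<open>
  A symmetric function over the integers in the variables \<open>x\<^sub>0, x\<^sub>1, \<dots>\<close> is given by its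
  coefficients; the multiset \<open>m\<close> stands for the monomial in which \<open>x\<^sub>i\<close> has exponent \<open>count m i\<close>.
\<close>

typedef symfun = "{f :: nat multiset \<Rightarrow> int.
    (\<forall>\<pi> m. bij \<pi> \<longrightarrow> f (image_mset \<pi> m) = f m) \<and> (\<exists>d. \<forall>m. d < size m \<longrightarrow> f m = 0)}"
  morphisms sf_coeff Abs_symfun
  by (rule exI[of _ "\<lambda>_. 0"]) auto

setup_lifting type_definition_symfun

lemma symfun_eqI: "(\<And>m. sf_coeff f m = sf_coeff g m) \<Longrightarrow> f = g"
  by transfer auto

definition msplits :: "'a multiset \<Rightarrow> ('a multiset \<times> 'a multiset) set" where
  "msplits m = {(a, b). a + b = m}"

lemma finite_msplits: "finite (msplits m)"
proof (induction m)
  case empty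
  have "msplits ({#} :: 'a multiset) = {({#}, {#})}" by (auto simp: msplits_def)
  then show ?case by simp
next
  case (add x m)
  have "(a, b) \<in> (\<lambda>(a, b). (add_mset x a, b)) ` msplits m \<union> (\<lambda>(a, b). (a, add_mset x b)) ` msplits m"
    if "a + b = add_mset x m" for a b
  proof -
    from that have "x \<in># a + b" by simp
    then consider a' where "a = add_mset x a'" | b' where "b = add_mset x b'"
      by (auto dest: multi_member_split)
    then show ?thesis
      using that by cases (auto simp: msplits_def image_iff)
  qed
  then have "msplits (add_mset x m) \<subseteq>
    (\<lambda>(a, b). (add_mset x a, b)) ` msplits m \<union> (\<lambda>(a, b). (a, add_mset x b)) ` msplits m"
    by (auto simp: msplits_def)
  with add show ?case by (meson finite_UnI finite_imageI finite_subset)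
qed

lemma sum_msplits_image:
  assumes "bij \<pi>"
  shows "(\<Sum>(a, b)\<in>msplits (image_mset \<pi> m). F a b) =
    (\<Sum>(a, b)\<in>msplits m. F (image_mset \<pi> a) (image_mset \<pi> b))"
proof -
  have *: "image_mset (inv_into UNIV \<pi>) (image_mset \<pi> c) = c" for c
    using assms by (simp add: multiset.map_comp bij_is_inj)
  have **: "image_mset \<pi> (image_mset (inv_into UNIV \<pi>) c) = c" for c
    using assms bij_is_surj[of \<pi>] by (simp add: multiset.map_comp surj_iff)
  show ?thesis
    by (rule sum.reindex_bij_witness[
          where j = "\<lambda>(a, b). (image_mset (inv_into UNIV \<pi>) a, image_mset (inv_into UNIV \<pi>) b)"
            and i = "\<lambda>(a, b). (image_mset \<pi> a, image_mset \<pi> b)"])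
      (auto simp: msplits_def * ** simp flip: image_mset_union)
qed

instantiation symfun :: comm_ring_1
begin

lift_definition zero_symfun :: symfun is "\<lambda>_. 0" by auto

lift_definition one_symfun :: symfun is "\<lambda>m. if m = {#} then 1 else 0"
  by (auto intro!: exI[of _ 0])

lift_definition plus_symfun :: "symfun \<Rightarrow> symfun \<Rightarrow> symfun" is "\<lambda>f g m. f m + g m"
proof -
  fix f g :: "nat multiset \<Rightarrow> int"
  assume f: "(\<forall>\<pi> m. bij \<pi> \<longrightarrow> f (image_mset \<pi> m) = f m) \<and> (\<exists>d. \<forall>m. d < size m \<longrightarrow> f m = 0)"
    and g: "(\<forall>\<pi> m. bij \<pi> \<longrightarrow> g (image_mset \<pi> m) = g m) \<and> (\<exists>d. \<forall>m. d < size m \<longrightarrow> g m = 0)"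
  from f g obtain d e where "\<forall>m. d < size m \<longrightarrow> f m = 0" "\<forall>m. e < size m \<longrightarrow> g m = 0"
    by blast
  then have "\<forall>m. d + e < size m \<longrightarrow> f m + g m = 0" by auto
  then have "\<exists>d. \<forall>m. d < size m \<longrightarrow> f m + g m = 0" by blast
  with f g show "(\<forall>\<pi> m. bij \<pi> \<longrightarrow> f (image_mset \<pi> m) + g (image_mset \<pi> m) = f m + g m) \<and>
    (\<exists>d. \<forall>m. d < size m \<longrightarrow> f m + g m = 0)" by auto
qed

lift_definition uminus_symfun :: "symfun \<Rightarrow> symfun" is "\<lambda>f m. - f m" by auto

definition minus_symfun :: "symfun \<Rightarrow> symfun \<Rightarrow> symfun" where
  "minus_symfun f g = f + - g"

lift_definition times_symfun :: "symfun \<Rightarrow> symfun \<Rightarrow> symfun"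
  is "\<lambda>f g m. \<Sum>(a, b)\<in>msplits m. f a * g b"
proof -
  fix f g :: "nat multiset \<Rightarrow> int"
  assume f: "(\<forall>\<pi> m. bij \<pi> \<longrightarrow> f (image_mset \<pi> m) = f m) \<and> (\<exists>d. \<forall>m. d < size m \<longrightarrow> f m = 0)"
    and g: "(\<forall>\<pi> m. bij \<pi> \<longrightarrow> g (image_mset \<pi> m) = g m) \<and> (\<exists>d. \<forall>m. d < size m \<longrightarrow> g m = 0)"
  from f g obtain d e where d: "\<forall>m. d < size m \<longrightarrow> f m = 0" and e: "\<forall>m. e < size m \<longrightarrow> g m = 0"
    by blast
  have "(\<Sum>(a, b)\<in>msplits m. f a * g b) = 0" if "d + e < size m" for m
  proof (rule sum.neutral, safe)
    fix a b assume "(a, b) \<in> msplits m"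
    with that have "d < size a \<or> e < size b" by (auto simp: msplits_def)
    with d e show "f a * g b = 0" by auto
  qed
  with f g show "(\<forall>\<pi> m. bij \<pi> \<longrightarrow>
      (\<Sum>(a, b)\<in>msplits (image_mset \<pi> m). f a * g b) = (\<Sum>(a, b)\<in>msplits m. f a * g b)) \<and>
    (\<exists>d. \<forall>m. d < size m \<longrightarrow> (\<Sum>(a, b)\<in>msplits m. f a * g b) = 0)"
    by (auto simp: sum_msplits_image intro!: exI[of _ "d + e"])
qed

instance
proof
  fix f g h :: symfun
  show "f * g * h = f * (g * h)"
  proof (rule symfun_eqI)
    fix m :: "nat multiset"
    let ?A = "SIGMA p:msplits m. msplits (fst p)" and ?B = "SIGMA p:msplits m. msplits (snd p)"
    have "sf_coeff (f * g * h) m = (\<Sum>(p, q)\<in>?A. sf_coeff f (fst q) * sf_coeff g (snd q) * sf_coeff h (snd p))"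
      by (simp add: times_symfun.rep_eq sum_distrib_right case_prod_unfold sum.Sigma finite_msplits)
    also have "\<dots> = (\<Sum>(p, q)\<in>?B. sf_coeff f (fst p) * (sf_coeff g (fst q) * sf_coeff h (snd q)))"
      by (rule sum.reindex_bij_witness[
            where j = "\<lambda>(p, q). ((fst q, snd q + snd p), (snd q, snd p))"
              and i = "\<lambda>(p, q). ((fst p + fst q, snd q), (fst p, fst q))"])
        (auto simp: msplits_def ac_simps)
    also have "\<dots> = sf_coeff (f * (g * h)) m"
      by (simp add: times_symfun.rep_eq sum_distrib_left case_prod_unfold sum.Sigma finite_msplits)
    finally show "sf_coeff (f * g * h) m = sf_coeff (f * (g * h)) m" .
  qed
  show "f * g = g * f"
  proof (rule symfun_eqI)
    fix m :: "nat multiset"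
    show "sf_coeff (f * g) m = sf_coeff (g * f) m"
      unfolding times_symfun.rep_eq
      by (rule sum.reindex_bij_witness[where i = prod.swap and j = prod.swap])
        (auto simp: msplits_def ac_simps)
  qed
  show "1 * f = f"
  proof (rule symfun_eqI)
    fix m :: "nat multiset"
    have "sf_coeff (1 * f) m = (\<Sum>p\<in>msplits m. if p = ({#}, m) then sf_coeff f m else 0)"
      unfolding times_symfun.rep_eq
      by (rule sum.cong) (auto simp: one_symfun.rep_eq msplits_def split: if_splits)
    also have "\<dots> = sf_coeff f m"
      by (subst sum.delta[OF finite_msplits]) (simp add: msplits_def)
    finally show "sf_coeff (1 * f) m = sf_coeff f m" .
  qed
  show "(f + g) * h = f * h + g * h"
    by (rule symfun_eqI)
      (simp add: times_symfun.rep_eq plus_symfun.rep_eq case_prod_unfold distrib_right sum.distrib)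
  show "f + g + h = f + (g + h)" "f + g = g + f" "0 + f = f" "- f + f = 0" "f - g = f + - g"
    by (auto intro!: symfun_eqI
        simp: plus_symfun.rep_eq zero_symfun.rep_eq uminus_symfun.rep_eq minus_symfun_def)
  have "sf_coeff 0 {#} \<noteq> sf_coeff 1 {#}"
    by (simp add: zero_symfun.rep_eq one_symfun.rep_eq)
  then show "(0 :: symfun) \<noteq> 1" by auto
qed

end

text \<open>The complete homogeneous symmetric function: the sum of all monomials of degree \<open>r\<close>.\<close>

lift_definition complete_sf :: "nat \<Rightarrow> symfun" is "\<lambda>r m. if size m = r then 1 else 0"
  by (auto intro: exI)

text \<open>The subring \<open>\<int>[h\<^sub>1, \<dots>, h\<^sub>k]\<close> of the ring of symmetric functions.\<close>

inductive_set Lambda_k :: "nat \<Rightarrow> symfun set" for k :: nat where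
  "complete_sf r \<in> Lambda_k k" if "r \<in> {1..k}"
| "1 \<in> Lambda_k k"
| "f - g \<in> Lambda_k k" if "f \<in> Lambda_k k" "g \<in> Lambda_k k"
| "f * g \<in> Lambda_k k" if "f \<in> Lambda_k k" "g \<in> Lambda_k k"

section \<open>K-k-Schur functions\<close>

text \<open>
  Only the values on affine Grassmannian elements are relevant. The conditions
  determine these values uniquely. The subtraction in the exponent of \<open>-1\<close> never truncates, as
  the length of \<open>d\<^sub>A * w\<close> is at most \<open>r + len w\<close>.
\<close>

definition K_k_Schur_family :: "nat \<Rightarrow> (int list set \<Rightarrow> symfun) \<Rightarrow> bool" where
  "K_k_Schur_family k g \<longleftrightarrow>
     (\<forall>w\<in>affine_grassmannian k. g w \<in> Lambda_k k) \<and>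
     g \<one>\<^bsub>affine_sym k\<^esub> = 1 \<and>
     (\<forall>w\<in>affine_grassmannian k. \<forall>r\<in>{1..k}.
        complete_sf r * g w =
          (\<Sum>A | A \<subset> index_set k \<and> card A = r \<and>
                demazure k (cyc_dec_elem k A) w \<in> affine_grassmannian k.
             (-1) ^ (r + len w - len (demazure k (cyc_dec_elem k A) w)) *
               g (demazure k (cyc_dec_elem k A) w)))"

definition K_k_Schur_sum :: "nat \<Rightarrow> (int list set \<Rightarrow> symfun) \<Rightarrow> nat list \<Rightarrow> symfun" where
  "K_k_Schur_sum k g p = (\<Sum>q | q \<in> bounded_partitions k \<and> part_le k q p. g (part_elem k q))"

end

theory Submission
  imports Defs
begin

text \<open>
  The group is represented faithfully by affine permutations of the integers, and \<open>W\<degree>\<close> by those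
  that increase on \<open>{1..k+1}\<close>. In the basis of the lower sums \<open>\<Sum>\<^sub>v\<^sub>\<le>\<^sub>w g\<^sub>v\<close> the 0-Hecke generator
  \<open>1 + D\<^sub>i\<close> maps basis elements to basis elements: it sends \<open>w\<close> to \<open>s\<^sub>i w\<close> if this is larger and still
  in \<open>W\<degree>\<close>, and to \<open>w\<close> otherwise. The Pieri rule says that \<open>h\<^sub>r\<close> acts as the sum over \<open>|A| = r\<close> of
  the products of the \<open>D\<^sub>i\<close>, \<open>i \<in> A\<close>, in cyclically decreasing order. Passing from \<open>\<lambda>\<close> to \<open>R\<^sub>t \<union> \<lambda>\<close>
  is \<open>f \<mapsto> \<sigma>\<^sup>t f \<sigma>\<^sup>-\<^sup>t w\<^sub>R\<close> with the rotation \<open>\<sigma>(x) = x + 1\<close>, which in one-line notation adds \<open>t\<close> to all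
  values and subtracts \<open>k + 1\<close> from the \<open>t\<close> smallest ones; it intertwines the action of \<open>i\<close> with
  that of \<open>i + t\<close> and hence commutes with every \<open>h\<^sub>r\<close>. A function on \<open>W\<degree>\<close> that satisfies the Pieri
  recursion is determined by its value at the identity, because every \<open>w\<^sub>\<lambda>\<close> is the leading term of
  \<open>h\<^sub>a\<close> applied to the partition without its last row \<open>a\<close>. Both sides of the factorization, as
  functions of \<open>\<lambda>\<close>, satisfy the recursion and agree at the empty partition.
\<close>

section \<open>Affine permutations\<close>

text \<open>No description of the lower interval of the partition R_t \<union> \<lambda> is used,
  and no bijection between it and pairs of smaller elements; only the action of the letters is
  transported. The signs of the Pieri rule make this possible: D_i acts as -1 on a descent, so a
  letter that is idle in d_A * w contributes a factor -1, and 1 + D_i has no signs left on lower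
  sums. Behind this is the lifting property of the strong order, adapted to W\<degree>: a generator
  may lead from w out of W\<degree>, and elements of W\<degree> below s_i w must then be shown to
  lie below w, by a generator of the finite group acting from the right. Length and strong order are
  defined by words and reflections of the presented group; the faithful representation turns them
  into comparisons of values, which remain readable after a rotation although the rotation is not an
  element of the group. Since a rotation permutes the sets A with |A| = r and keeps words cyclically
  decreasing, it preserves the sum that gives h_r.\<close>

locale affine_index =
  fixes k :: nat
  assumes k_pos: "1 \<le> k"
begin

abbreviation n :: int where "n \<equiv> int k + 1"

text \<open>The index is any integer and not only a residue, so that \<open>i + 1\<close> and
  rotated words need no reduction; \<open>swap_mod\<close> returns to residues. For n = 2 the swaps
  still generate the infinite dihedral group.\<close>

definition swap :: "int \<Rightarrow> int \<Rightarrow> int" where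
  "swap i x = (if n dvd x - i then x + 1 else if n dvd x - (i + 1) then x - 1 else x)"

primrec perm :: "int list \<Rightarrow> int \<Rightarrow> int" where
  "perm [] = id"
| "perm (i # u) = swap i \<circ> perm u"

lemma n_ge_2: "2 \<le> n"
  using k_pos by simp

lemma mod_n: "0 \<le> x mod n" "x mod n < n"
  using pos_mod_sign[of n x] pos_mod_bound[of n x] by simp_all

declare cox_trans [trans]

lemma not_n_dvd: "0 < c \<Longrightarrow> c < n \<Longrightarrow> \<not> n dvd c"
  using zdvd_imp_le by fastforce

lemma swap_cong: "n dvd i - j \<Longrightarrow> swap i = swap j"
proof -
  assume d: "n dvd i - j"
  have "n dvd x - i \<longleftrightarrow> n dvd x - j" for x
    using dvd_add[of n "x - i" "i - j"] dvd_diff[of n "x - j" "i - j"] d by auto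
  moreover have "n dvd x - (i + 1) \<longleftrightarrow> n dvd x - (j + 1)" for x
    using calculation[of "x - 1"] by (simp add: algebra_simps)
  ultimately show ?thesis unfolding swap_def by (intro ext) presburger
qed

lemma swap_mod: "swap (i mod n) = swap i"
  by (rule swap_cong) (simp add: mod_eq_dvd_iff[symmetric])

lemma swap_self: "swap i i = i + 1" "swap i (i + 1) = i"
  using not_n_dvd[of 1] n_ge_2 by (auto simp: swap_def)

text \<open>Positions are written as i + r + nq with the offset r in a full period, so that each
  Coxeter relation becomes a finite case distinction on r. The bound \<open>c + 1 < n\<close> keeps
  the exchanged pair c, c + 1 inside the period.\<close>

lemma swap_offset:
  assumes "0 \<le> r" "r < n" "0 \<le> c" "c + 1 < n"
  shows "swap (i + c) (i + r + n * q) =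
    i + (if r = c then c + 1 else if r = c + 1 then c else r) + n * q"
proof -
  have d: "n dvd (r - d) + n * q \<longleftrightarrow> r = d" if "0 \<le> d" "d < n" for d
  proof
    assume "n dvd (r - d) + n * q"
    then have "n dvd r - d" by (metis dvd_add_left_iff dvd_triv_left)
    then show "r = d"
      using not_n_dvd[of "r - d"] not_n_dvd[of "d - r"] that assms
      by (metis diff_gt_0_iff_gt dvd_diff_commute linorder_neqE_linordered_idom
          minus_int_code(1) diff_left_mono order_le_less_trans zle_diff1_eq diff_ge_0_iff_ge
          diff_mono dual_order.strict_trans2)
  qed auto
  from d[of c] d[of "c + 1"] assms show ?thesis
    by (auto simp: swap_def algebra_simps)
qed

lemma offset_cases: obtains r q where "x = i + r + n * q" "0 \<le> r" "r < n"
proof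
  show "x = i + (x - i) mod n + n * ((x - i) div n)"
    using mult_div_mod_eq[of n "x - i"] by linarith
qed (rule mod_n)+

lemma swap_swap: "swap i (swap i x) = x"
proof -
  obtain r q where x: "x = i + r + n * q" "0 \<le> r" "r < n" by (rule offset_cases)
  show ?thesis
    unfolding x(1) using x n_ge_2 swap_offset[of _ 0 i q] by simp
qed

lemma swap_braid:
  assumes "2 \<le> k"
  shows "swap i (swap (i + 1) (swap i x)) = swap (i + 1) (swap i (swap (i + 1) x))"
proof -
  obtain r q where x: "x = i + r + n * q" "0 \<le> r" "r < n" by (rule offset_cases)
  show ?thesis
    unfolding x(1) using x assms swap_offset[of _ 0 i q] swap_offset[of _ 1 i q] by auto
qed

lemma swap_commute:
  assumes "(i - j) mod n \<notin> {0, 1, int k}"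
  shows "swap i (swap j x) = swap j (swap i x)"
proof -
  define c where "c = (i - j) mod n"
  have "c \<noteq> 0" "c \<noteq> 1" "c \<noteq> int k" "0 \<le> c" "c < n"
    using assms mod_n[of "i - j"] unfolding c_def by auto
  then have c: "1 < c" "c + 1 < n" by linarith+
  have i: "swap i = swap (j + c)"
    by (rule swap_cong) (simp add: c_def mod_eq_dvd_iff[symmetric] mod_simps)
  obtain r q where x: "x = j + r + n * q" "0 \<le> r" "r < n" by (rule offset_cases)
  show ?thesis
    unfolding i x(1) using x c swap_offset[of _ 0 j q] swap_offset[of _ c j q] by auto
qed

lemma perm_append: "perm (u @ v) = perm u \<circ> perm v"
  by (induction u) (auto simp: comp_assoc)

lemma perm_cox_equiv: "cox_equiv k u v \<Longrightarrow> perm u = perm v"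
proof (induction rule: cox_equiv.induct)
  case (cox_braid i j u v)
  then have "swap j = swap (i + 1)" using swap_mod by simp
  with cox_braid show ?case by (auto simp: perm_append fun_eq_iff swap_braid)
next
  case (cox_comm i j u v)
  then show ?case using swap_commute[of i j] by (simp add: perm_append fun_eq_iff)
qed (auto simp: perm_append fun_eq_iff swap_swap)

lemma perm_rev: "perm (rev u) (perm u x) = x" "perm u (perm (rev u) x) = x"
  by (induction u arbitrary: x) (auto simp: perm_append swap_swap)

lemma bij_perm: "bij (perm u)"
  by (rule o_bij[of "perm (rev u)"]) (auto simp: fun_eq_iff perm_rev)

abbreviation finv :: "(int \<Rightarrow> int) \<Rightarrow> int \<Rightarrow> int" where "finv \<equiv> inv_into UNIV"

lemma finv_perm: "finv (perm u) = perm (rev u)"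
  by (rule inv_equality) (auto simp: perm_rev)

lemma swap_shift: "swap i (x + n * q) = swap i x + n * q"
proof -
  have *: "n dvd x + n * q - j \<longleftrightarrow> n dvd x - j" for j
    by (metis add_diff_eq diff_add_eq dvd_add_left_iff dvd_triv_left)
  show ?thesis unfolding swap_def * by auto
qed

lemma perm_shift: "perm u (x + n * q) = perm u x + n * q"
  by (induction u arbitrary: x) (auto simp: swap_shift)

lemma perm_dvd: "n dvd y - x \<Longrightarrow> perm u y - perm u x = y - x"
proof -
  assume "n dvd y - x"
  then obtain q where "y = x + n * q" by (metis add.commute diff_add_cancel dvdE)
  then show ?thesis using perm_shift[of u x q] by simp
qed

lemma perm_dvd_iff: "n dvd perm u y - perm u x \<longleftrightarrow> n dvd y - x"
  using perm_dvd[of y x u] perm_dvd[of "perm u y" "perm u x" "rev u"] by (auto simp: perm_rev)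

text \<open>Every integer moves by at most one, so only a pair i + nq, i + 1 + nq can be reversed.
  The strong exchange condition, the lifting property and the commutation of left and right Demazure
  operators all come down to this.\<close>

lemma swap_less:
  assumes "x < y" "swap i y \<le> swap i x"
  shows "y = x + 1" "n dvd x - i"
proof -
  have b: "swap i z \<le> z + 1" "z - 1 \<le> swap i z" for z by (auto simp: swap_def)
  have inj: "swap i x \<noteq> swap i y" using assms swap_swap by (metis less_irrefl)
  show "y = x + 1" using b[of x] b[of y] assms inj by linarith
  moreover from this show "n dvd x - i"
    using assms inj by (auto simp: swap_def split: if_splits)
qed

section \<open>Length of words and the descent criterion\<close>

definition word_len :: "int list \<Rightarrow> nat" where "word_len u = len (word_class k u)"

abbreviation I :: "int set" where "I \<equiv> index_set k"

lemma mem_word_class: "u \<in> lists I \<Longrightarrow> v \<in> word_class k u \<longleftrightarrow> v \<in> lists I \<and> cox_equiv k u v"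
  by (auto simp: word_class_def cox_rel_def)

lemma word_len_cong: "u \<in> lists I \<Longrightarrow> v \<in> lists I \<Longrightarrow> cox_equiv k u v \<Longrightarrow> word_len u = word_len v"
  unfolding word_len_def using word_class_eq_iff[of u k v] by metis

lemma word_len_le: "u \<in> lists I \<Longrightarrow> v \<in> lists I \<Longrightarrow> cox_equiv k u v \<Longrightarrow> word_len u \<le> length v"
  unfolding word_len_def len_def by (rule Least_le) (use mem_word_class in blast)

lemma word_len_min:
  assumes "u \<in> lists I"
  obtains v where "v \<in> lists I" "cox_equiv k u v" "length v = word_len u"
proof -
  have "length u \<in> length ` word_class k u"
    using assms mem_word_class cox_refl by blast
  then have "word_len u \<in> length ` word_class k u"
    unfolding word_len_def len_def by (rule LeastI)
  then obtain v where "v \<in> word_class k u" "length v = word_len u" by force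
  then show ?thesis using that mem_word_class[OF assms] by blast
qed

text \<open>Each relation has sides of equal parity. This excludes that a letter leaves the length
  unchanged.\<close>

lemma cox_equiv_parity: "cox_equiv k u v \<Longrightarrow> even (length u) = even (length v)"
  by (induction rule: cox_equiv.induct) auto

lemma word_len_parity: "u \<in> lists I \<Longrightarrow> even (word_len u) = even (length u)"
  by (metis word_len_min cox_equiv_parity)

lemma word_len_snoc_le: "u \<in> lists I \<Longrightarrow> i \<in> I \<Longrightarrow> word_len (u @ [i]) \<le> word_len u + 1"
proof -
  assume u: "u \<in> lists I" "i \<in> I"
  then obtain v where v: "v \<in> lists I" "cox_equiv k u v" "length v = word_len u"
    using word_len_min by blast
  then have "word_len (u @ [i]) \<le> length (v @ [i])"
    using u by (intro word_len_le) (auto intro: cox_equiv_append_right)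
  then show ?thesis using v by simp
qed

lemma word_len_snoc2: "u \<in> lists I \<Longrightarrow> i \<in> I \<Longrightarrow> word_len (u @ [i, i]) = word_len u"
  using cox_square[of i k u "[]"] by (intro word_len_cong) auto

lemma word_len_snoc:
  assumes "u \<in> lists I" "i \<in> I"
  shows "word_len (u @ [i]) = word_len u + 1 \<or> word_len u = word_len (u @ [i]) + 1"
proof -
  have "word_len u \<le> word_len (u @ [i]) + 1"
    using word_len_snoc_le[of "u @ [i]" i] word_len_snoc2[of u i] assms by simp
  moreover have "even (word_len (u @ [i])) \<noteq> even (word_len u)"
    using assms by (subst (1 2) word_len_parity) auto
  then have "word_len (u @ [i]) \<noteq> word_len u" by auto
  ultimately show ?thesis using word_len_snoc_le[OF assms] by linarith
qed

lemma perm_asc_cong: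
  "n dvd i - j \<Longrightarrow> perm u i < perm u (i + 1) \<longleftrightarrow> perm u j < perm u (j + 1)"
  using perm_dvd[of i j u] perm_dvd[of "i + 1" "j + 1" u] by auto

text \<open>
  Tits' argument: split a shortest word for \<open>u\<close> along the dihedral subgroup generated by \<open>i\<close> and
  its last letter \<open>j\<close>. For \<open>k = 1\<close> that subgroup is infinite, but there the differences of \<open>perm u\<close>
  at 0 and at 1 add up to 2, so a descent at \<open>j\<close> forces an ascent at \<open>i\<close>.
\<close>

lemma word_len_ascent:
  assumes "u \<in> lists I" "i \<in> I" "word_len (u @ [i]) > word_len u"
  shows "perm u i < perm u (i + 1)"
  using assms
proof (induction "word_len u" arbitrary: u i rule: less_induct)
  case less
  note u = less.prems(1) and i = less.prems(2)
  show ?case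
  proof (cases "word_len u = 0")
    case True
    with word_len_min[OF u] have "cox_equiv k u []" by (metis length_0_conv)
    then have "perm u = id" using perm_cox_equiv by fastforce
    then show ?thesis by simp
  next
    case False
    then obtain v where v: "v \<in> lists I" "cox_equiv k u v" "length v = word_len u" "v \<noteq> []"
      using word_len_min[OF u] by (metis length_0_conv)
    then obtain w j where w: "v = w @ [j]" by (metis rev_exhaust)
    have wj: "w \<in> lists I" "j \<in> I" using v w by auto
    have Lu: "word_len u = word_len (w @ [j])" using v w word_len_cong u by blast
    have evu: "perm u = perm w \<circ> swap j" using perm_cox_equiv[OF v(2)] w by (simp add: perm_append)
    have "word_len w \<le> length w" using wj(1) by (intro word_len_le) (auto intro: cox_refl)
    then have Lw: "word_len w + 1 = word_len u" using word_len_snoc[OF wj] Lu v(3) w by simp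
    have uw: "cox_equiv k (u @ x) (w @ [j] @ x)" for x
      using cox_equiv_append_right[OF v(2), of x] w by simp
    have ij: "i \<noteq> j"
    proof
      assume "i = j"
      then have "word_len (u @ [i]) = word_len (w @ [i, i])"
        using u i wj uw[of "[i]"] by (intro word_len_cong) auto
      then show False using word_len_snoc2[of w i] wj i less.prems(3) Lw by simp
    qed
    have jw: "perm w j < perm w (j + 1)" using less.hyps[of w j] Lw wj Lu by simp
    \<comment> \<open>If w also descends at i, then w2 = w s_i is two shorter than u, so the
      induction hypothesis is available for w2 at i and, once the length is known to grow there, at
      j.\<close>
    have down: "\<exists>w2. w2 \<in> lists I \<and> cox_equiv k w (w2 @ [i]) \<and> word_len w2 + 2 = word_len u \<and>
       perm w2 i < perm w2 (i + 1)"
      if "\<not> word_len (w @ [i]) > word_len w"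
    proof -
      have l: "word_len (w @ [i]) + 1 = word_len w" using that word_len_snoc[OF wj(1) i] by auto
      have "cox_equiv k w (w @ [i, i])" using cox_square[of i k w "[]"] i by (simp add: cox_sym)
      moreover have "perm (w @ [i]) i < perm (w @ [i]) (i + 1)"
        using less.hyps[of "w @ [i]" i] l Lw wj i word_len_snoc2[of w i] by simp
      ultimately show ?thesis using l Lw wj i by (intro exI[of _ "w @ [i]"]) auto
    qed
    consider (dihedral) "k = 1" | (up) "k \<ge> 2" "(j - i) mod n = 1"
      | (dn) "k \<ge> 2" "(i - j) mod n = 1" | (comm) "k \<ge> 2" "(i - j) mod n \<notin> {0,1,int k}"
    proof -
      have "(j - i) mod n = 1" if "(i - j) mod n = int k"
      proof -
        have "(j - i) mod n = (- ((i - j) mod n)) mod n" by (simp add: mod_simps)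
        also have "\<dots> = (- int k + n) mod n" unfolding that by (simp only: mod_add_self2)
        finally show ?thesis using k_pos by simp
      qed
      moreover have "(i - j) mod n \<noteq> 0"
      proof
        assume "(i - j) mod n = 0"
        then have "i mod n = j mod n" by (simp add: mod_eq_dvd_iff dvd_eq_mod_eq_0)
        then show False using ij i wj(2) by (auto simp: index_set_def)
      qed
      ultimately show thesis using that k_pos by fastforce
    qed
    then show ?thesis
    proof cases
      case dihedral
      with ij i wj have c: "i = 0 \<and> j = 1 \<or> i = 1 \<and> j = 0" by (auto simp: index_set_def)
      have p: "perm w (x + 2) = perm w x + 2" for x using perm_shift[of w x 1] dihedral by simp
      have q: "perm u (x + 2) = perm u x + 2" for x using perm_shift[of u x 1] dihedral by simp
      have "perm u j > perm u (j + 1)" using jw unfolding evu by (simp add: swap_self)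
      then show ?thesis using c q[of 0] by auto
    next
      case up
      have d: "n dvd j - (i + 1)"
        using up by (metis mod_eq_dvd_iff diff_diff_eq mod_mod_trivial dvd_minus_mod diff_diff_eq)
      have sj: "swap j = swap (i + 1)" by (rule swap_cong[OF d])
      have jw': "perm w (i + 1) < perm w (i + 2)"
        using jw perm_asc_cong[OF d, of w] by (simp add: add.assoc)
      have si: "swap (i + 1) i = i" "swap (i + 1) (i + 1) = i + 2"
        using swap_offset[of 0 1 i 0] swap_offset[of 1 1 i 0] up(1) by auto
      show ?thesis
      proof (cases "word_len (w @ [i]) > word_len w")
        case True
        then have "perm w i < perm w (i + 1)" using less.hyps[of w i] Lw wj i by simp
        then show ?thesis using jw' unfolding evu sj by (simp add: si)
      next
        case False
        then obtain w2 where w2: "w2 \<in> lists I" "cox_equiv k w (w2 @ [i])"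
            "word_len w2 + 2 = word_len u"
          using down by blast
        \<comment> \<open>If w2 descended at j, the braid relation would give u s_i = (w2 s_j) s_i
          s_j, of length at most two more than w2 s_j and hence less than that of u.\<close>
        have up2: "word_len (w2 @ [j]) > word_len w2"
        proof (rule ccontr)
          assume "\<not> ?thesis"
          then have l: "word_len (w2 @ [j]) + 1 = word_len w2"
            using word_len_snoc[OF w2(1) wj(2)] by auto
          have j: "j = (i + 1) mod n" using d wj(2) by (metis index_set_def atLeastAtMost_iff
                mod_eq_dvd_iff mod_pos_pos_trivial zle_add1_eq_le)
          have "cox_equiv k (u @ [i]) (w @ [j, i])" using uw[of "[i]"] by simp
          also have "cox_equiv k (w @ [j, i]) (w2 @ [i, j, i])"
            using cox_equiv_append_right[OF w2(2), of "[j, i]"] by simp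
          also have "cox_equiv k (w2 @ [i, j, i]) (w2 @ [j, i, j])"
            using cox_braid[OF up(1) i j, of w2 "[]"] by simp
          finally have "word_len (u @ [i]) = word_len ((w2 @ [j]) @ [i, j])"
            using u i wj w2 by (intro word_len_cong) auto
          also have "\<dots> \<le> word_len (w2 @ [j]) + 2"
            using word_len_snoc_le[of "w2 @ [j] @ [i]" j] word_len_snoc_le[of "w2 @ [j]" i] wj w2 i
            by simp
          finally show False using l w2(3) less.prems(3) by simp
        qed
        then have "perm w2 j < perm w2 (j + 1)" using less.hyps[of w2 j] wj w2 by simp
        then have "perm w2 (i + 1) < perm w2 (i + 2)"
          using perm_asc_cong[OF d, of w2] by (simp add: add.assoc)
        moreover have "perm w = perm w2 \<circ> swap i"
          using perm_cox_equiv[OF w2(2)] by (simp add: perm_append)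
        moreover have "swap i (i + 2) = i + 2" using swap_offset[of 2 0 i 0] up(1) by auto
        ultimately show ?thesis unfolding evu sj by (simp only: comp_apply si swap_self[of i])
      qed
    next
      case dn
      have d: "n dvd i - (j + 1)"
        using dn by (metis mod_eq_dvd_iff diff_diff_eq mod_mod_trivial dvd_minus_mod diff_diff_eq)
      then have d': "n dvd j - (i - 1)"
        by (metis diff_diff_eq2 dvd_diff_commute add.commute diff_add_eq)
      have sj: "swap j = swap (i - 1)" by (rule swap_cong[OF d'])
      have jw': "perm w (i - 1) < perm w i" using jw perm_asc_cong[OF d', of w] by simp
      have si: "swap (i - 1) i = i - 1" "swap (i - 1) (i + 1) = i + 1"
        using swap_offset[of 2 0 "i - 1" 0] swap_self[of "i - 1"] dn(1) by (auto simp: add.commute)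
      show ?thesis
      proof (cases "word_len (w @ [i]) > word_len w")
        case True
        then have "perm w i < perm w (i + 1)" using less.hyps[of w i] Lw wj i by simp
        then show ?thesis using jw' unfolding evu sj by (simp add: si)
      next
        case False
        then obtain w2 where w2: "w2 \<in> lists I" "cox_equiv k w (w2 @ [i])"
            "word_len w2 + 2 = word_len u"
          using down by blast
        have up2: "word_len (w2 @ [j]) > word_len w2"
        proof (rule ccontr)
          assume "\<not> ?thesis"
          then have l: "word_len (w2 @ [j]) + 1 = word_len w2"
            using word_len_snoc[OF w2(1) wj(2)] by auto
          have j: "i = (j + 1) mod n" using d i by (metis index_set_def atLeastAtMost_iff
                mod_eq_dvd_iff mod_pos_pos_trivial zle_add1_eq_le)
          have "cox_equiv k (u @ [i]) (w @ [j, i])" using uw[of "[i]"] by simp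
          also have "cox_equiv k (w @ [j, i]) (w2 @ [i, j, i])"
            using cox_equiv_append_right[OF w2(2), of "[j, i]"] by simp
          also have "cox_equiv k (w2 @ [i, j, i]) (w2 @ [j, i, j])"
            using cox_sym[OF cox_braid[OF dn(1) wj(2) j, of w2 "[]"]] by simp
          finally have "word_len (u @ [i]) = word_len ((w2 @ [j]) @ [i, j])"
            using u i wj w2 by (intro word_len_cong) auto
          also have "\<dots> \<le> word_len (w2 @ [j]) + 2"
            using word_len_snoc_le[of "w2 @ [j] @ [i]" j] word_len_snoc_le[of "w2 @ [j]" i] wj w2 i
            by simp
          finally show False using l w2(3) less.prems(3) by simp
        qed
        then have "perm w2 j < perm w2 (j + 1)" using less.hyps[of w2 j] wj w2 by simp
        then have "perm w2 (i - 1) < perm w2 i"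
          using perm_asc_cong[OF d', of w2] by simp
        moreover have "perm w = perm w2 \<circ> swap i"
          using perm_cox_equiv[OF w2(2)] by (simp add: perm_append)
        moreover have "swap i (i - 1) = i - 1" using swap_offset[of 0 1 "i - 1" 0] dn(1) by auto
        ultimately show ?thesis unfolding evu sj by (simp add: si swap_self)
      qed
    next
      case comm
      have up2: "word_len (w @ [i]) > word_len w"
      proof (rule ccontr)
        assume "\<not> ?thesis"
        then obtain w2 where w2: "w2 \<in> lists I" "cox_equiv k w (w2 @ [i])"
            "word_len w2 + 2 = word_len u"
          using down by blast
        have "cox_equiv k (u @ [i]) (w @ [j, i])" using uw[of "[i]"] by simp
        also have "cox_equiv k (w @ [j, i]) (w @ [i, j])"
          using cox_sym[OF cox_comm[OF i wj(2) comm(2), of w "[]"]] by simp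
        also have "cox_equiv k (w @ [i, j]) (w2 @ [i, i, j])"
          using cox_equiv_append_right[OF w2(2), of "[i, j]"] by simp
        also have "cox_equiv k (w2 @ [i, i, j]) (w2 @ [j])"
          using cox_square[OF i, of w2 "[j]"] by simp
        finally have "word_len (u @ [i]) = word_len (w2 @ [j])"
          using u i wj w2 by (intro word_len_cong) auto
        then show False using word_len_snoc_le[OF w2(1) wj(2)] w2(3) less.prems(3) by simp
      qed
      then have "perm w i < perm w (i + 1)" using less.hyps[of w i] Lw wj i by simp
      moreover have "swap j i = i \<and> swap j (i + 1) = i + 1"
      proof -
        define c where "c = (i - j) mod n"
        have "c \<noteq> 0" "c \<noteq> 1" "c \<noteq> int k" "0 \<le> c" "c < n"
          using comm(2) mod_n[of "i - j"] unfolding c_def by auto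
        then have c: "1 < c" "c + 1 < n" by linarith+
        have i: "i = j + c + n * ((i - j) div n)"
          unfolding c_def using mult_div_mod_eq[of n "i - j"] by linarith
        have "swap j (j + c + n * ((i - j) div n)) = j + c + n * ((i - j) div n)"
          "swap j (j + (c + 1) + n * ((i - j) div n)) = j + (c + 1) + n * ((i - j) div n)"
          using swap_offset[of c 0 j "(i - j) div n"] swap_offset[of "c + 1" 0 j "(i - j) div n"] c
          by simp_all
        moreover have "i + 1 = j + (c + 1) + n * ((i - j) div n)" using i by linarith
        ultimately show ?thesis using i by metis
      qed
      ultimately show ?thesis unfolding evu by simp
    qed
  qed
qed

section \<open>Faithfulness of the representation\<close>

lemma rev_cancel: "u \<in> lists I \<Longrightarrow> cox_equiv k (rev u @ u) []"
proof (induction u)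
  case (Cons i u)
  then have "cox_equiv k (rev u @ [i, i] @ u) (rev u @ u)" by (intro cox_square) auto
  with Cons show ?case by (auto intro: cox_trans)
qed (simp add: cox_refl)

text \<open>A nonempty shortest word ends in a letter at which its product descends, whereas the
  identity has no descent.\<close>

lemma word_len_eq_0:
  assumes u: "u \<in> lists I" and "perm u = id"
  shows "word_len u = 0"
proof (rule ccontr)
  assume "word_len u \<noteq> 0"
  then obtain v where v: "v \<in> lists I" "cox_equiv k u v" "length v = word_len u" "v \<noteq> []"
    using word_len_min[OF u] by (metis length_0_conv)
  then obtain w j where w: "v = w @ [j]" by (metis rev_exhaust)
  have wj: "w \<in> lists I" "j \<in> I" using v w by auto
  have "word_len w \<le> length w" using wj(1) by (intro word_len_le) (auto intro: cox_refl)
  moreover have "word_len u = word_len (w @ [j])" using v w word_len_cong u by blast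
  ultimately have "perm w j < perm w (j + 1)" using word_len_ascent[OF wj] v(3) w by simp
  moreover have "perm u = perm w \<circ> swap j"
    using perm_cox_equiv[OF v(2)] w by (simp add: perm_append)
  ultimately have "perm u (j + 1) < perm u j" by (simp add: swap_self)
  with assms(2) show False by simp
qed

lemma perm_faithful:
  assumes u: "u \<in> lists I" and v: "v \<in> lists I" and e: "perm u = perm v"
  shows "cox_equiv k u v"
proof -
  have "perm (u @ rev v) = id" using e by (auto simp: perm_append perm_rev fun_eq_iff)
  moreover have uv: "u @ rev v \<in> lists I" using u v by auto
  ultimately have "word_len (u @ rev v) = 0" by (intro word_len_eq_0)
  with word_len_min[OF uv] have "cox_equiv k (u @ rev v) []" by (metis length_0_conv)
  then have "cox_equiv k (u @ rev v @ v) v" using cox_equiv_append_right by fastforce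
  moreover have "cox_equiv k (u @ rev v @ v) u"
    using cox_equiv_append_left[OF rev_cancel[OF v], of u] by simp
  ultimately show ?thesis by (blast intro: cox_sym cox_trans)
qed

text \<open>By faithfulness this is the class of words that represents f, so functions in
  \<open>Aff\<close> can replace elements of the quotient. For f outside \<open>Aff\<close> the set
  is empty.\<close>

definition elt :: "(int \<Rightarrow> int) \<Rightarrow> int list set" where
  "elt f = {u \<in> lists I. perm u = f}"

definition Aff :: "(int \<Rightarrow> int) set" where "Aff = range perm"

definition plen :: "(int \<Rightarrow> int) \<Rightarrow> nat" where "plen f = len (elt f)"

lemma word_class_eq_elt: "u \<in> lists I \<Longrightarrow> word_class k u = elt (perm u)"
  using mem_word_class[of u] perm_faithful[of u] perm_cox_equiv unfolding elt_def by fastforce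

lemma reduce_letters: "map (\<lambda>i. i mod n) u \<in> lists I" "perm (map (\<lambda>i. i mod n) u) = perm u"
proof -
  show "map (\<lambda>i. i mod n) u \<in> lists I"
    using mod_n by (fastforce simp: index_set_def)
  show "perm (map (\<lambda>i. i mod n) u) = perm u"
    by (induction u) (auto simp: swap_mod)
qed

lemma Aff_cases:
  assumes "f \<in> Aff"
  obtains u where "u \<in> lists I" "f = perm u"
  using assms reduce_letters unfolding Aff_def by (metis rangeE)

lemma perm_Aff [simp]: "perm u \<in> Aff" by (auto simp: Aff_def)

lemma id_Aff [simp]: "id \<in> Aff" using perm_Aff[of "[]"] by simp

lemma swap_Aff [simp]: "swap i \<in> Aff" using perm_Aff[of "[i]"] by simp

lemma comp_Aff [simp]: "f \<in> Aff \<Longrightarrow> g \<in> Aff \<Longrightarrow> f \<circ> g \<in> Aff"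
  unfolding Aff_def by (auto simp: perm_append[symmetric])

lemma finv_Aff [simp]: "f \<in> Aff \<Longrightarrow> finv f \<in> Aff"
  unfolding Aff_def by (auto simp: finv_perm)

lemma finv_f [simp]: "f \<in> Aff \<Longrightarrow> finv f (f x) = x" "f \<in> Aff \<Longrightarrow> f (finv f x) = x"
  unfolding Aff_def by (auto simp: finv_perm perm_rev)

lemma finv_comp [simp]: "f \<in> Aff \<Longrightarrow> finv f \<circ> f = id" "f \<in> Aff \<Longrightarrow> f \<circ> finv f = id"
  by (auto simp: fun_eq_iff)

lemma Aff_eq_iff: "f \<in> Aff \<Longrightarrow> f x = f y \<longleftrightarrow> x = y"
  by (metis finv_f(1))

lemma finv_eq: "f \<in> Aff \<Longrightarrow> (\<And>x. g (f x) = x) \<Longrightarrow> finv f = g"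
  by (metis finv_f(2) ext)

lemma finv_finv [simp]: "f \<in> Aff \<Longrightarrow> finv (finv f) = f"
  by (rule finv_eq) auto

lemma finv_mult: "f \<in> Aff \<Longrightarrow> g \<in> Aff \<Longrightarrow> finv (f \<circ> g) = finv g \<circ> finv f"
  by (rule finv_eq) auto

lemma finv_swap [simp]: "finv (swap i) = swap i"
  by (rule finv_eq) (auto simp: swap_swap)

lemma swap_comp_swap [simp]: "swap i \<circ> swap i = id" "swap i \<circ> (swap i \<circ> f) = f"
    "f \<circ> swap i \<circ> swap i = f"
  by (auto simp: fun_eq_iff swap_swap)

lemma Aff_shift: "f \<in> Aff \<Longrightarrow> f (x + n * q) = f x + n * q"
  unfolding Aff_def using perm_shift by auto

lemma Aff_dvd: "f \<in> Aff \<Longrightarrow> n dvd y - x \<Longrightarrow> f y - f x = y - x"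
  unfolding Aff_def using perm_dvd by auto

lemma Aff_dvd_iff: "f \<in> Aff \<Longrightarrow> n dvd f y - f x \<longleftrightarrow> n dvd y - x"
  unfolding Aff_def using perm_dvd_iff by auto

lemma elt_mem: "u \<in> elt f \<longleftrightarrow> u \<in> lists I \<and> perm u = f"
  by (simp add: elt_def)

lemma elt_inj: "f \<in> Aff \<Longrightarrow> elt f = elt g \<Longrightarrow> f = g"
  using Aff_cases elt_mem by metis

lemma plen_perm: "u \<in> lists I \<Longrightarrow> plen (perm u) = word_len u"
  by (simp add: plen_def word_len_def word_class_eq_elt)

lemma plen_le: "plen (perm u) \<le> length u"
proof -
  have "plen (perm u) = word_len (map (\<lambda>i. i mod n) u)"
    using plen_perm[OF reduce_letters(1)] reduce_letters(2) by simp
  also have "\<dots> \<le> length (map (\<lambda>i. i mod n) u)"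
    by (rule word_len_le[OF reduce_letters(1) reduce_letters(1) cox_refl])
  finally show ?thesis by simp
qed

lemma plen_obtain:
  assumes "f \<in> Aff"
  obtains u where "u \<in> lists I" "perm u = f" "length u = plen f"
proof -
  obtain u where u: "u \<in> lists I" "f = perm u" using assms by (rule Aff_cases)
  obtain v where v: "v \<in> lists I" "cox_equiv k u v" "length v = word_len u"
    using word_len_min[OF u(1)] .
  with that[of v] perm_cox_equiv[OF v(2)] u show thesis using plen_perm by metis
qed

lemma plen_id [simp]: "plen id = 0"
  using plen_le[of "[]"] by simp

lemma plen_eq_0: "f \<in> Aff \<Longrightarrow> plen f = 0 \<Longrightarrow> f = id"
  by (metis plen_obtain perm.simps(1) length_0_conv)

text \<open>\<open>word_len_ascent\<close> gives one direction; applied to f s_i, where the values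
  at i and i + 1 have changed places, it gives the other. By periodicity i may be any
  integer.\<close>

lemma plen_right:
  assumes f: "f \<in> Aff"
  shows "f i < f (i + 1) \<Longrightarrow> plen (f \<circ> swap i) = plen f + 1"
    and "f (i + 1) < f i \<Longrightarrow> plen f = plen (f \<circ> swap i) + 1"
proof -
  have mem: "i mod n \<in> I" using mod_n by (simp add: index_set_def)
  have d: "n dvd i - i mod n" by simp
  obtain u where u: "u \<in> lists I" "f = perm u" using f by (rule Aff_cases)
  have 1: "plen (f \<circ> swap i) = word_len (u @ [i mod n])"
    using u mem plen_perm[of "u @ [i mod n]"] by (simp add: perm_append swap_mod)
  have 2: "plen f = word_len u" using u plen_perm by simp
  have up: "f i < f (i + 1)" if "word_len (u @ [i mod n]) > word_len u"
    using word_len_ascent[OF u(1) mem that] perm_asc_cong[OF d, of u] u by simp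
  have dn: "f (i + 1) < f i" if "word_len (u @ [i mod n]) < word_len u"
  proof -
    have "word_len ((u @ [i mod n]) @ [i mod n]) > word_len (u @ [i mod n])"
      using that word_len_snoc2[OF u(1) mem] by simp
    then have "perm (u @ [i mod n]) (i mod n) < perm (u @ [i mod n]) (i mod n + 1)"
      using u mem by (intro word_len_ascent) auto
    then have "perm (u @ [i mod n]) i < perm (u @ [i mod n]) (i + 1)"
      using perm_asc_cong[OF d] by simp
    then show ?thesis using u by (simp add: perm_append swap_mod swap_self)
  qed
  from up dn 1 2 word_len_snoc[OF u(1) mem]
  show "f i < f (i + 1) \<Longrightarrow> plen (f \<circ> swap i) = plen f + 1"
    and "f (i + 1) < f i \<Longrightarrow> plen f = plen (f \<circ> swap i) + 1"
    by fastforce+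
qed

lemma plen_finv: "f \<in> Aff \<Longrightarrow> plen (finv f) = plen f"
proof -
  have *: "plen (finv f) \<le> plen f" if "f \<in> Aff" for f
    using that by (metis plen_obtain plen_le finv_perm length_rev)
  show "f \<in> Aff \<Longrightarrow> plen (finv f) = plen f"
    using *[of f] *[of "finv f"] by simp
qed

lemma plen_left:
  assumes f: "f \<in> Aff"
  shows "finv f i < finv f (i + 1) \<Longrightarrow> plen (swap i \<circ> f) = plen f + 1"
    and "finv f (i + 1) < finv f i \<Longrightarrow> plen f = plen (swap i \<circ> f) + 1"
  using plen_right[of "finv f" i] plen_finv[of "swap i \<circ> f"] plen_finv[of f] f
  by (simp_all add: finv_mult)

lemma asc_cases: "f \<in> Aff \<Longrightarrow> f i < f (i + 1) \<or> f (i + 1) < f i"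
  using Aff_eq_iff[of f i "i + 1"] by linarith

lemma plen_left_iff: "f \<in> Aff \<Longrightarrow> plen f < plen (swap i \<circ> f) \<longleftrightarrow> finv f i < finv f (i + 1)"
  using plen_left[of f i] asc_cases[of "finv f" i] by fastforce

lemma plen_right_iff: "f \<in> Aff \<Longrightarrow> plen f < plen (f \<circ> swap i) \<longleftrightarrow> f i < f (i + 1)"
  using plen_right[of f i] asc_cases[of "f" i] by fastforce

section \<open>Reflections and the Bruhat order\<close>

text \<open>For n not dividing b - a this is the affine reflection that exchanges a + nq and b + nq
  for every q; otherwise the first case takes precedence and the map is no reflection. That a
  transposition belongs to the group is not shown for all a and b;
  \<open>transposition a b \<in> Refl\<close> appears as a hypothesis where it matters.\<close>

definition transposition :: "int \<Rightarrow> int \<Rightarrow> int \<Rightarrow> int" where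
  "transposition a b x =
      (if n dvd x - a then x + (b - a) else if n dvd x - b then x - (b - a) else x)"

definition Refl :: "(int \<Rightarrow> int) set" where
  "Refl = {f \<circ> swap i \<circ> finv f | f i. f \<in> Aff}"

lemma transposition_conj: "f \<in> Aff \<Longrightarrow> f \<circ> transposition a b \<circ> finv f = transposition (f a) (f b)"
proof (rule ext)
  fix x assume f: "f \<in> Aff"
  define y where "y = finv f x"
  have x: "x = f y" using f by (simp add: y_def)
  have "f (transposition a b y) = transposition (f a) (f b) (f y)"
  proof -
    have iff: "n dvd f y - f a \<longleftrightarrow> n dvd y - a" "n dvd f y - f b \<longleftrightarrow> n dvd y - b"
      using Aff_dvd_iff[OF f] by auto
    have "f (y + (b - a)) = f y + (f b - f a)" if "n dvd y - a"
    proof -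
      have "f (y + (b - a)) - f b = y + (b - a) - b"
        using that by (intro Aff_dvd[OF f]) (simp add: algebra_simps)
      with Aff_dvd[OF f that] show ?thesis by linarith
    qed
    moreover have "f (y - (b - a)) = f y - (f b - f a)" if "n dvd y - b"
    proof -
      have "f (y - (b - a)) - f a = y - (b - a) - a"
        using that by (intro Aff_dvd[OF f]) (simp add: algebra_simps)
      with Aff_dvd[OF f that] show ?thesis by linarith
    qed
    ultimately show ?thesis unfolding transposition_def iff by simp
  qed
  then show "(f \<circ> transposition a b \<circ> finv f) x = transposition (f a) (f b) x"
    using f unfolding x by simp
qed

lemma transposition_comp: "f \<in> Aff \<Longrightarrow> f \<circ> transposition a b = transposition (f a) (f b) \<circ> f"
  using transposition_conj[of f a b] by (auto simp: fun_eq_iff) (metis finv_f(1))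

lemma transposition_swap: "transposition i (i + 1) = swap i"
  by (auto simp: transposition_def swap_def)

lemma transposition_swap_dvd: "n dvd a - i \<Longrightarrow> transposition a (a + 1) = swap i"
  using transposition_swap swap_cong by metis

lemma transposition_commute: "\<not> n dvd b - a \<Longrightarrow> transposition a b = transposition b a"
proof (rule ext)
  fix x assume "\<not> n dvd b - a"
  then have "\<not> (n dvd x - a \<and> n dvd x - b)" using dvd_diff[of n "x - a" "x - b"] by auto
  then show "transposition a b x = transposition b a x" by (auto simp: transposition_def)
qed

lemma transposition_self: "\<not> n dvd b - a \<Longrightarrow> transposition a b a = b"
    "\<not> n dvd b - a \<Longrightarrow> transposition a b b = a"
  by (auto simp: transposition_def)

lemma Refl_Aff: "r \<in> Refl \<Longrightarrow> r \<in> Aff" by (auto simp: Refl_def)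

lemma Refl_invol: "r \<in> Refl \<Longrightarrow> r \<circ> r = id"
  by (auto simp: Refl_def fun_eq_iff swap_swap)

lemma Refl_conj: "r \<in> Refl \<Longrightarrow> g \<in> Aff \<Longrightarrow> g \<circ> r \<circ> finv g \<in> Refl"
proof -
  assume "r \<in> Refl" and g: "g \<in> Aff"
  then obtain f i where f: "r = f \<circ> swap i \<circ> finv f" "f \<in> Aff" by (auto simp: Refl_def)
  have "g \<circ> r \<circ> finv g = (g \<circ> f) \<circ> swap i \<circ> finv (g \<circ> f)"
    using f g by (simp add: finv_mult comp_assoc)
  then show ?thesis using f g unfolding Refl_def by (intro CollectI exI[of _ "g \<circ> f"]) auto
qed

lemma swap_Refl: "swap i \<in> Refl"
  unfolding Refl_def by (intro CollectI exI[of _ id] exI[of _ i]) auto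

lemma Refl_transposition:
  assumes "r \<in> Refl"
  obtains a b where "a < b" "\<not> n dvd b - a" "r = transposition a b"
proof -
  obtain f i where f: "r = f \<circ> swap i \<circ> finv f" "f \<in> Aff" using assms by (auto simp: Refl_def)
  have r: "r = transposition (f i) (f (i + 1))"
    using f transposition_conj[of f i "i + 1"] by (simp add: transposition_swap)
  have "\<not> n dvd (i + 1) - i" using not_n_dvd[of 1] n_ge_2 by simp
  then have d: "\<not> n dvd f (i + 1) - f i" using Aff_dvd_iff[OF f(2)] by blast
  show thesis
  proof (cases "f i < f (i + 1)")
    case True
    with that r d show ?thesis by blast
  next
    case False
    then show ?thesis
      using that[of "f (i + 1)" "f i"] r d transposition_commute[OF d] asc_cases[OF f(2), of i]
      by (metis dvd_diff_commute)
  qed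
qed

text \<open>The strong exchange condition. Reading the word from the right, some letter first
  reverses the values of a and b. By \<open>swap_less\<close> it exchanges exactly these two values,
  so it acts as the reflection does and can be deleted.\<close>

lemma word_transposition:
  assumes "a < b" "\<not> n dvd b - a" "perm u b < perm u a"
  shows "\<exists>v. length v < length u \<and> perm v = perm u \<circ> transposition a b"
  using assms(3)
proof (induction u)
  case (Cons i u)
  show ?case
  proof (cases "perm u b < perm u a")
    case True
    then obtain v where "length v < length u" "perm v = perm u \<circ> transposition a b"
      using Cons by blast
    then show ?thesis by (intro exI[of _ "i # v"]) (auto simp: comp_assoc)
  next
    case False
    then have "perm u a < perm u b" using assms(1) Aff_eq_iff[of "perm u" a b] by force
    then have "perm u b = perm u a + 1" "n dvd perm u a - i"
      using swap_less[of "perm u a" "perm u b" i] Cons.prems by auto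
    then have "perm u \<circ> transposition a b = swap i \<circ> perm u"
      using transposition_comp[of "perm u" a b] transposition_swap_dvd by simp
    then have "perm (i # u) \<circ> transposition a b = perm u" by (simp add: comp_assoc)
    then show ?thesis by (metis impossible_Cons linorder_not_le)
  qed
qed (use assms in simp)

lemma plen_transposition_down:
  assumes "f \<in> Aff" "a < b" "\<not> n dvd b - a" "f b < f a"
  shows "plen (f \<circ> transposition a b) < plen f"
  using assms by (metis plen_obtain word_transposition plen_le le_less_trans)

lemma plen_transposition_up:
  assumes "f \<in> Aff" "transposition a b \<in> Refl" "a < b" "\<not> n dvd b - a" "f a < f b"
  shows "plen f < plen (f \<circ> transposition a b)"
proof -
  have "plen (f \<circ> transposition a b \<circ> transposition a b) < plen (f \<circ> transposition a b)"
    using assms by (intro plen_transposition_down) (auto simp: transposition_self Refl_Aff)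
  then show ?thesis using Refl_invol[OF assms(2)] by (simp add: comp_assoc)
qed

section \<open>The strong order and the lifting property\<close>

definition bstep :: "(int \<Rightarrow> int) \<Rightarrow> (int \<Rightarrow> int) \<Rightarrow> bool" where
  "bstep f h \<longleftrightarrow> f \<in> Aff \<and> (\<exists>r\<in>Refl. h = f \<circ> r) \<and> plen f < plen h"

definition bleq :: "(int \<Rightarrow> int) \<Rightarrow> (int \<Rightarrow> int) \<Rightarrow> bool" where "bleq = bstep\<^sup>*\<^sup>*"

lemma bstep_transposition:
  assumes "bstep f h"
  obtains a b where "a < b" "\<not> n dvd b - a" "transposition a b \<in> Refl" "f a < f b"
      "h = f \<circ> transposition a b"
proof -
  obtain r where r: "r \<in> Refl" "h = f \<circ> r" and f: "f \<in> Aff" "plen f < plen h"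
    using assms by (auto simp: bstep_def)
  obtain a b where ab: "a < b" "\<not> n dvd b - a" "r = transposition a b"
    using Refl_transposition[OF r(1)] .
  have "f a < f b"
    using plen_transposition_down[OF f(1) ab(1,2)] f r ab Aff_eq_iff[OF f(1), of a b] by force
  then show thesis using that ab r by blast
qed

lemma stpI:
  assumes "f \<in> Aff" "transposition a b \<in> Refl" "a < b" "\<not> n dvd b - a" "f a < f b"
  shows "bstep f (f \<circ> transposition a b)"
  using assms plen_transposition_up unfolding bstep_def by blast

lemma bstep_Aff: "bstep f h \<Longrightarrow> f \<in> Aff \<and> h \<in> Aff"
  by (auto simp: bstep_def Refl_Aff)

lemma bleq_refl [simp]: "bleq f f" by (simp add: bleq_def)

lemma bleq_trans: "bleq f g \<Longrightarrow> bleq g h \<Longrightarrow> bleq f h" by (simp add: bleq_def)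

lemma bstep_bleq: "bstep f h \<Longrightarrow> bleq f h" by (simp add: bleq_def)

lemma bleq_plen: "bleq f h \<Longrightarrow> f = h \<or> plen f < plen h"
  unfolding bleq_def by (induction rule: rtranclp_induct) (auto simp: bstep_def)

text \<open>Right multiplication by s_i conjugates the reflection to the pair s_i(a), s_i(b). The
  pair keeps its order, and the step survives, unless it is i, i + 1 modulo n; then the reflection
  is s_i itself. On the left the same argument applies to the values f a and f b.\<close>

lemma bstep_right: "bstep f h \<Longrightarrow> f \<circ> swap i = h \<or> bstep (f \<circ> swap i) (h \<circ> swap i)"
proof -
  assume s: "bstep f h"
  then have f: "f \<in> Aff" by (auto simp: bstep_def)
  obtain a b where ab: "a < b" "\<not> n dvd b - a" "transposition a b \<in> Refl" "f a < f b"
      "h = f \<circ> transposition a b"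
    using bstep_transposition[OF s] .
  have c: "transposition (swap i a) (swap i b) = swap i \<circ> transposition a b \<circ> swap i"
    using transposition_conj[of "swap i" a b] by simp
  show ?thesis
  proof (cases "swap i a < swap i b")
    case True
    have "bstep (f \<circ> swap i) ((f \<circ> swap i) \<circ> transposition (swap i a) (swap i b))"
    proof (rule stpI)
      show "transposition (swap i a) (swap i b) \<in> Refl"
        using Refl_conj[OF ab(3), of "swap i"] c by simp
      show "\<not> n dvd swap i b - swap i a" using Aff_dvd_iff[of "swap i"] ab by simp
    qed (use True f ab in \<open>auto simp: swap_swap\<close>)
    moreover have "(f \<circ> swap i) \<circ> transposition (swap i a) (swap i b) = h \<circ> swap i"
      unfolding c ab(5) by (auto simp: fun_eq_iff swap_swap)
    ultimately show ?thesis by simp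
  next
    case False
    then have "b = a + 1" "n dvd a - i" using swap_less[OF ab(1), of i] by auto
    then show ?thesis using ab transposition_swap_dvd by simp
  qed
qed

lemma bstep_left: "bstep f h \<Longrightarrow> swap i \<circ> f = h \<or> bstep (swap i \<circ> f) (swap i \<circ> h)"
proof -
  assume s: "bstep f h"
  then have f: "f \<in> Aff" by (auto simp: bstep_def)
  obtain a b where ab: "a < b" "\<not> n dvd b - a" "transposition a b \<in> Refl" "f a < f b"
      "h = f \<circ> transposition a b"
    using bstep_transposition[OF s] .
  show ?thesis
  proof (cases "swap i (f a) < swap i (f b)")
    case True
    have "bstep (swap i \<circ> f) ((swap i \<circ> f) \<circ> transposition a b)"
      by (rule stpI) (use True f ab in auto)
    then show ?thesis using ab by (simp add: comp_assoc)
  next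
    case False
    then have "f b = f a + 1" "n dvd f a - i" using swap_less[OF ab(4), of i] by auto
    then have "f \<circ> transposition a b = swap i \<circ> f"
      using transposition_comp[OF f, of a b] transposition_swap_dvd by simp
    then show ?thesis using ab by simp
  qed
qed

text \<open>\<open>left_max i\<close> is the Demazure action of s_i on the whole group. Monotonicity
  of \<open>left_max\<close>, \<open>left_min\<close> and \<open>right_min\<close> is the form in
  which the lifting property is used; \<open>right_max\<close> serves as the right-hand operator
  that commutes with \<open>left_max\<close>.\<close>

definition left_max :: "int \<Rightarrow> (int \<Rightarrow> int) \<Rightarrow> int \<Rightarrow> int" where
  "left_max i f = (if plen f < plen (swap i \<circ> f) then swap i \<circ> f else f)"
definition left_min :: "int \<Rightarrow> (int \<Rightarrow> int) \<Rightarrow> int \<Rightarrow> int" where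
  "left_min i f = (if plen f < plen (swap i \<circ> f) then f else swap i \<circ> f)"
definition right_min :: "int \<Rightarrow> (int \<Rightarrow> int) \<Rightarrow> int \<Rightarrow> int" where
  "right_min i f = (if plen f < plen (f \<circ> swap i) then f else f \<circ> swap i)"
definition right_max :: "int \<Rightarrow> (int \<Rightarrow> int) \<Rightarrow> int \<Rightarrow> int" where
  "right_max i f = (if plen f < plen (f \<circ> swap i) then f \<circ> swap i else f)"

lemma bstep_left_swap: "f \<in> Aff \<Longrightarrow> plen f < plen (swap i \<circ> f) \<Longrightarrow> bstep f (swap i \<circ> f)"
proof -
  assume f: "f \<in> Aff" "plen f < plen (swap i \<circ> f)"
  have "swap i \<circ> f = f \<circ> (finv f \<circ> swap i \<circ> finv (finv f))" using f by (auto simp: fun_eq_iff)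
  moreover have "finv f \<circ> swap i \<circ> finv (finv f) \<in> Refl"
    using f by (intro Refl_conj swap_Refl) auto
  ultimately show ?thesis using f unfolding bstep_def by blast
qed

lemma bstep_right_swap: "f \<in> Aff \<Longrightarrow> plen f < plen (f \<circ> swap i) \<Longrightarrow> bstep f (f \<circ> swap i)"
  using swap_Refl unfolding bstep_def by blast

lemma plen_left_not: "f \<in> Aff \<Longrightarrow> \<not> plen f < plen (swap i \<circ> f) \<longleftrightarrow> plen (swap i \<circ> f) < plen f"
  using plen_left[of f i] asc_cases[of "finv f" i] by fastforce

lemma plen_right_not: "f \<in> Aff \<Longrightarrow> \<not> plen f < plen (f \<circ> swap i) \<longleftrightarrow> plen (f \<circ> swap i) < plen f"
  using plen_right[of f i] asc_cases[of f i] by fastforce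

lemma left_min_bounds:
  assumes "f \<in> Aff" shows "bleq (left_min i f) f" "bleq (left_min i f) (swap i \<circ> f)"
    "bleq f (left_max i f)" "bleq (swap i \<circ> f) (left_max i f)"
  using assms bstep_left_swap[of f i] bstep_left_swap[of "swap i \<circ> f" i] plen_left_not[of f i]
  by (auto simp: left_min_def left_max_def intro: bstep_bleq)

lemma right_min_bounds:
  assumes "f \<in> Aff" shows "bleq (right_min i f) f" "bleq (right_min i f) (f \<circ> swap i)"
  using assms bstep_right_swap[of f i] bstep_right_swap[of "f \<circ> swap i" i] plen_right_not[of f i]
  by (auto simp: right_min_def intro: bstep_bleq)

text \<open>If s_i f = h, both elements belong to the same pair. Otherwise s_i f and s_i h are also
  related by a step, hence f and s_i f both lie below \<open>left_max i h\<close>, and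
  \<open>left_min i f\<close> lies below both h and s_i h.\<close>

lemma left_max_mono_step: "bstep f h \<Longrightarrow> bleq (left_max i f) (left_max i h) \<and>
    bleq (left_min i f) (left_min i h)"
proof -
  assume s: "bstep f h"
  note Aff = bstep_Aff[OF s]
  from bstep_left[OF s, of i] show ?thesis
  proof
    assume h: "swap i \<circ> f = h"
    then have "swap i \<circ> h = f" by auto
    then have "left_max i f = left_max i h \<and> left_min i f = left_min i h"
      using h s plen_left_not[of f i] Aff by (auto simp: left_max_def left_min_def bstep_def)
    then show ?thesis by simp
  next
    assume s': "bstep (swap i \<circ> f) (swap i \<circ> h)"
    have "bleq f (left_max i h)" "bleq (swap i \<circ> f) (left_max i h)"
      "bleq (left_min i f) h" "bleq (left_min i f) (swap i \<circ> h)"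
      using left_min_bounds[of h i] left_min_bounds[of f i] Aff s s'
      by (meson bleq_trans bstep_bleq)+
    then show ?thesis unfolding left_max_def[of i f] left_min_def[of i h] by auto
  qed
qed

lemma left_max_mono: "bleq f h \<Longrightarrow> bleq (left_max i f) (left_max i h)"
  unfolding bleq_def by (induction rule: rtranclp_induct)
    (use left_max_mono_step in \<open>auto simp: bleq_def intro: rtranclp_trans\<close>)

lemma left_min_mono: "bleq f h \<Longrightarrow> bleq (left_min i f) (left_min i h)"
  unfolding bleq_def by (induction rule: rtranclp_induct)
    (use left_max_mono_step in \<open>auto simp: bleq_def intro: rtranclp_trans\<close>)

lemma right_min_mono_step: "bstep f h \<Longrightarrow> bleq (right_min i f) (right_min i h)"
proof -
  assume s: "bstep f h"
  note Aff = bstep_Aff[OF s]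
  from bstep_right[OF s, of i] show ?thesis
  proof
    assume h: "f \<circ> swap i = h"
    then have "h \<circ> swap i = f" by auto
    then have "right_min i f = right_min i h"
      using h s plen_right_not[of f i] Aff by (auto simp: right_min_def bstep_def)
    then show ?thesis by simp
  next
    assume s': "bstep (f \<circ> swap i) (h \<circ> swap i)"
    have "bleq (right_min i f) h" "bleq (right_min i f) (h \<circ> swap i)"
      using right_min_bounds[of f i] Aff s s' by (meson bleq_trans bstep_bleq)+
    then show ?thesis unfolding right_min_def[of i h] by auto
  qed
qed

lemma right_min_mono: "bleq f h \<Longrightarrow> bleq (right_min i f) (right_min i h)"
  unfolding bleq_def by (induction rule: rtranclp_induct)
    (use right_min_mono_step in \<open>auto simp: bleq_def intro: rtranclp_trans\<close>)

section \<open>Transport to the presented group\<close>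

lemma carrier_elt: "carrier (affine_sym k) = elt ` Aff"
proof -
  have "Aff = perm ` lists I" using Aff_cases perm_Aff by blast
  then show ?thesis unfolding carrier_affine_sym by (simp add: image_image word_class_eq_elt)
qed

lemma one_elt: "\<one>\<^bsub>affine_sym k\<^esub> = elt id"
  using word_class_eq_elt[of "[]"] by (simp add: one_affine_sym)

lemma mult_elt: "f \<in> Aff \<Longrightarrow> g \<in> Aff \<Longrightarrow> elt f \<otimes>\<^bsub>affine_sym k\<^esub> elt g = elt (f \<circ> g)"
proof -
  assume "f \<in> Aff" "g \<in> Aff"
  then obtain u v where u: "u \<in> lists I" "f = perm u" and v: "v \<in> lists I" "g = perm v"
    by (metis Aff_cases)
  have "u @ v \<in> lists I" using u v by auto
  then show ?thesis
    using mult_word_class[OF u(1) v(1)] word_class_eq_elt u v by (simp add: perm_append)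
qed

lemma gen_elt: "i \<in> I \<Longrightarrow> gen k i = elt (swap i)"
  using word_class_eq_elt[of "[i]"] by (simp add: gen_def)

lemma inv_elt: "f \<in> Aff \<Longrightarrow> inv\<^bsub>affine_sym k\<^esub> (elt f) = elt (finv f)"
  by (rule group.inv_equality[OF group_affine_sym]) (auto simp: mult_elt one_elt carrier_elt)

lemma reflections_elt: "reflections k = elt ` Refl"
proof -
  have "reflections k = {elt (f \<circ> swap i \<circ> finv f) | f i. f \<in> Aff \<and> i \<in> I}"
    unfolding reflections_def carrier_elt
    by (force simp: gen_elt mult_elt inv_elt)
  also have "\<dots> = elt ` Refl"
  proof -
    have "\<exists>j\<in>I. elt (f \<circ> swap i \<circ> finv f) = elt (f \<circ> swap j \<circ> finv f)" for f i
      using mod_n by (intro bexI[of _ "i mod n"]) (simp_all add: swap_mod index_set_def)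
    then have "{elt (f \<circ> swap i \<circ> finv f) | f i. f \<in> Aff \<and> i \<in> I} =
      {elt (f \<circ> swap i \<circ> finv f) | f i. f \<in> Aff}"
      by (intro equalityI subsetI; clarsimp) metis+
    then show ?thesis unfolding Refl_def by blast
  qed
  finally show ?thesis .
qed

lemma bruhat_step_elt: "f \<in> Aff \<Longrightarrow> bruhat_step k (elt f) y \<longleftrightarrow> (\<exists>h. y = elt h \<and> bstep f h)"
  unfolding bruhat_step_def reflections_elt carrier_elt bstep_def
  by (auto simp: mult_elt Refl_Aff plen_def)

lemma bruhat_le_elt:
  assumes f: "f \<in> Aff" and h: "h \<in> Aff"
  shows "bruhat_le k (elt f) (elt h) \<longleftrightarrow> bleq f h"
proof
  assume "bleq f h"
  then have "bleq f h \<and> bruhat_le k (elt f) (elt h)"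
    unfolding bleq_def bruhat_le_def
  proof (induction rule: rtranclp_induct)
    case (step g h)
    then have "bruhat_step k (elt g) (elt h)" using bruhat_step_elt bstep_Aff by blast
    with step show ?case by auto
  qed auto
  then show "bruhat_le k (elt f) (elt h)" ..
next
  have "bruhat_le k (elt f) y \<Longrightarrow> \<exists>g. g \<in> Aff \<and> y = elt g \<and> bleq f g" for y
    unfolding bruhat_le_def
  proof (induction rule: rtranclp_induct)
    case (step y z)
    then obtain g where g: "g \<in> Aff" "y = elt g" "bleq f g" by blast
    then obtain g' where g': "z = elt g'" "bstep g g'" using bruhat_step_elt step.hyps(2) by blast
    then have "bleq f g'" using g bstep_bleq bleq_trans by blast
    then show ?case using g' bstep_Aff by blast
  qed (use f in auto)
  then show "bruhat_le k (elt f) (elt h) \<Longrightarrow> bleq f h" using elt_inj h by blast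
qed

lemma bruhat_less_left: "f \<in> Aff \<Longrightarrow> bruhat_less k (elt f) (elt (swap i \<circ> f)) \<longleftrightarrow>
    plen f < plen (swap i \<circ> f)"
  unfolding bruhat_less_def
  using bruhat_le_elt[of f "swap i \<circ> f"] bleq_plen[of f
      "swap i \<circ> f"] bstep_left_swap[of f i] bstep_bleq
    elt_inj[of f "swap i \<circ> f"]
  by (metis comp_Aff less_irrefl swap_Aff)

lemma bruhat_less_right: "f \<in> Aff \<Longrightarrow> bruhat_less k (elt f) (elt (f \<circ> swap i)) \<longleftrightarrow>
    plen f < plen (f \<circ> swap i)"
  unfolding bruhat_less_def
  using bruhat_le_elt[of f "f \<circ> swap i"] bleq_plen[of f
      "f \<circ> swap i"] bstep_right_swap[of f i] bstep_bleq
    elt_inj[of f "f \<circ> swap i"]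
  by (metis comp_Aff less_irrefl swap_Aff)

definition Grass :: "(int \<Rightarrow> int) set" where
  "Grass = {f \<in> Aff. \<forall>i\<in>{1..int k}. f i < f (i + 1)}"

lemma affine_grassmannian_elt: "affine_grassmannian k = elt ` Grass"
proof -
  have "(elt f \<in> affine_grassmannian k) = (f \<in> Grass)" if f: "f \<in> Aff" for f
  proof -
    have "bruhat_less k (elt f) (elt f \<otimes>\<^bsub>affine_sym k\<^esub> gen k i) \<longleftrightarrow> f i < f (i + 1)"
      if "i \<in> {1..int k}" for i
      using that f bruhat_less_right[OF f, of i] plen_right_iff[OF f, of i]
      by (simp add: gen_elt mult_elt index_set_def)
    then show ?thesis using f by (auto simp: affine_grassmannian_def Grass_def carrier_elt)
  qed
  then show ?thesis unfolding affine_grassmannian_def carrier_elt Grass_def by auto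
qed

lemma demazure_gen_elt: "i \<in> I \<Longrightarrow> f \<in> Aff \<Longrightarrow> demazure_gen k i (elt f) = elt (left_max i f)"
  using bruhat_less_left[of f i] by (simp add: demazure_gen_def gen_elt mult_elt left_max_def)

declare bleq_trans [trans]

section \<open>Grassmannian permutations\<close>

lemma Grass_Aff: "f \<in> Grass \<Longrightarrow> f \<in> Aff" by (simp add: Grass_def)

lemma id_Grass [simp]: "id \<in> Grass" by (simp add: Grass_def)

text \<open>
  The coset of \<open>f\<close> modulo the finite symmetric group is recorded by the function that sends a value
  \<open>x\<close> to the index \<open>b\<close> of the interval \<open>{n b + 1..n b + n}\<close> that contains the position of \<open>x\<close>. The
  values with negative index form the Maya diagram of the core.
\<close>

definition block :: "int \<Rightarrow> int" where "block y = (y - 1) div n"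

definition block_of :: "(int \<Rightarrow> int) \<Rightarrow> int \<Rightarrow> int" where "block_of f x = block (finv f x)"

lemma block_iff: "block y = b \<longleftrightarrow> n * b < y \<and> y \<le> n * b + n"
proof
  assume b: "block y = b"
  define r where "r = (y - 1) mod n"
  have "n * b + r = y - 1" unfolding r_def b[symmetric] block_def by (rule mult_div_mod_eq)
  moreover have "0 \<le> r" "r < n" unfolding r_def by (rule mod_n)+
  ultimately show "n * b < y \<and> y \<le> n * b + n" by linarith
next
  assume b: "n * b < y \<and> y \<le> n * b + n"
  define r where "r = y - 1 - n * b"
  have "y - 1 = n * b + r" "0 \<le> r" "r < n" using b unfolding r_def by linarith+
  then show "block y = b" unfolding block_def by (rule int_div_pos_eq)
qed

lemma block_shift: "block (y + n * q) = block y + q"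
  using block_iff[of "y + n * q" "block y + q"] block_iff[of y "block y"]
  by (simp add: distrib_left)

lemma block_less: "block x < block y \<Longrightarrow> x < y"
proof -
  assume "block x < block y"
  then have "n * (block x + 1) \<le> n * block y" using n_ge_2 by (intro mult_left_mono) auto
  then show ?thesis
    using block_iff[of x "block x"] block_iff[of y "block y"] by (simp add: distrib_left)
qed

lemma Grass_mono0:
  assumes f: "f \<in> Grass" and "1 \<le> x" "x < y" "y \<le> n"
  shows "f x < f y"
  using assms(3,4)
proof (induction y rule: int_gr_induct)
  case base
  then show ?case using f assms by (auto simp: Grass_def)
next
  case (step y)
  have "f y < f (y + 1)" using f step assms by (auto simp: Grass_def)
  then show ?case using step by simp
qed

lemma Grass_mono:
  assumes f: "f \<in> Grass" and xy: "x < y" "block x = block y"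
  shows "f x < f y"
proof -
  define b where "b = block y"
  have "f (x - n * b) < f (y - n * b)"
    using block_iff[of x b] block_iff[of y b] xy unfolding b_def by (intro Grass_mono0[OF f]) auto
  then show ?thesis using Aff_shift[OF Grass_Aff[OF f], of "x - n * b" b]
      Aff_shift[OF Grass_Aff[OF f], of "y - n * b" b] by simp
qed

lemma block_of_shift: "f \<in> Aff \<Longrightarrow> block_of f (x + n * q) = block_of f x + q"
  by (simp add: block_of_def Aff_shift block_shift)

lemma block_of_comp: "f \<in> Aff \<Longrightarrow> block_of (swap i \<circ> f) x = block_of f (swap i x)"
  by (simp add: block_of_def finv_mult)

text \<open>Since f increases on a block and no integer lies between i and i + 1, their positions in
  a common block are neighbours. Left multiplication by s_i is then right multiplication by a
  generator of the finite symmetric group of that block, which leads out of W\<degree>.\<close>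

lemma block_of_eq_dest:
  assumes f: "f \<in> Grass" and e: "block_of f i = block_of f (i + 1)"
  shows "finv f (i + 1) = finv f i + 1" "swap i \<circ> f = f \<circ> swap (finv f i)" "swap i \<circ> f \<notin> Grass"
    "finv f i < finv f (i + 1)"
proof -
  note fG = Grass_Aff[OF f]
  define p q where "p = finv f i" and "q = finv f (i + 1)"
  have fp: "f p = i" "f q = i + 1" using fG by (simp_all add: p_def q_def)
  have b: "block p = block q" using e by (simp add: block_of_def p_def q_def)
  have "\<not> q < p" using Grass_mono[OF f _ b[symmetric]] fp by force
  moreover have "p \<noteq> q" using fp by auto
  ultimately have pq: "p < q" by simp
  have "\<not> p + 1 < q"
  proof
    assume l: "p + 1 < q"
    then have b1: "block (p + 1) = block p"
      using block_iff[of p "block p"] block_iff[of q "block p"] block_iff[of "p + 1" "block p"] b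
      by auto
    have "f p < f (p + 1)" "f (p + 1) < f q" using Grass_mono[OF f] l b b1 by auto
    then show False using fp by simp
  qed
  then have q: "q = p + 1" using pq by simp
  then show "finv f (i + 1) = finv f i + 1" by (simp add: p_def q_def)
  show "finv f i < finv f (i + 1)" using pq by (simp add: p_def q_def)
  have "f \<circ> transposition p (p + 1) = transposition i (i + 1) \<circ> f"
    using transposition_comp[OF fG, of p "p + 1"] fp q by simp
  then show "swap i \<circ> f = f \<circ> swap (finv f i)" unfolding transposition_swap p_def by simp
  show "swap i \<circ> f \<notin> Grass"
  proof
    assume "swap i \<circ> f \<in> Grass"
    from Grass_mono[OF this pq b] fp show False by (simp add: swap_self)
  qed
qed

text \<open>Only a pair i, i + 1 modulo n at neighbouring positions of the window could be reversed;
  such positions share a block, so i and i + 1 would too.\<close>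

lemma block_of_neq_Grass:
  assumes f: "f \<in> Grass" and e: "block_of f i \<noteq> block_of f (i + 1)"
  shows "swap i \<circ> f \<in> Grass"
proof -
  note fG = Grass_Aff[OF f]
  have "swap i (f j) < swap i (f (j + 1))" if j: "j \<in> {1..int k}" for j
  proof (rule ccontr)
    assume neg: "\<not> ?thesis"
    have l: "f j < f (j + 1)" using f j by (simp add: Grass_def)
    from swap_less[OF l, of i] neg have 1: "f (j + 1) = f j + 1" and 2: "n dvd f j - i" by auto
    from 2 obtain q where q: "i = f j + n * q"
      by (metis dvd_diff_commute dvdE add.commute diff_add_cancel)
    have "f (j + n * q) = i" "f (j + 1 + n * q) = i + 1"
      using q 1 Aff_shift[OF fG, of j q] Aff_shift[OF fG, of "j + 1" q] by simp_all
    then have "finv f i = j + n * q" "finv f (i + 1) = j + 1 + n * q"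
      using finv_f(1)[OF fG, of "j + n * q"] finv_f(1)[OF fG, of "j + 1 + n * q"] by simp_all
    moreover have "block j = 0" "block (j + 1) = 0" using j by (simp_all add: block_iff)
    ultimately have "block_of f i = block_of f (i + 1)" by (simp add: block_of_def block_shift)
    with e show False by simp
  qed
  then show ?thesis using fG by (simp add: Grass_def)
qed

lemma Grass_down: "f \<in> Grass \<Longrightarrow> \<not> plen f < plen (swap i \<circ> f) \<Longrightarrow> swap i \<circ> f \<in> Grass"
  using block_of_neq_Grass block_of_eq_dest(4) plen_left_iff Grass_Aff by blast

text \<open>The action of i on W\<degree>, read off from the blocks: i + 1 in a later block is an
  ascent inside W\<degree>, an equal block leads out of W\<degree>, and an earlier block is a
  descent. Comparison of blocks, unlike comparison of lengths, is easily followed through the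
  rectangle shift.\<close>

definition grass_act :: "int \<Rightarrow> (int \<Rightarrow> int) \<Rightarrow> int \<Rightarrow> int" where
  "grass_act i f = (if block_of f i < block_of f (i + 1) then swap i \<circ> f else f)"

lemma grass_act_Grass [simp]: "f \<in> Grass \<Longrightarrow> grass_act i f \<in> Grass"
  by (auto simp: grass_act_def intro: block_of_neq_Grass)

lemma grass_act_alt:
  assumes f: "f \<in> Grass"
  shows "grass_act i f =
      (if plen f < plen (swap i \<circ> f) \<and> swap i \<circ> f \<in> Grass then swap i \<circ> f else f)"
proof (cases "block_of f i" "block_of f (i + 1)" rule: linorder_cases)
  case less
  then have "finv f i < finv f (i + 1)" by (simp add: block_of_def block_less)
  with less block_of_neq_Grass[OF f, of i] plen_left_iff[OF Grass_Aff[OF f], of i] show ?thesis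
    by (simp add: grass_act_def)
next
  case equal
  then show ?thesis using block_of_eq_dest(3)[OF f equal] by (simp add: grass_act_def)
next
  case greater
  then have "finv f (i + 1) < finv f i" by (simp add: block_of_def block_less)
  with greater plen_left_iff[OF Grass_Aff[OF f], of i] show ?thesis
    by (simp add: grass_act_def)
qed

text \<open>A lower interval needs only words of bounded length over a finite alphabet. Over an
  infinite index set a sum would take the default value 0.\<close>

lemma finite_bleq: "w \<in> Aff \<Longrightarrow> finite {v \<in> Grass. bleq v w}"
proof (rule finite_subset)
  show "finite (perm ` {u. set u \<subseteq> I \<and> length u \<le> plen w})"
    by (intro finite_imageI finite_lists_length_le) (simp add: index_set_def)
  show "{v \<in> Grass. bleq v w} \<subseteq> perm ` {u. set u \<subseteq> I \<and> length u \<le> plen w}"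
  proof clarify
    fix v assume v: "v \<in> Grass" "bleq v w"
    obtain u where u: "u \<in> lists I" "perm u = v" "length u = plen v"
      using plen_obtain[OF Grass_Aff[OF v(1)]] .
    with bleq_plen[OF v(2)] have "length u \<le> plen w" by auto
    with u show "v \<in> perm ` {u. set u \<subseteq> I \<and> length u \<le> plen w}" by auto
  qed
qed

section \<open>Lower sums and 0-Hecke operators\<close>

definition lower_sum :: "((int \<Rightarrow> int) \<Rightarrow> 'r::comm_ring_1) \<Rightarrow> (int \<Rightarrow> int) \<Rightarrow> 'r" where
  "lower_sum F w = (\<Sum>v | v \<in> Grass \<and> bleq v w. F v)"

text \<open>
  The transpose of the 0-Hecke generator \<open>D\<^sub>i\<close>, acting on functions on \<open>W\<degree>\<close>; elements outside \<open>W\<degree>\<close>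
  count as zero.
\<close>

definition hecke_op :: "int \<Rightarrow> ((int \<Rightarrow> int) \<Rightarrow> 'r::comm_ring_1) \<Rightarrow> (int \<Rightarrow> int) \<Rightarrow> 'r" where
  "hecke_op i F v =
      (if plen v < plen (swap i \<circ> v) then if swap i \<circ> v \<in> Grass then F (swap i \<circ> v) else 0
     else - F v)"

text \<open>This describes the lower interval of \<open>grass_act i w\<close> by that of w: both
  contain the same elements v with v < s_i v, and the other elements of the larger interval are the
  s_i v in W\<degree> for such v below w.\<close>

lemma bleq_grass_act:
  assumes w: "w \<in> Grass" and v: "v \<in> Grass"
  shows "bleq v w \<Longrightarrow> bleq v (grass_act i w)"
    and "bleq v (grass_act i w) \<Longrightarrow> plen v < plen (swap i \<circ> v) \<Longrightarrow> bleq v w"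
    and "bleq v w \<Longrightarrow> plen v < plen (swap i \<circ> v) \<Longrightarrow> swap i \<circ> v \<in> Grass \<Longrightarrow>
        bleq (swap i \<circ> v) (grass_act i w)"
    and "bleq v (grass_act i w) \<Longrightarrow> \<not> plen v < plen (swap i \<circ> v) \<Longrightarrow> bleq (swap i \<circ> v) w"
proof -
  note wG = Grass_Aff[OF w] and vG = Grass_Aff[OF v]
  have "bleq w (grass_act i w)"
    using left_min_bounds(3)[OF wG, of i] by (auto simp: grass_act_alt[OF w] left_max_def)
  then show "bleq v w \<Longrightarrow> bleq v (grass_act i w)"
    by (rule bleq_trans[rotated])
  have min: "bleq (left_min i v) w" if "bleq v (grass_act i w)"
  proof -
    have "bleq (left_min i v) (left_min i (grass_act i w))" using that by (rule left_min_mono)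
    also have "bleq \<dots> w"
      using left_min_bounds[OF wG, of i] plen_left_not[of "swap i \<circ> w" i] wG
      by (auto simp: grass_act_alt[OF w] left_min_def)
    finally show ?thesis .
  qed
  show "bleq v (grass_act i w) \<Longrightarrow> plen v < plen (swap i \<circ> v) \<Longrightarrow> bleq v w"
    using min by (simp add: left_min_def)
  show "bleq v (grass_act i w) \<Longrightarrow> \<not> plen v < plen (swap i \<circ> v) \<Longrightarrow> bleq (swap i \<circ> v) w"
    using min by (simp add: left_min_def)
  assume a: "bleq v w" "plen v < plen (swap i \<circ> v)" "swap i \<circ> v \<in> Grass"
  then have m: "bleq (swap i \<circ> v) (left_max i w)"
    using left_max_mono[of v w i] by (simp add: left_max_def)
  show "bleq (swap i \<circ> v) (grass_act i w)"
  proof (cases "plen w < plen (swap i \<circ> w) \<and> swap i \<circ> w \<notin> Grass")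
    case False
    then show ?thesis using m by (auto simp: grass_act_alt[OF w] left_max_def)
  next
    \<comment> \<open>Here s_i w lies outside W\<degree> and \<open>grass_act\<close> stays at w,
      but m bounds s_i v only by s_i w. Since s_i w = w s_p with p and p + 1 in one block,
      \<open>right_min p\<close> turns this upper bound into w and fixes s_i v, which lies in
      W\<degree>.\<close>
    case True
    then have e: "block_of w i = block_of w (i + 1)" using block_of_neq_Grass[OF w] by blast
    define p where "p = finv w i"
    have wp: "swap i \<circ> w = w \<circ> swap p" using block_of_eq_dest(2)[OF w e] by (simp add: p_def)
    have bp: "block p = block (p + 1)"
      using e block_of_eq_dest(1)[OF w e] by (simp add: block_of_def p_def)
    have asc: "plen x < plen (x \<circ> swap p)" if "x \<in> Grass" for x
      using plen_right_iff[OF Grass_Aff[OF that], of p] Grass_mono[OF that _ bp] by simp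
    have "bleq (right_min p (swap i \<circ> v)) (right_min p (w \<circ> swap p))"
      using m True wp by (intro right_min_mono) (simp add: left_max_def)
    moreover have "right_min p (swap i \<circ> v) = swap i \<circ> v"
      using asc[OF a(3)] by (simp add: right_min_def)
    moreover have "right_min p (w \<circ> swap p) = w" using asc[OF w] by (simp add: right_min_def)
    ultimately show ?thesis using True by (simp add: grass_act_alt[OF w])
  qed
qed

text \<open>The operator contributes F(s_i v) for the ascents v below w with s_i v in W\<degree>,
  and -F(v) for the descents. The first sum is that of F over all descents below
  \<open>grass_act i w\<close>; the ascents are the same for both intervals and cancel in the
  difference of the lower sums.\<close>

lemma lower_sum_hecke_op:
  assumes w: "w \<in> Grass"
  shows "lower_sum (hecke_op i F) w = lower_sum F (grass_act i w) - lower_sum F w"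
proof -
  note wG = Grass_Aff[OF w]
  define S S' where "S = {v. v \<in> Grass \<and> bleq v w}" and
      "S' = {v. v \<in> Grass \<and> bleq v (grass_act i w)}"
  define U where "U v \<longleftrightarrow> plen v < plen (swap i \<circ> v)" for v
  have fin: "finite S" "finite S'"
    using finite_bleq[OF wG] finite_bleq[of "grass_act i w"] w Grass_Aff[OF grass_act_Grass[OF w]]
    by (simp_all add: S_def S'_def)
  have flip: "U (swap i \<circ> v) \<longleftrightarrow> \<not> U v" if "v \<in> Grass" for v
    using plen_left_not[OF Grass_Aff[OF that], of i] by (auto simp: U_def)
  have up: "{v. v \<in> S' \<and> U v} = {v. v \<in> S \<and> U v}"
    using bleq_grass_act[OF w] by (auto simp: S_def S'_def U_def)
  have bij: "(\<Sum>v | v \<in> S \<and> U v \<and> swap i \<circ> v \<in> Grass. F (swap i \<circ> v)) = (\<Sum>v | v \<in> S' \<and> \<not> U v. F v)"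
  proof (rule sum.reindex_bij_witness[where i = "\<lambda>v. swap i \<circ> v" and j = "\<lambda>v. swap i \<circ> v"])
    fix v assume "v \<in> {v. v \<in> S \<and> U v \<and> swap i \<circ> v \<in> Grass}"
    then show "swap i \<circ> v \<in> {v. v \<in> S' \<and> \<not> U v}"
      using bleq_grass_act(3)[OF w, of v i] flip by (auto simp: S_def S'_def U_def)
  next
    fix v assume "v \<in> {v. v \<in> S' \<and> \<not> U v}"
    then show "swap i \<circ> v \<in> {v. v \<in> S \<and> U v \<and> swap i \<circ> v \<in> Grass}"
      using bleq_grass_act(4)[OF w, of v i] flip Grass_down[of v i]
      by (auto simp: S_def S'_def U_def)
  qed auto
  have split: "(\<Sum>v\<in>X. H v) = (\<Sum>v | v \<in> X \<and> U v. H v) + (\<Sum>v | v \<in> X \<and> \<not> U v. H v)"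
    if "finite X" for X and H :: "_ \<Rightarrow> 'a"
    by (subst sum.union_disjoint[symmetric]) (auto intro: that sum.cong finite_subset[OF _ that])
  have "lower_sum (hecke_op i F) w =
      (\<Sum>v | v \<in> S \<and> U v. hecke_op i F v) + (\<Sum>v | v \<in> S \<and> \<not> U v. hecke_op i F v)"
    unfolding lower_sum_def S_def[symmetric] by (rule split[OF fin(1)])
  also have "(\<Sum>v | v \<in> S \<and> U v. hecke_op i F v) =
      (\<Sum>v | v \<in> S \<and> U v \<and> swap i \<circ> v \<in> Grass. F (swap i \<circ> v))"
    by (rule sum.mono_neutral_cong_right) (auto simp: fin hecke_op_def U_def)
  also have "(\<Sum>v | v \<in> S \<and> \<not> U v. hecke_op i F v) = - (\<Sum>v | v \<in> S \<and> \<not> U v. F v)"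
    unfolding sum_negf[symmetric] by (rule sum.cong) (auto simp: hecke_op_def U_def)
  also note bij
  also have "(\<Sum>v | v \<in> S' \<and> \<not> U v. F v) + - (\<Sum>v | v \<in> S \<and> \<not> U v. F v) =
    (\<Sum>v\<in>S'. F v) - (\<Sum>v\<in>S. F v)"
    using split[OF fin(1), of F] split[OF fin(2), of F] unfolding up by simp
  finally show ?thesis unfolding lower_sum_def S_def[symmetric] S'_def[symmetric] .
qed

section \<open>The Demazure action and the Pieri rule\<close>

lemma left_max_Aff [simp]: "f \<in> Aff \<Longrightarrow> left_max i f \<in> Aff"
  by (simp add: left_max_def)

lemma right_max_Aff [simp]: "f \<in> Aff \<Longrightarrow> right_max i f \<in> Aff"
  by (simp add: right_max_def)

lemma foldr_left_max_Aff [simp]: "f \<in> Aff \<Longrightarrow> foldr left_max u f \<in> Aff"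
  by (induction u) auto

text \<open>Right multiplication applies s_j to the positions of i and i + 1. It reverses their
  order only if they are j, j + 1 modulo n in some order, and then s_i f = f s_j.\<close>

lemma descent_rmul:
  assumes f: "f \<in> Aff" and "swap i \<circ> f \<noteq> f \<circ> swap j"
  shows "plen (f \<circ> swap j) < plen (swap i \<circ> (f \<circ> swap j)) \<longleftrightarrow> plen f < plen (swap i \<circ> f)"
proof -
  have no: "\<not> (finv f b = finv f a + 1 \<and> n dvd finv f a - j)"
    if "{a, b} = {i, i + 1}" for a b
  proof
    assume c: "finv f b = finv f a + 1 \<and> n dvd finv f a - j"
    have "f \<circ> transposition (finv f a) (finv f a + 1) = transposition a b \<circ> f"
      using transposition_comp[OF f, of "finv f a" "finv f a + 1"] c f by (metis finv_f(2))
    moreover have "transposition (finv f a) (finv f a + 1) = swap j"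
      using c transposition_swap_dvd by blast
    moreover have "transposition a b = swap i"
      using that transposition_swap[of i] transposition_commute[of "i + 1" i] not_n_dvd[of 1] n_ge_2
      by (auto simp: doubleton_eq_iff)
    ultimately show False using assms(2) by simp
  qed
  have "swap j (finv f i) < swap j (finv f (i + 1)) \<longleftrightarrow> finv f i < finv f (i + 1)"
    using swap_less[of "finv f i" "finv f (i + 1)" j] swap_less[of "finv f (i + 1)" "finv f i" j]
      no[of i "i + 1"] no[of "i + 1" i] asc_cases[of "finv f" i] f
    by (metis doubleton_eq_iff finv_Aff linorder_not_le not_less_iff_gr_or_eq)
  then show ?thesis using f by (simp add: plen_left_iff finv_mult)
qed

text \<open>If s_i f = f s_j, both operators choose the larger element of the same pair. Otherwise
  multiplication on one side does not affect whether the other side ascends.\<close>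

lemma left_max_right_max: "f \<in> Aff \<Longrightarrow> left_max i (right_max j f) = right_max j (left_max i f)"
proof -
  assume f: "f \<in> Aff"
  show ?thesis
  proof (cases "swap i \<circ> f = f \<circ> swap j")
    case True
    then have eq: "left_max i f = right_max j f" by (simp add: left_max_def right_max_def)
    have "swap i \<circ> (f \<circ> swap j) = f" "swap i \<circ> f \<circ> swap j = f"
      using True by (metis swap_comp_swap(2), metis swap_comp_swap(3))
    then show ?thesis unfolding eq using True plen_left_not[OF f, of i]
      by (auto simp: left_max_def right_max_def)
  next
    case False
    have "swap j \<circ> finv f \<noteq> finv f \<circ> swap i"
    proof
      assume "swap j \<circ> finv f = finv f \<circ> swap i"
      then have "finv (swap j \<circ> finv f) = finv (finv f \<circ> swap i)" by simp
      then show False using f False by (simp add: finv_mult)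
    qed
    then have "plen (finv f \<circ> swap i) < plen (swap j \<circ> (finv f \<circ> swap i)) \<longleftrightarrow>
        plen (finv f) < plen (swap j \<circ> finv f)"
      using f by (intro descent_rmul) auto
    then have "plen (swap i \<circ> f) < plen (swap i \<circ> f \<circ> swap j) \<longleftrightarrow> plen f < plen (f \<circ> swap j)"
      using f plen_finv[of "swap i \<circ> f"] plen_finv[of
          "swap i \<circ> f \<circ> swap j"] plen_finv[of f] plen_finv[of "f \<circ> swap j"]
      by (simp add: finv_mult comp_assoc)
    with descent_rmul[OF f False] show ?thesis
      by (auto simp: left_max_def right_max_def comp_assoc)
  qed
qed

lemma foldr_left_max_fold_right_max:
  "f \<in> Aff \<Longrightarrow> foldr left_max u (fold right_max y f) = fold right_max y (foldr left_max u f)"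
proof (induction y arbitrary: f)
  case (Cons j y)
  have "foldr left_max u (right_max j f) = right_max j (foldr left_max u f)" using Cons.prems
    by (induction u) (auto simp: left_max_right_max)
  with Cons show ?case by simp
qed simp

lemma plen_comp_le: "f \<in> Aff \<Longrightarrow> plen (perm u \<circ> f) \<le> length u + plen f"
proof -
  assume "f \<in> Aff"
  then obtain v where "perm v = f" "length v = plen f" using plen_obtain by metis
  then show ?thesis using plen_le[of "u @ v"] by (simp add: perm_append)
qed

lemma foldr_left_max_additive:
  "f \<in> Aff \<Longrightarrow> plen (perm u \<circ> f) = length u + plen f \<Longrightarrow> foldr left_max u f = perm u \<circ> f"
proof (induction u)
  case (Cons i u)
  have g: "perm u \<circ> f \<in> Aff" using Cons.prems by simp
  have "plen (swap i \<circ> (perm u \<circ> f)) \<le> plen (perm u \<circ> f) + 1"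
    using plen_left[OF g, of i] asc_cases[of "finv (perm u \<circ> f)" i] g by fastforce
  moreover have "plen (swap i \<circ> (perm u \<circ> f)) = length u + plen f + 1"
    using Cons.prems by (simp add: comp_def)
  moreover have "plen (perm u \<circ> f) \<le> length u + plen f"
    using plen_comp_le[of f u] Cons.prems by simp
  ultimately have l: "plen (perm u \<circ> f) = length u + plen f"
      "plen (perm u \<circ> f) < plen (swap i \<circ> (perm u \<circ> f))"
    by linarith+
  have "foldr left_max (i # u) f = left_max i (foldr left_max u f)" by simp
  also have "foldr left_max u f = perm u \<circ> f" using Cons.IH[OF Cons.prems(1) l(1)] .
  also have "left_max i (perm u \<circ> f) = swap i \<circ> (perm u \<circ> f)"
    using l(2) by (simp only: left_max_def if_True)
  finally show ?case by (simp only: perm.simps comp_assoc)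
qed simp

lemma foldr_left_max_reduced: "plen (perm u) = length u \<Longrightarrow> foldr left_max u id = perm u"
  using foldr_left_max_additive[of id u] by simp

lemma fold_right_max_reduced: "plen (perm u) = length u \<Longrightarrow> fold right_max u id = perm u"
proof (induction u rule: rev_induct)
  case (snoc i u)
  have e: "perm (u @ [i]) = perm u \<circ> swap i" by (simp add: perm_append)
  have "plen (perm u \<circ> swap i) \<le> plen (perm u) + 1"
    using plen_right[of "perm u" i] asc_cases[of "perm u" i] by fastforce
  moreover have "plen (perm u \<circ> swap i) = length u + 1" using snoc.prems e by (simp add: comp_def)
  ultimately have "plen (perm u) = length u" "plen (perm u) < plen (perm u \<circ> swap i)"
    using plen_le[of u] by linarith+
  with snoc e show ?case by (simp add: right_max_def)
qed simp

text \<open>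
  Left and right Demazure operators commute, so acting on \<open>f\<close> from the left by a reduced word for
  \<open>x\<close> is the same as acting on \<open>x\<close> from the right by a reduced word for \<open>f\<close>. This avoids
  Matsumoto's theorem.
\<close>

lemma foldr_left_max_cong:
  assumes "plen (perm u) = length u" "plen (perm v) = length v" "perm u = perm v" and f: "f \<in> Aff"
  shows "foldr left_max u f = foldr left_max v f"
proof -
  obtain y where y: "perm y = f" "length y = plen f" using plen_obtain[OF f] .
  then have "f = fold right_max y id" using fold_right_max_reduced[of y] by simp
  then show ?thesis
    using foldr_left_max_fold_right_max[of id _ y] foldr_left_max_reduced assms by simp
qed

text \<open>Only a letter congruent to i moves anything across the cut between i and i + 1. A
  missing letter thus yields an invariant half-line.\<close>

lemma perm_cut: "\<forall>j\<in>set u. \<not> n dvd i - j \<Longrightarrow> perm u x \<le> i \<longleftrightarrow> x \<le> i"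
proof (induction u arbitrary: x)
  case (Cons j u)
  have "swap j y \<le> i \<longleftrightarrow> y \<le> i" for y
  proof (cases "y = i \<or> y = i + 1")
    case True
    with Cons.prems show ?thesis by (auto simp: swap_def)
  next
    case False
    then show ?thesis by (auto simp: swap_def)
  qed
  with Cons show ?case by simp
qed simp

section \<open>Cyclically decreasing words\<close>

lemma I_dvd: "i \<in> I \<Longrightarrow> j \<in> I \<Longrightarrow> n dvd i - j \<Longrightarrow> i = j"
  using not_n_dvd[of "i - j"] not_n_dvd[of "j - i"] dvd_diff_commute[of n i j]
  by (fastforce simp: index_set_def)

text \<open>When a new letter i is put in front, the remaining word respects the cut at i, so its
  inverse keeps i before i + 1 and the length grows.\<close>

lemma distinct_reduced: "distinct u \<Longrightarrow> set u \<subseteq> I \<Longrightarrow> plen (perm u) = length u"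
proof (induction u)
  case (Cons i u)
  have "\<forall>j\<in>set (rev u). \<not> n dvd i - j" using Cons.prems I_dvd[of i] by auto
  from perm_cut[OF this, of i] perm_cut[OF this, of "i + 1"]
  have "finv (perm u) i < finv (perm u) (i + 1)" by (simp add: finv_perm)
  then show ?case using Cons plen_left(1)[of "perm u" i] by (simp add: comp_def)
qed simp

definition cyc_word :: "int set \<Rightarrow> int list" where
  "cyc_word A = (SOME u. set u = A \<and> cyc_decreasing k u)"

lemma cyc_interval:
  assumes "a \<le> k"
  shows "distinct (map (\<lambda>j. (c + int j) mod n) (rev [0..<a]))"
    and "sorted_wrt (\<lambda>x y. y \<noteq> (x + 1) mod n) (map (\<lambda>j. (c + int j) mod n) (rev [0..<a]))"
proof -
  have inj: "j = j'" if "(c + int j) mod n = (c + int j') mod n" "j < a" "j' < a" for j j'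
  proof -
    have "n dvd int j - int j'" using that(1) by (simp add: mod_eq_dvd_iff)
    then show ?thesis using that assms I_dvd[of "int j" "int j'"] by (simp add: index_set_def)
  qed
  then show "distinct (map (\<lambda>j. (c + int j) mod n) (rev [0..<a]))"
    by (auto simp: distinct_map inj_on_def)
  have "sorted_wrt (\<lambda>j j'. j' < j) (rev [0..<a])"
    unfolding sorted_wrt_rev by (rule sorted_wrt_upt)
  then have "sorted_wrt (\<lambda>j j'. (c + int j') mod n \<noteq> ((c + int j) mod n + 1) mod n) (rev [0..<a])"
  proof (rule sorted_wrt_mono_rel[rotated])
    fix j j' assume j: "j \<in> set (rev [0..<a])" "j' \<in> set (rev [0..<a])" "j' < j"
    have "n dvd int j' - (int j + 1)" if "(c + int j') mod n = ((c + int j) mod n + 1) mod n"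
    proof -
      have "(c + int j') mod n = (c + int j + 1) mod n" using that by (simp add: mod_simps)
      then have "n dvd (c + int j') - (c + int j + 1)" by (simp only: mod_eq_dvd_iff)
      moreover have "(c + int j') - (c + int j + 1) = int j' - (int j + 1)" by simp
      ultimately show ?thesis by metis
    qed
    moreover have "\<not> n dvd (int j + 1) - int j'" using j assms by (intro not_n_dvd) auto
    ultimately show "(c + int j') mod n \<noteq> ((c + int j) mod n + 1) mod n"
      by (metis dvd_diff_commute)
  qed
  then show "sorted_wrt (\<lambda>x y. y \<noteq> (x + 1) mod n) (map (\<lambda>j. (c + int j) mod n) (rev [0..<a]))"
    unfolding sorted_wrt_map .
qed

lemma cyc_decreasing_iff:
  "cyc_decreasing k u \<longleftrightarrow> distinct u \<and> sorted_wrt (\<lambda>a b. b \<noteq> (a + 1) mod n) u"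
  by (auto simp: cyc_decreasing_def sorted_wrt_iff_nth_less)

text \<open>A misses some residue c, so the cycle can be cut open there: c + k, ..., c + 1 modulo n
  is a cyclically decreasing word, and it stays one when only the letters of A are kept.\<close>

lemma cyc_word:
  assumes "A \<subset> I"
  shows "set (cyc_word A) = A" "cyc_decreasing k (cyc_word A)"
proof -
  obtain c where c: "c \<in> I" "c \<notin> A" using assms by blast
  define m where "m = map (\<lambda>j. (c + 1 + int j) mod n) (rev [0..<k])"
  define u where "u = filter (\<lambda>x. x \<in> A) m"
  have "x \<in> set m" if "x \<in> A" for x
  proof -
    have x: "x \<in> I" "x \<noteq> c" using assms that c by auto
    define d where "d = (x - c) mod n"
    have xd: "(c + d) mod n = x" using x by (simp add: d_def mod_simps index_set_def)
    have "d \<noteq> 0" using xd x c(1) by (auto simp: index_set_def)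
    moreover have "0 \<le> d" "d < n" unfolding d_def by (rule mod_n)+
    ultimately have d: "1 \<le> d" "d < n" by linarith+
    then have "x = (c + 1 + int (nat (d - 1))) mod n" using xd by simp
    moreover have "nat (d - 1) \<in> set (rev [0..<k])" using d by auto
    ultimately show ?thesis unfolding m_def set_map by (rule image_eqI)
  qed
  then have "set u = A" by (auto simp: u_def)
  moreover have "cyc_decreasing k u"
    using cyc_interval[of k "c + 1"] unfolding cyc_decreasing_iff u_def m_def
    by (auto intro: sorted_wrt_filter)
  ultimately have "\<exists>u. set u = A \<and> cyc_decreasing k u" by blast
  from someI_ex[OF this] show "set (cyc_word A) = A" "cyc_decreasing k (cyc_word A)"
    by (auto simp: cyc_word_def)
qed

text \<open>\<open>demazure\<close> picks an arbitrary reduced word of d_A. By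
  \<open>foldr_left_max_cong\<close> the choice does not matter, and the cyclically decreasing word,
  reduced because its letters are distinct, can take its place.\<close>

lemma demazure_elt:
  assumes A: "A \<subset> I" and f: "f \<in> Aff"
  shows "demazure k (cyc_dec_elem k A) (elt f) = elt (foldr left_max (cyc_word A) f)"
proof -
  have v: "cyc_word A \<in> lists I" "set (cyc_word A) \<subseteq> I" "distinct (cyc_word A)"
    using cyc_word[OF A] A by (auto simp: cyc_decreasing_def)
  define x where "x = elt (perm (cyc_word A))"
  have x: "cyc_dec_elem k A = x"
    unfolding cyc_dec_elem_def cyc_word_def[symmetric] x_def by (rule word_class_eq_elt[OF v(1)])
  have lx: "len x = plen (perm (cyc_word A))" by (simp add: x_def plen_def)
  define u where "u = (SOME u. u \<in> x \<and> length u = len x)"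
  obtain u0 where "u0 \<in> lists I" "perm u0 = perm (cyc_word A)"
      "length u0 = plen (perm (cyc_word A))"
    using plen_obtain[of "perm (cyc_word A)"] by auto
  then have "\<exists>u. u \<in> x \<and> length u = len x" unfolding lx by (auto simp: x_def elt_mem)
  from someI_ex[OF this] have "u \<in> x" "length u = len x" by (simp_all only: u_def)
  then have u: "u \<in> lists I" "perm u = perm (cyc_word A)" "length u = plen (perm (cyc_word A))"
    unfolding lx by (auto simp: x_def elt_mem)
  have "foldr (demazure_gen k) y (elt f) = elt (foldr left_max y f)" if "y \<in> lists I" for y
    using that by (induction y) (auto simp: demazure_gen_elt f)
  then have "demazure k x (elt f) = elt (foldr left_max u f)"
    using u unfolding demazure_def u_def[symmetric] by blast
  also have "foldr left_max u f = foldr left_max (cyc_word A) f"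
    using u f distinct_reduced[OF v(3,2)] by (intro foldr_left_max_cong) auto
  finally show ?thesis unfolding x .
qed

text \<open>Operators on functions compose in the order opposite to the action on elements: the
  first letter is applied to F first, but the value at w is found by letting the last letter act on
  w first.\<close>

fun hecke_word :: "int list \<Rightarrow> ((int \<Rightarrow> int) \<Rightarrow> 'r::comm_ring_1) \<Rightarrow> (int \<Rightarrow> int) \<Rightarrow> 'r" where
  "hecke_word [] F = F"
| "hecke_word (i # u) F = hecke_word u (hecke_op i F)"

lemma plen_left_max_le: "f \<in> Aff \<Longrightarrow> plen (left_max i f) \<le> plen f + 1"
  using plen_left[of f i] asc_cases[of "finv f" i] by (fastforce simp: left_max_def)

lemma plen_foldr_left_max_le: "f \<in> Aff \<Longrightarrow> plen (foldr left_max u f) \<le> plen f + length u"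
proof (induction u)
  case (Cons i u)
  then show ?case using plen_left_max_le[of "foldr left_max u f" i] by simp
qed simp

text \<open>W\<degree> is closed under left descents, so a path that has left it never returns. This
  justifies the value 0 in \<open>hecke_op\<close>.\<close>

lemma left_max_not_Grass: "f \<in> Aff \<Longrightarrow> f \<notin> Grass \<Longrightarrow> left_max i f \<notin> Grass"
proof
  assume f: "f \<in> Aff" "f \<notin> Grass" "left_max i f \<in> Grass"
  then have "plen f < plen (swap i \<circ> f)" "swap i \<circ> f \<in> Grass"
    by (auto simp: left_max_def split: if_splits)
  then have "swap i \<circ> (swap i \<circ> f) \<in> Grass" using Grass_down[of "swap i \<circ> f" i] by simp
  with f show False by simp
qed

text \<open>A letter either raises the length by one or is idle. The exponent, the number of letters
  minus the gain in length, counts the idle letters, each of which contributes -1.\<close>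

lemma hecke_word_eq:
  assumes w: "w \<in> Grass"
  shows "hecke_word u F w = (if foldr left_max u w \<in> Grass
    then (-1) ^ (length u + plen w - plen (foldr left_max u w)) * F (foldr left_max u w) else 0)"
proof (induction u arbitrary: F)
  case Nil
  then show ?case using w by simp
next
  case (Cons i u)
  define d where "d = foldr left_max u w"
  have d: "d \<in> Aff" "plen d \<le> plen w + length u"
    using plen_foldr_left_max_le Grass_Aff[OF w] by (auto simp: d_def)
  have "hecke_word (i # u) F w =
      (if d \<in> Grass then (-1) ^ (length u + plen w - plen d) * hecke_op i F d else 0)"
    using Cons by (simp add: d_def)
  also have "\<dots> = (if left_max i d \<in> Grass
    then (-1) ^ (length (i # u) + plen w - plen (left_max i d)) * F (left_max i d) else 0)"
  proof (cases "d \<in> Grass \<and> left_max i d \<in> Grass")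
    case True
    show ?thesis
    proof (cases "plen d < plen (swap i \<circ> d)")
      case up: True
      then have "plen (swap i \<circ> d) = plen d + 1" using plen_left_iff plen_left d by blast
      then show ?thesis using True up by (simp add: hecke_op_def left_max_def)
    next
      case False
      have "length (i # u) + plen w - plen d = Suc (length u + plen w - plen d)" using d by simp
      then show ?thesis using True False by (simp add: hecke_op_def left_max_def)
    qed
  next
    case False
    then show ?thesis
      using left_max_not_Grass[OF d(1), of i] by (auto simp: hecke_op_def left_max_def)
  qed
  finally show ?case by (simp add: d_def)
qed

fun diff_word :: "int list \<Rightarrow> ((int \<Rightarrow> int) \<Rightarrow> 'r::comm_ring_1) \<Rightarrow> (int \<Rightarrow> int) \<Rightarrow> 'r" where
  "diff_word [] F = F"
| "diff_word (i # u) F = diff_word u (\<lambda>f. F (grass_act i f) - F f)"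

lemma diff_word_cong: "(\<And>f. f \<in> Grass \<Longrightarrow> F f = F' f) \<Longrightarrow> w \<in> Grass \<Longrightarrow> diff_word u F w =
    diff_word u F' w"
proof (induction u arbitrary: F F')
  case (Cons i u)
  show ?case unfolding diff_word.simps by (rule Cons.IH) (use Cons.prems in auto)
qed simp

lemma lower_sum_hecke_word: "w \<in> Grass \<Longrightarrow> lower_sum (hecke_word u F) w = diff_word u (lower_sum F) w"
proof (induction u arbitrary: F)
  case (Cons i u)
  have "lower_sum (hecke_word (i # u) F) w = diff_word u (lower_sum (hecke_op i F)) w"
    using Cons by simp
  also have "\<dots> = diff_word (i # u) (lower_sum F) w"
    using Cons.prems by (simp, intro diff_word_cong) (auto simp: lower_sum_hecke_op)
  finally show ?case .
qed simp

lemma Pieri_lower_sum: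
  assumes g: "K_k_Schur_family k g" and w: "w \<in> Grass" and r: "r \<in> {1..k}"
  shows "complete_sf r * lower_sum (g \<circ> elt) w =
    (\<Sum>A | A \<subset> I \<and> card A = r. diff_word (cyc_word A) (lower_sum (g \<circ> elt)) w)"
proof -
  have fin: "finite {A. A \<subset> I \<and> card A = r}"
    by (rule finite_subset[of _ "Pow I"]) (auto simp: index_set_def)
  have P: "complete_sf r * (g \<circ> elt) v =
      (\<Sum>A | A \<subset> I \<and> card A = r. hecke_word (cyc_word A) (g \<circ> elt) v)"
    if v: "v \<in> Grass" for v
  proof -
    note vG = Grass_Aff[OF v]
    have "elt v \<in> affine_grassmannian k" using v by (simp add: affine_grassmannian_elt)
    with g r have "complete_sf r * g (elt v) = (\<Sum>A | A \<subset> index_set k \<and> card A = r \<and>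
                demazure k (cyc_dec_elem k A) (elt v) \<in> affine_grassmannian k.
             (-1) ^ (r + len (elt v) - len (demazure k (cyc_dec_elem k A) (elt v))) *
               g (demazure k (cyc_dec_elem k A) (elt v)))"
      unfolding K_k_Schur_family_def by blast
    also have "\<dots> = (\<Sum>A | A \<subset> I \<and> card A = r. hecke_word (cyc_word A) (g \<circ> elt) v)"
    \<comment> \<open>The Pieri rule omits the A with d_A * v outside W\<degree>. For these
      \<open>hecke_word\<close> is 0, so the sum extends to all A of size r, independently of v, and
      can be exchanged with the sum over v.\<close>
    proof (rule sum.mono_neutral_cong_left[OF fin])
      have Grass: "demazure k (cyc_dec_elem k A) (elt v) \<in> affine_grassmannian k \<longleftrightarrow>
        foldr left_max (cyc_word A) v \<in> Grass" if "A \<subset> I" for A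
        unfolding demazure_elt[OF that vG] affine_grassmannian_elt
        using elt_inj[of "foldr left_max (cyc_word A) v"] vG by auto
      show "\<forall>A\<in>{A. A \<subset> I \<and> card A = r} - {A. A \<subset> index_set k \<and> card A = r \<and>
          demazure k (cyc_dec_elem k A) (elt v) \<in> affine_grassmannian k}.
          hecke_word (cyc_word A) (g \<circ> elt) v = 0"
      proof
        fix A assume "A \<in> {A. A \<subset> I \<and> card A = r} - {A. A \<subset> index_set k \<and> card A = r \<and>
          demazure k (cyc_dec_elem k A) (elt v) \<in> affine_grassmannian k}"
        then have A: "A \<subset> I" "demazure k (cyc_dec_elem k A) (elt v) \<notin> affine_grassmannian k"
          by blast+
        then show "hecke_word (cyc_word A) (g \<circ> elt) v = 0"
          using Grass[OF A(1)] by (simp add: hecke_word_eq[OF v])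
      qed
      fix A assume "A \<in> {A. A \<subset> index_set k \<and> card A = r \<and>
          demazure k (cyc_dec_elem k A) (elt v) \<in> affine_grassmannian k}"
      then have A: "A \<subset> I" "card A = r"
          "demazure k (cyc_dec_elem k A) (elt v) \<in> affine_grassmannian k"
        by blast+
      have m: "foldr left_max (cyc_word A) v \<in> Grass" using A(3) Grass[OF A(1)] by blast
      have "length (cyc_word A) = r"
        using cyc_word[OF A(1)] A(2) by (auto simp: cyc_decreasing_def dest: distinct_card)
      then show "(-1) ^ (r + len (elt v) - len (demazure k (cyc_dec_elem k A) (elt v))) *
           g (demazure k (cyc_dec_elem k A) (elt v)) = hecke_word (cyc_word A) (g \<circ> elt) v"
        using m by (simp add: hecke_word_eq[OF v] demazure_elt[OF A(1) vG] plen_def)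
    qed blast
    finally show ?thesis by simp
  qed
  have "complete_sf r * lower_sum (g \<circ> elt) w =
      (\<Sum>v | v \<in> Grass \<and> bleq v w. complete_sf r * (g \<circ> elt) v)"
    unfolding lower_sum_def by (rule sum_distrib_left)
  also have "\<dots> =
      (\<Sum>v | v \<in> Grass \<and> bleq v w. \<Sum>A | A \<subset> I \<and> card A = r. hecke_word (cyc_word A) (g \<circ> elt) v)"
    by (rule sum.cong) (auto simp: P[simplified])
  also have "\<dots> = (\<Sum>A | A \<subset> I \<and> card A = r. lower_sum (hecke_word (cyc_word A) (g \<circ> elt)) w)"
    unfolding lower_sum_def by (rule sum.swap)
  finally show ?thesis by (simp add: lower_sum_hecke_word[OF w])
qed

section \<open>Multiplication by a rectangle\<close>

text \<open>Conjugation by the c-th power of the rotation. The rotation is not a product of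
  generators, but conjugation by it preserves \<open>Aff\<close>, as it only adds c to each
  letter.\<close>

definition shift_conj :: "int \<Rightarrow> (int \<Rightarrow> int) \<Rightarrow> int \<Rightarrow> int" where
  "shift_conj c f x = f (x - c) + c"

lemma shift_conj_comp: "shift_conj c (f \<circ> g) = shift_conj c f \<circ> shift_conj c g"
  by (auto simp: shift_conj_def)

lemma shift_conj_shift_conj: "shift_conj c (shift_conj d f) = shift_conj (c + d) f"
  by (auto simp: shift_conj_def algebra_simps)

lemma shift_conj_0 [simp]: "shift_conj 0 f = f"
  by (auto simp: shift_conj_def)

lemma shift_conj_swap: "shift_conj c (swap i) = swap (i + c)"
  by (auto simp: shift_conj_def swap_def algebra_simps)

lemma perm_map_shift: "perm (map (\<lambda>i. i + c) u) = shift_conj c (perm u)"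
proof (induction u)
  case (Cons i u)
  have "shift_conj c (swap i \<circ> perm u) = swap (i + c) \<circ> shift_conj c (perm u)"
    by (simp add: shift_conj_comp shift_conj_swap)
  with Cons show ?case by (simp add: comp_def)
qed (auto simp: shift_conj_def)

lemma shift_conj_Aff: "f \<in> Aff \<Longrightarrow> shift_conj c f \<in> Aff"
  by (metis Aff_cases perm_map_shift perm_Aff)

lemma shift_conj_period: "f \<in> Aff \<Longrightarrow> shift_conj (c + n * q) f = shift_conj c f"
proof
  fix x assume f: "f \<in> Aff"
  have "f (x - c + n * (- q)) = f (x - c) + n * (- q)" by (rule Aff_shift[OF f])
  then show "shift_conj (c + n * q) f x = shift_conj c f x"
    by (simp add: shift_conj_def algebra_simps)
qed

lemma window_cases: obtains r q where "x = r + n * q" "1 \<le> r" "r \<le> n"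
proof -
  obtain r q where "x = 1 + r + n * q" "0 \<le> r" "r < n" by (rule offset_cases)
  then show thesis using that[of "1 + r" q] by simp
qed

section \<open>Rows and rectangles in one-line notation\<close>

definition row_word :: "nat \<Rightarrow> nat \<Rightarrow> int list" where
  "row_word m a = map (\<lambda>j. int j - int m) (rev [0..<a])"

lemma row_word_Suc: "row_word m (Suc a) = (int a - int m) # row_word m a"
  by (simp add: row_word_def)

lemma perm_row_word_shift: "perm (row_word m a) = shift_conj (- int m) (perm (row_word 0 a))"
  unfolding perm_map_shift[symmetric] by (simp add: row_word_def comp_def)

text \<open>One row is a cycle: as the letters 0, ..., a - 1 act in turn, the value 0 modulo n moves
  up past 1, ..., a, each of which drops by one. In the window 1..n that value is r = n, whence the
  summand n.\<close>

lemma perm_row0: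
  assumes "a \<le> k" "1 \<le> r" "r \<le> n"
  shows "perm (row_word 0 a) (r + n * q) =
      (if r = n then int a + n else if r \<le> int a then r - 1 else r) + n * q"
  using assms(1)
proof (induction a)
  case 0
  then show ?case using assms by (simp add: row_word_def)
next
  case (Suc a)
  have a: "int a < int k" using Suc by simp
  have swap: "swap (int a) (y + n * q) = swap (int a) y + n * q" for y q by (rule swap_shift)
  have 1: "swap (int a) y = (if y = int a then y + 1 else if y = int a + 1 then y - 1 else y)"
    if "0 \<le> y" "y < n" for y
    using swap_offset[of y "int a" 0 0] that a by simp
  have 2: "swap (int a) (int a + n) = int a + 1 + n"
    using swap_shift[of "int a" "int a" 1] by (simp add: swap_self)
  have 3: "swap (int a) r = r" if "int a + 1 < r" "r < n"
    using 1[of r] that by auto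
  have IH: "perm (row_word 0 (Suc a)) (r + n * q) =
    swap (int a) (if r = n then int a + n else if r \<le> int a then r - 1 else r) + n * q"
    using Suc swap by (simp add: row_word_Suc)
  consider "r = n" | "r \<le> int a" | "r = int a + 1" "r < n" | "int a + 1 < r" "r < n"
    using assms by linarith
  then show ?case
  proof cases
    case 1
    then show ?thesis unfolding IH using 2 by simp
  next
    case 2
    then have "swap (int a) (r - 1) = r - 1"
      using \<open>\<And>y. _ \<Longrightarrow> _ \<Longrightarrow> swap (int a) y = _\<close>[of "r - 1"] a assms by auto
    then show ?thesis unfolding IH using 2 a by simp
  next
    case 3
    then show ?thesis unfolding IH using a by (simp add: swap_self)
  next
    case 4
    then show ?thesis unfolding IH using 3 a by simp
  qed
qed

text \<open>
  The one-line notation of \<open>w\<^sub>R\<close> for the rectangle \<open>R\<^sub>t\<close>: up to a rotation, a translation.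
\<close>

definition rect_perm :: "nat \<Rightarrow> int \<Rightarrow> int" where
  "rect_perm t x = x + int t - (if (x - 1) mod n < int t then n else 0)"

lemma rect_perm_window: "1 \<le> r \<Longrightarrow> r \<le> n \<Longrightarrow>
  rect_perm t (r + n * q) = (if r \<le> int t then r + int t - n else r + int t) + n * q"
proof -
  assume r: "1 \<le> r" "r \<le> n"
  have "(r + n * q - 1) mod n = ((r - 1) + n * q) mod n" by (simp add: algebra_simps)
  also have "\<dots> = r - 1" using r by (simp only: mod_mult_self2) simp
  finally show ?thesis unfolding rect_perm_def by auto
qed

fun rows_word :: "nat \<Rightarrow> nat list \<Rightarrow> int list" where
  "rows_word m [] = []"
| "rows_word m (a # p) = rows_word (Suc m) p @ row_word m a"

lemma rows_word_append: "rows_word m (p @ p') = rows_word (m + length p) p' @ rows_word m p"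
  by (induction p arbitrary: m) auto

lemma perm_rows_word_shift: "perm (rows_word (m + c) p) =
    shift_conj (- int c) (perm (rows_word m p))"
proof (induction p arbitrary: m)
  case Nil
  then show ?case by (auto simp: shift_conj_def)
next
  case (Cons a p)
  have "perm (row_word (m + c) a) = shift_conj (- int c) (perm (row_word m a))"
    using perm_row_word_shift[of "m + c" a] perm_row_word_shift[of m a]
    by (simp add: shift_conj_shift_conj minus_diff_commute)
  with Cons[of "Suc m"] show ?case
    by (simp only: rows_word.simps perm_append shift_conj_comp add_Suc)
qed

lemma rows_word_eq: "rows_word m p =
    concat (map (\<lambda>i. row_word (m + i) (p ! i)) (rev [0..<length p]))"
proof (induction p arbitrary: m)
  case (Cons a p)
  have u: "[0..<length (a # p)] = 0 # map Suc [0..<length p]"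
    by (simp add: upt_conv_Cons map_Suc_upt del: upt_Suc)
  show ?case unfolding u by (simp add: Cons rev_map comp_def)
qed simp

lemma perm_residue_word: "perm (residue_word k p) = perm (rows_word 0 p)"
    "residue_word k p \<in> lists I"
proof -
  have "residue_word k p = map (\<lambda>i. i mod n) (rows_word 0 p)"
    unfolding residue_word_def rows_word_eq row_word_def by (simp add: map_concat comp_def)
  then show "perm (residue_word k p) = perm (rows_word 0 p)" "residue_word k p \<in> lists I"
    by (simp_all only: reduce_letters)
qed

lemma part_elem_elt: "part_elem k p = elt (perm (rows_word 0 p))"
  unfolding part_elem_def by (simp add: word_class_eq_elt perm_residue_word)

text \<open>A further row of length t lowers the values at the positions 1, ..., t by one and adds t
  to the value at n - j. After n - t rows every position above t has gained t once and the first t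
  positions have dropped by n - t, which is the formula of \<open>rect_perm\<close>.\<close>

lemma perm_rect:
  assumes t: "t \<le> k" and r: "1 \<le> r" "r \<le> n" and j: "j + t \<le> k + 1"
  shows "perm (rows_word 0 (replicate j t)) (r + n * q) =
    (if r \<le> int t then r - int j else if r > n - int j then r + int t else r) + n * q"
  using j
proof (induction j)
  case 0
  then show ?case using r by simp
next
  case (Suc j)
  have j: "int j + int t < n" using Suc by linarith
  have "rows_word 0 (replicate (Suc j) t) = row_word j t @ rows_word 0 (replicate j t)"
    using rows_word_append[of 0 "replicate j t" "[t]"] by (simp add: replicate_append_same)
  then have e: "perm (rows_word 0 (replicate (Suc j) t)) (r + n * q) =
    perm (row_word 0 t)
        ((if r \<le> int t then r - int j else if r > n - int j then r + int t else r) + n * q + int j)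
            - int j"
    using Suc by (simp add: perm_append perm_row_word_shift[of j] shift_conj_def)
  have R: "perm (row_word 0 t) (s + n * q') =
      (if s = n then int t + n else if s \<le> int t then s - 1 else s) + n * q'"
    if "1 \<le> s" "s \<le> n" for s q'
    using perm_row0[OF t that] .
  consider "r \<le> int t" | "int t < r" "r > n - int j" | "int t < r" "r = n - int j" | "int t < r"
      "r < n - int j"
    by linarith
  then show ?case
  proof cases
    case 1
    have "r < n" using 1 j by linarith
    then show ?thesis unfolding e using 1 R[of r q] r by (simp add: algebra_simps)
  next
    case 2
    \<comment> \<open>Such a position has gained t in an earlier row. Its value, written in the next
      window, lies strictly between t and n, where the row acts trivially.\<close>
    have "r + int t + n * q + int j = (r + int t + int j - n) + n * (q + 1)"
      by (simp add: algebra_simps)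
    then show ?thesis unfolding e using 2 R[of "r + int t + int j - n" "q + 1"] r j
      by (simp add: algebra_simps)
  next
    case 3
    then have y: "(if r \<le> int t then r - int j else if r > n - int j then r + int t else r) +
      n * q + int j = n + n * q" by simp
    have R3: "perm (row_word 0 t) (n + n * q) = int t + n + n * q" using R[of n q] n_ge_2 by simp
    show ?thesis unfolding e y R3 using 3 by simp
  next
    case 4
    then have y: "(if r \<le> int t then r - int j else if r > n - int j then r + int t else r) +
      n * q + int j = (r + int j) + n * q" by simp
    have R4: "perm (row_word 0 t) ((r + int j) + n * q) = (r + int j) + n * q"
      using R[of "r + int j" q] 4 r by simp
    show ?thesis unfolding e y R4 using 4 by simp
  qed
qed

lemma rect_perm_eq: "t \<le> k \<Longrightarrow> rect_perm t = perm (rows_word 0 (replicate (k + 1 - t) t))"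
proof
  fix x assume t: "t \<le> k"
  obtain r q where x: "x = r + n * q" "1 \<le> r" "r \<le> n" by (rule window_cases)
  have "int (k + 1 - t) = n - int t" using t by simp
  then show "rect_perm t x = perm (rows_word 0 (replicate (k + 1 - t) t)) x"
    unfolding x(1) rect_perm_window[OF x(2,3)] using perm_rect[OF t x(2,3), of "k + 1 - t" q] t x
    by auto
qed

lemma rect_perm_Aff: "t \<le> k \<Longrightarrow> rect_perm t \<in> Aff"
  using rect_perm_eq by simp

text \<open>
  The rectangle can be moved past a longer row at the cost of rotating the residues of that row.
\<close>

lemma rect_perm_row_word:
  assumes "t \<le> a" "a \<le> k"
  shows "shift_conj (- 1) (rect_perm t) \<circ> perm (row_word 0 a) =
      shift_conj (int t) (perm (row_word 0 a)) \<circ> rect_perm t"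
proof
  fix x
  obtain r q where x: "x = r + n * q" "1 \<le> r" "r \<le> n" by (rule window_cases)
  have a: "int t \<le> int a" "int a < n" using assms by simp_all
  have R: "perm (row_word 0 a) (s + n * q') =
      (if s = n then int a + n else if s \<le> int a then s - 1 else s) + n * q'"
    if "1 \<le> s" "s \<le> n" for s q'
    using perm_row0[OF assms(2) that] .
  note P = rect_perm_window[where t = t]
  \<comment> \<open>Both sides are followed through explicit intermediate values; each must be put
    into the form r + nq with r in the window before \<open>R\<close> or \<open>P\<close>
    applies.\<close>
  have goal: "shift_conj (- 1) (rect_perm t) (perm (row_word 0 a) x) =
      shift_conj (int t) (perm (row_word 0 a)) (rect_perm t x)"
    if "perm (row_word 0 a) x = y" "y + 1 = y'" "rect_perm t y' = z + int t + 1" "rect_perm t x = w"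
      "w - int t = w'" "perm (row_word 0 a) w' = z" for y y' z w w'
    using that by (simp add: shift_conj_def)
  consider "r = n" | "r \<le> int t" | "int t < r" "r \<le> int a" | "int a < r" "r < n" using x by linarith
  then have "shift_conj (- 1) (rect_perm t) (perm (row_word 0 a) x) =
      shift_conj (int t) (perm (row_word 0 a)) (rect_perm t x)"
  proof cases
    case 1
    show ?thesis
    proof (rule goal)
      show "perm (row_word 0 a) x = int a + n + n * q"
        using R[of n q] n_ge_2 unfolding x(1) 1 by simp
      show "int a + n + n * q + 1 = (int a + 1) + n * (q + 1)" by (simp add: distrib_left)
      show "rect_perm t ((int a + 1) + n * (q + 1)) = int a + n + n * q + int t + 1"
        using P[of "int a + 1" "q + 1"] a by (simp add: distrib_left)
      show "rect_perm t x = n + int t + n * q" using P[of n q] a n_ge_2 unfolding x(1) 1 by simp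
      show "n + int t + n * q - int t = n + n * q" by simp
      show "perm (row_word 0 a) (n + n * q) = int a + n + n * q" using R[of n q] n_ge_2 by simp
    qed
  next
    case 2
    then have "r < n" using a by simp
    show ?thesis
    proof (rule goal)
      show "perm (row_word 0 a) x = r - 1 + n * q" using R[of r q] x 2 a by simp
      show "r - 1 + n * q + 1 = r + n * q" by simp
      show "rect_perm t x = r + int t - n + n * q" using P[of r q] x 2 by simp
      show "r + int t - n + n * q - int t = r + n * (q - 1)" by (simp add: right_diff_distrib)
      show "perm (row_word 0 a) (r + n * (q - 1)) = r - 1 + n * (q - 1)"
        using R[of r "q - 1"] x 2 a by simp
      show "rect_perm t (r + n * q) = r - 1 + n * (q - 1) + int t + 1"
        using P[of r q] x 2 by (simp add: right_diff_distrib)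
    qed
  next
    case 3
    then have "r < n" using a by simp
    show ?thesis
    proof (rule goal)
      show "perm (row_word 0 a) x = r - 1 + n * q" using R[of r q] x 3 a by simp
      show "r - 1 + n * q + 1 = r + n * q" by simp
      show "rect_perm t x = r + int t + n * q" using P[of r q] x 3 by simp
      show "r + int t + n * q - int t = r + n * q" by simp
      show "perm (row_word 0 a) (r + n * q) = r - 1 + n * q" using R[of r q] x 3 a by simp
      show "rect_perm t (r + n * q) = r - 1 + n * q + int t + 1" using P[of r q] x 3 by simp
    qed
  next
    case 4
    show ?thesis
    proof (rule goal)
      show "perm (row_word 0 a) x = r + n * q" using R[of r q] x 4 a by simp
      show "r + n * q + 1 = (r + 1) + n * q" by simp
      show "rect_perm t x = r + int t + n * q" using P[of r q] x 4 a by simp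
      show "r + int t + n * q - int t = r + n * q" by simp
      show "perm (row_word 0 a) (r + n * q) = r + n * q" using R[of r q] x 4 a by simp
      show "rect_perm t ((r + 1) + n * q) = r + n * q + int t + 1"
        using P[of "r + 1" q] x 4 a by simp
    qed
  qed
  then show "(shift_conj (- 1) (rect_perm t) \<circ> perm (row_word 0 a)) x =
      (shift_conj (int t) (perm (row_word 0 a)) \<circ> rect_perm t) x" by simp
qed

text \<open>For each row crossed, the rectangle moves by one row, which lowers its residues by one,
  and the residues of the crossed row increase by t.\<close>

lemma rect_perm_has_rows:
  assumes "\<forall>a\<in>set p. t \<le> a \<and> a \<le> k"
  shows "shift_conj (- int (m + length p)) (rect_perm t) \<circ> perm (rows_word m p) =
    shift_conj (int t) (perm (rows_word m p)) \<circ> shift_conj (- int m) (rect_perm t)"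
  using assms
proof (induction p arbitrary: m)
  case Nil
  then show ?case by (auto simp: shift_conj_def)
next
  case (Cons a p)
  have "shift_conj (- int m) (shift_conj (- 1) (rect_perm t) \<circ> perm (row_word 0 a)) =
      shift_conj (- int m) (shift_conj (int t) (perm (row_word 0 a)) \<circ> rect_perm t)"
    using rect_perm_row_word[of t a] Cons.prems by simp
  then have r: "shift_conj (- int (Suc m)) (rect_perm t) \<circ> perm (row_word m a) =
      shift_conj (int t) (perm (row_word m a)) \<circ> shift_conj (- int m) (rect_perm t)"
    by (simp add: shift_conj_comp shift_conj_shift_conj perm_row_word_shift[of m a] add.commute)
  have IH: "shift_conj (- int (Suc m + length p)) (rect_perm t) \<circ> perm (rows_word (Suc m) p) =
      shift_conj (int t) (perm (rows_word (Suc m) p)) \<circ> shift_conj (- int (Suc m)) (rect_perm t)"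
    by (rule Cons.IH) (use Cons.prems in auto)
  have "shift_conj (- int (m + length (a # p))) (rect_perm t) \<circ> perm (rows_word m (a # p)) =
    (shift_conj (- int (Suc m + length p)) (rect_perm t) \<circ> perm (rows_word (Suc m) p)) \<circ>
        perm (row_word m a)"
    by (simp only: rows_word.simps perm_append comp_assoc list.size add_Suc_right add_Suc
        add_0_right)
  also have "\<dots> = shift_conj (int t) (perm (rows_word (Suc m) p)) \<circ>
      (shift_conj (- int (Suc m)) (rect_perm t) \<circ> perm (row_word m a))"
    unfolding IH by (simp only: comp_assoc)
  also have "\<dots> = shift_conj (int t) (perm (rows_word m (a # p))) \<circ>
      shift_conj (- int m) (rect_perm t)"
    unfolding r by (simp only: rows_word.simps perm_append shift_conj_comp comp_assoc)
  finally show ?case .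
qed

section \<open>The rectangle shift on Grassmannian elements\<close>

definition rect_shift :: "nat \<Rightarrow> (int \<Rightarrow> int) \<Rightarrow> int \<Rightarrow> int" where
  "rect_shift t f = shift_conj (int t) f \<circ> rect_perm t"

lemma rect_shift_Aff: "t \<le> k \<Longrightarrow> f \<in> Aff \<Longrightarrow> rect_shift t f \<in> Aff"
  by (simp add: rect_shift_def shift_conj_Aff rect_perm_Aff)

lemma rect_shift_id: "rect_shift t id = rect_perm t"
  by (auto simp: rect_shift_def shift_conj_def)

text \<open>The rectangle is inserted after the parts that are at least t; moving it to the top
  rotates their residues by t. The smaller parts move down by n - t rows, which lowers their
  residues by n - t, again a rotation by t modulo n. So all rows are rotated alike.\<close>

lemma perm_part_union:
  assumes p: "p \<in> bounded_partitions k" and t: "t \<le> k"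
  shows "perm (rows_word 0 (part_union (k_rectangle k t) p)) = rect_shift t (perm (rows_word 0 p))"
proof -
  define b s where "b = takeWhile (\<lambda>a. t \<le> a) p" and "s = dropWhile (\<lambda>a. t \<le> a) p"
  have ps: "p = b @ s" by (simp add: b_def s_def)
  have sp: "sorted_wrt (\<ge>) p" "set p \<subseteq> {1..k}" using p by (auto simp: bounded_partitions_def)
  have bt: "\<forall>a\<in>set b. t \<le> a \<and> a \<le> k" using sp(2) set_takeWhileD[of _ _ p] by (fastforce simp: b_def)
  have st: "\<forall>a\<in>set s. a \<le> t"
  proof (cases s)
    case (Cons c s')
    then have "\<not> t \<le> c" using hd_dropWhile[of "\<lambda>a. t \<le> a" p] by (auto simp: s_def)
    then show ?thesis using Cons sp(1) ps by (auto simp: sorted_wrt_append)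
  qed simp
  have "part_union (k_rectangle k t) p = b @ replicate (k + 1 - t) t @ s"
  proof -
    have "sorted_wrt (\<ge>) (b @ replicate (k + 1 - t) t @ s)"
    proof -
      have "sorted_wrt (\<ge>) (replicate (k + 1 - t) t)" by (simp add: sorted_wrt_iff_nth_less)
      then show ?thesis using sp(1) ps bt st by (auto simp: sorted_wrt_append)
    qed
    then have "sorted (rev (b @ replicate (k + 1 - t) t @ s))"
      by (simp only: sorted_wrt_rev)
    then have "sort (replicate (k + 1 - t) t @ p) = rev (b @ replicate (k + 1 - t) t @ s)"
      by (intro properties_for_sort) (simp_all add: ps)
    then show ?thesis by (simp add: part_union_def k_rectangle_def)
  qed
  then have "perm (rows_word 0 (part_union (k_rectangle k t) p)) =
    perm (rows_word (length b + (k + 1 - t)) s) \<circ>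
        (perm (rows_word (0 + length b) (replicate (k + 1 - t) t)) \<circ> perm (rows_word 0 b))"
    by (simp only: rows_word_append perm_append comp_assoc length_replicate add.assoc add_0)
  also have "perm (rows_word (0 + length b) (replicate (k + 1 - t) t)) \<circ> perm (rows_word 0 b) =
    shift_conj (- int (0 + length b)) (rect_perm t) \<circ> perm (rows_word 0 b)"
    unfolding perm_rows_word_shift rect_perm_eq[OF t] by simp
  also have "\<dots> = shift_conj (int t) (perm (rows_word 0 b)) \<circ> rect_perm t"
    using rect_perm_has_rows[OF bt, of 0] by simp
  also have "perm (rows_word (length b + (k + 1 - t)) s) =
      shift_conj (int t + n * (- 1)) (perm (rows_word (length b) s))"
  proof -
    have "- int (k + 1 - t) = int t + n * (- 1)" using t by simp
    then show ?thesis unfolding perm_rows_word_shift by (simp only:)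
  qed
  also have "\<dots> = shift_conj (int t) (perm (rows_word (length b) s))"
    by (rule shift_conj_period) simp
  finally show ?thesis
    unfolding rect_shift_def ps
    by (simp only: rows_word_append perm_append shift_conj_comp comp_assoc add_0)
qed

lemma finv_rect_shift:
  assumes f: "f \<in> Aff" and t: "t \<le> k"
  shows "finv (rect_shift t f) (y + int t) =
      finv f y + (if (finv f y - 1) mod n < int t then n else 0)"
proof -
  define p where "p = finv f y"
  define p' where "p' = p + (if (p - 1) mod n < int t then n else 0)"
  have "(p - 1 + n) mod n = (p - 1) mod n" by (rule mod_add_self2)
  then have "(p' - 1) mod n = (p - 1) mod n" by (simp add: p'_def algebra_simps)
  then have "rect_perm t p' = p + int t" by (simp add: rect_perm_def p'_def)
  then have "rect_shift t f p' = y + int t"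
    using f by (simp add: rect_shift_def shift_conj_def p_def)
  then have "finv (rect_shift t f) (y + int t) = p'"
    using finv_f(1)[OF rect_shift_Aff[OF t f], of p'] by simp
  then show ?thesis by (simp add: p_def p'_def)
qed

text \<open>On positions, the shift moves the first t places of each block to the next block and
  leaves the others in theirs.\<close>

lemma block_of_rect_shift:
  assumes f: "f \<in> Aff" and t: "t \<le> k"
  shows "block_of (rect_shift t f) (y + int t) =
      block_of f y + (if (finv f y - 1) mod n < int t then 1 else 0)"
  using block_shift[of "finv f y" 1] by (simp add: block_of_def finv_rect_shift[OF f t])

lemma rect_shift_Grass:
  assumes f: "f \<in> Grass" and t: "t \<le> k"
  shows "rect_shift t f \<in> Grass"
proof -
  note fG = Grass_Aff[OF f]
  have v: "rect_shift t f i = (if i \<le> int t then f i - n else f i) + int t" if "1 \<le> i" "i \<le> n" for i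
    using rect_perm_window[OF that, of t 0] Aff_shift[OF fG, of i "-1"]
    by (simp add: rect_shift_def shift_conj_def)
  have "rect_shift t f i < rect_shift t f (i + 1)" if "i \<in> {1..int k}" for i
  proof -
    have "f i < f (i + 1)" using f that by (simp add: Grass_def)
    then show ?thesis using that by (simp add: v)
  qed
  then show ?thesis using rect_shift_Aff[OF t fG] by (auto simp: Grass_def)
qed

text \<open>Each block index grows by 0 or 1, so only two cases are critical. If i and i + 1 share a
  block, they are neighbours with i first, so the index of i grows whenever that of i + 1 does. If i
  + 1 is in the next block, its offset there cannot exceed that of i, since monotonicity of f on the
  window would put i + 1 beyond i + n; so the index of i + 1 grows whenever that of i does.\<close>

lemma block_of_rect_shift_less:
  assumes f: "f \<in> Grass" and t: "t \<le> k"
  shows "block_of (rect_shift t f) (i + int t) < block_of (rect_shift t f) (i + 1 + int t) \<longleftrightarrow>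
      block_of f i < block_of f (i + 1)"
proof -
  note fG = Grass_Aff[OF f]
  define p q where "p = finv f i" and "q = finv f (i + 1)"
  have fpq: "f p = i" "f q = i + 1" using fG by (simp_all add: p_def q_def)
  have dec: "x = (x - 1) mod n + 1 + n * block x" for x
    using mult_div_mod_eq[of n "x - 1"] unfolding block_def by linarith
  have b: "block_of f i = block p" "block_of f (i + 1) = block q"
    by (simp_all add: block_of_def p_def q_def)
  have e: "block_of (rect_shift t f) (i + int t) =
      block p + (if (p - 1) mod n < int t then 1 else 0)"
    "block_of (rect_shift t f) (i + 1 + int t) = block q + (if (q - 1) mod n < int t then 1 else 0)"
    using block_of_rect_shift[OF fG t, of i] block_of_rect_shift[OF fG t, of "i + 1"]
    by (simp_all add: block_of_def p_def q_def)
  have eq: "(q - 1) mod n = (p - 1) mod n + 1" if "block p = block q"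
    using block_of_eq_dest(1)[OF f, of i] b that dec[of p] dec[of q] by (simp add: p_def q_def)
  have no: "\<not> ((p - 1) mod n < (q - 1) mod n)" if "block q = block p + 1"
  proof
    assume l: "(p - 1) mod n < (q - 1) mod n"
    have "f ((p - 1) mod n + 1) < f ((q - 1) mod n + 1)"
      using l mod_n[of "p - 1"] mod_n[of "q - 1"] by (intro Grass_mono0[OF f]) auto
    moreover have "i = f ((p - 1) mod n + 1) + n * block p"
      using dec[of p] fpq(1) Aff_shift[OF fG, of "(p - 1) mod n + 1" "block p"] by simp
    moreover have "i + 1 = f ((q - 1) mod n + 1) + n * block q"
      using dec[of q] fpq(2) Aff_shift[OF fG, of "(q - 1) mod n + 1" "block q"] by simp
    ultimately have "1 > n" using that by (simp add: algebra_simps)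
    then show False using n_ge_2 by simp
  qed
  show ?thesis unfolding e unfolding b
    using eq no by (cases "block p" "block q" rule: linorder_cases) (auto; fastforce)+
qed

lemma grass_act_rect_shift:
  assumes f: "f \<in> Grass" and t: "t \<le> k"
  shows "grass_act (i + int t) (rect_shift t f) = rect_shift t (grass_act i f)"
proof -
  have "swap (i + int t) \<circ> rect_shift t f = rect_shift t (swap i \<circ> f)"
    by (simp only: rect_shift_def shift_conj_comp shift_conj_swap comp_assoc)
  then show ?thesis
    using block_of_rect_shift_less[OF f t, of i]
    by (simp add: grass_act_def add.commute add.left_commute)
qed

section \<open>Invariance of the Pieri rule under the shift\<close>

lemma diff_word_rect_shift:
  assumes w: "w \<in> Grass" and t: "t \<le> k"
  shows "diff_word u (F \<circ> rect_shift t) w = diff_word (map (\<lambda>i. i + int t) u) F (rect_shift t w)"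
proof (induction u arbitrary: F)
  case (Cons i u)
  have "diff_word (i # u) (F \<circ> rect_shift t) w =
      diff_word u ((\<lambda>f. F (grass_act (i + int t) f) - F f) \<circ> rect_shift t) w"
    unfolding diff_word.simps
    by (rule diff_word_cong[OF _ w]) (simp add: grass_act_rect_shift[OF _ t])
  also have "\<dots> = diff_word (map (\<lambda>i. i + int t) (i # u)) F (rect_shift t w)"
    unfolding Cons by simp
  finally show ?case .
qed simp

lemma grass_act_mod: "f \<in> Aff \<Longrightarrow> grass_act (i mod n) f = grass_act i f"
proof -
  assume f: "f \<in> Aff"
  have "i = i mod n + n * (i div n)" using mult_div_mod_eq[of n i] by linarith
  then have "block_of f i = block_of f (i mod n) + i div n"
      "block_of f (i + 1) = block_of f (i mod n + 1) + i div n"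
    using block_of_shift[OF f, of "i mod n" "i div n"] block_of_shift[OF f, of "i mod n + 1"
        "i div n"]
    by (simp_all add: algebra_simps)
  then show ?thesis by (simp add: grass_act_def swap_mod)
qed

lemma diff_word_mod: "w \<in> Grass \<Longrightarrow> diff_word (map (\<lambda>i. i mod n) u) F w = diff_word u F w"
proof (induction u arbitrary: F)
  case (Cons i u)
  then show ?case
    by (simp, intro diff_word_cong) (auto simp: grass_act_mod Grass_Aff)
qed simp

text \<open>The first letter i of u can be moved to the front of v: a letter j before it in v is not
  i - 1 because v is cyclically decreasing, and not i + 1 because i precedes j in u, so it commutes
  with i.\<close>

lemma perm_cyc_unique:
  assumes "distinct u" "distinct v" "set u = set v" "set u \<subseteq> I"
    "sorted_wrt (\<lambda>a b. b \<noteq> (a + 1) mod n) u" "sorted_wrt (\<lambda>a b. b \<noteq> (a + 1) mod n) v"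
  shows "perm u = perm v"
  using assms
proof (induction u arbitrary: v)
  case (Cons i u)
  obtain v1 v2 where v: "v = v1 @ i # v2"
    using Cons.prems(3) by (metis list.set_intros(1) split_list)
  have c: "swap j (swap i x) = swap i (swap j x)" if j: "j \<in> set v1" for j x
  proof (rule swap_commute)
    have ji: "j \<noteq> i" "j \<in> I" "i \<in> I" "j \<in> set u" using j v Cons.prems by auto
    have n1: "i \<noteq> (j + 1) mod n" using j v Cons.prems(6) by (auto simp: sorted_wrt_append)
    have n2: "j \<noteq> (i + 1) mod n" using ji Cons.prems(5) by auto
    have m: "i mod n = i" "j mod n = j" using ji by (auto simp: index_set_def)
    have "(j - i) mod n \<noteq> 0" using ji I_dvd[of j i] by (auto simp: dvd_eq_mod_eq_0)
    moreover have "(j - i) mod n \<noteq> 1"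
    proof
      assume "(j - i) mod n = 1"
      then have "(i + (j - i) mod n) mod n = (i + 1) mod n" by simp
      then show False using n2 m by (simp add: mod_simps)
    qed
    moreover have "(j - i) mod n \<noteq> int k"
    proof
      assume "(j - i) mod n = int k"
      then have "n dvd (j - i) - int k" using dvd_minus_mod[of n "j - i"] by simp
      then have "n dvd ((j - i) - int k) + n" by (rule dvd_add) (rule dvd_refl)
      moreover have "((j - i) - int k) + n = (j + 1) - i" by simp
      ultimately have "(j + 1) mod n = i mod n" by (simp only: mod_eq_dvd_iff)
      then show False using n1 m by simp
    qed
    ultimately show "(j - i) mod n \<notin> {0, 1, int k}" by blast
  qed
  then have "perm v1 \<circ> swap i = swap i \<circ> perm v1"
    by (induction v1) (auto simp: fun_eq_iff)
  then have "perm v = swap i \<circ> perm (v1 @ v2)"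
    unfolding v by (simp only: perm_append perm.simps comp_assoc[symmetric])
  moreover have "perm u = perm (v1 @ v2)"
    using Cons.prems v by (intro Cons.IH) (auto simp: sorted_wrt_append)
  ultimately show ?case by (simp only: perm.simps)
qed simp

text \<open>Independence of the word is known for \<open>foldr left_max\<close>, hence for
  \<open>hecke_word\<close>, and carries over to \<open>diff_word\<close> through lower sums. For
  that reason the argument is a lower sum and not an arbitrary function.\<close>

lemma diff_word_lower_sum_cong:
  assumes w: "w \<in> Grass" and "cyc_decreasing k u" "cyc_decreasing k v" "set u = set v" "set u \<subseteq> I"
  shows "diff_word u (lower_sum F) w = diff_word v (lower_sum F) w"
proof -
  have d: "distinct u" "distinct v" using assms by (auto simp: cyc_decreasing_def)
  then have l: "length u = length v" using assms(4) by (metis distinct_card)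
  have e: "perm u = perm v" using assms by (intro perm_cyc_unique) (auto simp: cyc_decreasing_iff)
  have fc: "foldr left_max u f = foldr left_max v f" if "f \<in> Aff" for f
    using distinct_reduced[OF d(1)] distinct_reduced[OF d(2)] e assms that
    by (intro foldr_left_max_cong) auto
  have "hecke_word u F x = hecke_word v F x" if "x \<in> Grass" for x
    unfolding hecke_word_eq[OF that] fc[OF Grass_Aff[OF that]] l ..
  then have "lower_sum (hecke_word u F) w = lower_sum (hecke_word v F) w"
    unfolding lower_sum_def by (intro sum.cong) auto
  then show ?thesis using w by (simp add: lower_sum_hecke_word)
qed

definition rot_letter :: "nat \<Rightarrow> int \<Rightarrow> int" where "rot_letter t i = (i + int t) mod n"

lemma rot_letter_I: "rot_letter t i \<in> I"
  using mod_n by (simp add: rot_letter_def index_set_def)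

lemma rot_letter_inj: "inj_on (rot_letter t) I"
proof (rule inj_onI)
  fix x y assume xy: "x \<in> I" "y \<in> I" "rot_letter t x = rot_letter t y"
  then have "n dvd (x + int t) - (y + int t)" by (simp only: rot_letter_def mod_eq_dvd_iff)
  then show "x = y" using xy I_dvd by simp
qed

lemma rot_letter_image_I: "rot_letter t ` I = I"
  using rot_letter_I by (intro endo_inj_surj rot_letter_inj) (auto simp: index_set_def)

lemma rot_letter_psubset: "A \<subset> I \<Longrightarrow> rot_letter t ` A \<subset> I"
  by (metis rot_letter_image_I rot_letter_inj inj_on_image_eq_iff image_mono psubset_eq order_refl)

lemma bij_rot_letter: "bij_betw (image (rot_letter t)) {A. A \<subset> I \<and> card A = r} {A. A \<subset> I \<and> card A =
    r}"
proof (rule bij_betwI')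
  fix A B assume "A \<in> {A. A \<subset> I \<and> card A = r}" "B \<in> {A. A \<subset> I \<and> card A = r}"
  then show "rot_letter t ` A = rot_letter t ` B \<longleftrightarrow> A = B"
    using inj_on_image_eq_iff[OF rot_letter_inj, of A B t] by blast
next
  fix A assume "A \<in> {A. A \<subset> I \<and> card A = r}"
  then show "rot_letter t ` A \<in> {A. A \<subset> I \<and> card A = r}"
    using rot_letter_psubset[of A t] card_image[OF inj_on_subset[OF rot_letter_inj, of A]] by blast
next
  fix B assume B: "B \<in> {A. A \<subset> I \<and> card A = r}"
  define A where "A = {x \<in> I. rot_letter t x \<in> B}"
  have im: "rot_letter t ` A = B" using B rot_letter_image_I[of t] by (auto simp: A_def)
  have "A \<subseteq> I" by (auto simp: A_def)
  moreover have "A \<noteq> I" using B im rot_letter_image_I[of t] by auto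
  moreover have "card A = r"
    using B im card_image[OF inj_on_subset[OF rot_letter_inj, of A]] \<open>A \<subseteq> I\<close> by auto
  ultimately show "\<exists>A\<in>{A. A \<subset> I \<and> card A = r}. B = rot_letter t ` A" using im by blast
qed

lemma cyc_map_rot_letter:
  assumes A: "A \<subset> I"
  shows "cyc_decreasing k (map (rot_letter t) (cyc_word A))"
proof -
  have v: "set (cyc_word A) = A" "distinct (cyc_word A)"
      "sorted_wrt (\<lambda>a b. b \<noteq> (a + 1) mod n) (cyc_word A)"
    using cyc_word[OF A] by (auto simp: cyc_decreasing_iff)
  have "distinct (map (rot_letter t) (cyc_word A))"
    using v A inj_on_subset[OF rot_letter_inj] by (auto simp: distinct_map)
  moreover have "sorted_wrt (\<lambda>a b. rot_letter t b \<noteq> (rot_letter t a + 1) mod n) (cyc_word A)"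
  proof (rule sorted_wrt_mono_rel[OF _ v(3)])
    fix a b assume ab: "a \<in> set (cyc_word A)" "b \<in> set (cyc_word A)" "b \<noteq> (a + 1) mod n"
    show "rot_letter t b \<noteq> (rot_letter t a + 1) mod n"
    proof
      assume "rot_letter t b = (rot_letter t a + 1) mod n"
      then have "(b + int t) mod n = (a + 1 + int t) mod n"
        by (simp add: rot_letter_def mod_simps algebra_simps)
      then have "n dvd (b + int t) - (a + 1 + int t)" by (simp only: mod_eq_dvd_iff)
      then have "b mod n = (a + 1) mod n" by (simp add: mod_eq_dvd_iff)
      then show False using ab v(1) A by (auto simp: index_set_def)
    qed
  qed
  ultimately show ?thesis by (simp add: cyc_decreasing_iff sorted_wrt_map)
qed

lemma Pieri_rect_shift:
  assumes P: "\<And>w. w \<in> Grass \<Longrightarrow> h * lower_sum F w =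
      (\<Sum>A | A \<subset> I \<and> card A = r. diff_word (cyc_word A) (lower_sum F) w)"
    and w: "w \<in> Grass" and t: "t \<le> k"
  shows "h * (lower_sum F \<circ> rect_shift t) w =
      (\<Sum>A | A \<subset> I \<and> card A = r. diff_word (cyc_word A) (lower_sum F \<circ> rect_shift t) w)"
proof -
  note wt = rect_shift_Grass[OF w t]
  have "diff_word (cyc_word A) (lower_sum F \<circ> rect_shift t) w =
      diff_word (cyc_word (rot_letter t ` A)) (lower_sum F) (rect_shift t w)" if A: "A \<subset> I" for A
  proof -
    have "diff_word (cyc_word A) (lower_sum F \<circ> rect_shift t) w =
        diff_word (map (\<lambda>i. i mod n) (map (\<lambda>i. i + int t) (cyc_word A))) (lower_sum F)
            (rect_shift t w)"
      unfolding diff_word_rect_shift[OF w t] diff_word_mod[OF wt] ..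
    also have "map (\<lambda>i. i mod n) (map (\<lambda>i. i + int t) (cyc_word A)) =
        map (rot_letter t) (cyc_word A)"
      by (simp add: rot_letter_def)
    also have "diff_word (map (rot_letter t) (cyc_word A)) (lower_sum F) (rect_shift t w) =
        diff_word (cyc_word (rot_letter t ` A)) (lower_sum F) (rect_shift t w)"
      using cyc_word[OF A] cyc_word[OF rot_letter_psubset[OF A, of t]]
          rot_letter_psubset[OF A, of t]
      by (intro diff_word_lower_sum_cong[OF wt] cyc_map_rot_letter[OF A]) auto
    finally show ?thesis .
  qed
  then have "(\<Sum>A | A \<subset> I \<and> card A = r. diff_word (cyc_word A) (lower_sum F \<circ> rect_shift t) w) =
    (\<Sum>A | A \<subset> I \<and> card A =
        r. diff_word (cyc_word (rot_letter t ` A)) (lower_sum F) (rect_shift t w))"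
    by (intro sum.cong) auto
  also have "\<dots> = (\<Sum>A | A \<subset> I \<and> card A = r. diff_word (cyc_word A) (lower_sum F) (rect_shift t w))"
    by (rule sum.reindex_bij_betw[OF bij_rot_letter])
  finally show ?thesis using P[OF wt] by simp
qed

section \<open>Solutions of the Pieri recursion\<close>

lemma swap_fix: "x \<noteq> i \<Longrightarrow> x \<noteq> i + 1 \<Longrightarrow> i + 1 - n < x \<Longrightarrow> x < i + n \<Longrightarrow> swap i x = x"
  using not_n_dvd[of "x - i"] not_n_dvd[of "x - (i + 1)"] not_n_dvd[of "i - x"]
    not_n_dvd[of "i + 1 - x"] dvd_diff_commute[of n x i] dvd_diff_commute[of n x "i + 1"]
  unfolding swap_def by (cases "x < i") auto

lemma block_of_lower:
  assumes f: "f \<in> Aff" and "\<forall>x\<in>{c..<c + n}. block_of f x \<le> 0" "x < c"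
  shows "block_of f x < 0"
proof -
  define q where "q = (x - c) div n"
  define r where "r = (x - c) mod n"
  have "n * q + r = x - c" unfolding q_def r_def by (rule mult_div_mod_eq)
  then have x: "x = (c + r) + n * q" by simp
  have r: "0 \<le> r" "r < n" unfolding r_def by (rule mod_n)+
  have "q < 0" unfolding q_def using assms(3) by (intro div_neg_pos_less0) auto
  moreover have "block_of f (c + r) \<le> 0" using assms(2) r by auto
  ultimately show ?thesis unfolding x using block_of_shift[OF f] by simp
qed

section \<open>Adding and removing a row\<close>

definition interval_word :: "int \<Rightarrow> nat \<Rightarrow> int list" where
  "interval_word c a = map (\<lambda>j. c + int j) (rev [0..<a])"

lemma row_word_interval_word: "row_word m a = interval_word (- int m) a"
  by (simp add: row_word_def interval_word_def)

lemma interval_word_Suc: "interval_word c (Suc a) = (c + int a) # interval_word c a"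
  by (simp add: interval_word_def)

lemma block_of_step:
  assumes f: "f \<in> Grass" and "block_of f i \<noteq> block_of f (i + 1)" and "c \<le> i" "i + 1 < c + n"
  shows "swap i \<circ> f \<in> Grass" "block_of (swap i \<circ> f) i = block_of f (i + 1)"
      "block_of (swap i \<circ> f) (i + 1) = block_of f i"
    "\<forall>x\<in>{c..<c + n} - {i, i + 1}. block_of (swap i \<circ> f) x = block_of f x"
    "block_of f i < block_of f (i + 1) \<Longrightarrow> plen (swap i \<circ> f) = plen f + 1"
    "block_of f (i + 1) < block_of f i \<Longrightarrow> plen f = plen (swap i \<circ> f) + 1"
  using block_of_neq_Grass[OF f assms(2)] block_of_comp[OF Grass_Aff[OF f]] assms swap_fix[of _ i]
    plen_left[OF Grass_Aff[OF f], of i] block_less[of "finv f i" "finv f (i + 1)"]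
    block_less[of "finv f (i + 1)" "finv f i"]
  by (auto simp: swap_self block_of_def)

text \<open>In the Maya diagram the bead at c, a place of negative index, moves right past a places
  of index 0. Each move exchanges a smaller index with a larger one on its right, so it is an ascent
  within W\<degree>. With c = -m this adds a row of a cells as row m, counted from 0.\<close>

lemma interval_word_up:
  assumes f: "f \<in> Grass" and "block_of f c < 0" "\<forall>j\<in>{1..int a}. block_of f (c + j) = 0" "a \<le> k"
  shows "perm (interval_word c a) \<circ> f \<in> Grass"
    "plen (perm (interval_word c a) \<circ> f) = plen f + a"
    "\<forall>j\<in>{0..<int a}. block_of (perm (interval_word c a) \<circ> f) (c + j) = 0"
    "block_of (perm (interval_word c a) \<circ> f) (c + int a) < 0"
    "\<forall>x\<in>{c..<c + n} - {c..c + int a}. block_of (perm (interval_word c a) \<circ> f) x = block_of f x"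
  using assms(3,4)
proof (induction a)
  case 0
  {
    case 1
    then show ?case using assms by (simp add: interval_word_def)
  next
    case 2
    then show ?case by (simp add: interval_word_def)
  next
    case 3
    then show ?case by simp
  next
    case 4
    then show ?case using assms by (simp add: interval_word_def)
  next
    case 5
    then show ?case by (simp add: interval_word_def)
  }
next
  case (Suc a)
  define g where "g = perm (interval_word c a) \<circ> f"
  have e: "perm (interval_word c (Suc a)) \<circ> f = swap (c + int a) \<circ> g"
    unfolding g_def interval_word_Suc by (simp only: perm.simps comp_assoc)
  {
    assume a: "\<forall>j\<in>{1..int (Suc a)}. block_of f (c + j) = 0" "Suc a \<le> k"
    then have a': "\<forall>j\<in>{1..int a}. block_of f (c + j) = 0" "a \<le> k" by auto
    note IH = Suc.IH[OF a', folded g_def]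
    have z: "block_of g (c + int a + 1) = 0"
    proof -
      have e: "c + int a + 1 = c + int (Suc a)" by simp
      have "block_of f (c + int a + 1) = 0" unfolding e by (rule a(1)[rule_format]) simp
      moreover have "c + int a + 1 \<in> {c..<c + n} - {c..c + int a}" using a(2) by auto
      ultimately show ?thesis using IH(5) by simp
    qed
    then have ne: "block_of g (c + int a) < block_of g (c + int a + 1)" using IH(4) by simp
    have s: "c \<le> c + int a" "c + int a + 1 < c + n" using a(2) by auto
    note st = block_of_step[OF IH(1) less_imp_neq[OF ne] s]
    have e': "c + int (Suc a) = c + int a + 1" by simp
    have "swap (c + int a) \<circ> g \<in> Grass \<and> plen (swap (c + int a) \<circ> g) = plen f + Suc a \<and>
      (\<forall>j\<in>{0..<int (Suc a)}. block_of (swap (c + int a) \<circ> g) (c + j) = 0) \<and>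
      block_of (swap (c + int a) \<circ> g) (c + int (Suc a)) < 0 \<and>
      (\<forall>x\<in>{c..<c + n} - {c..c + int (Suc a)}. block_of (swap (c + int a) \<circ> g) x = block_of f x)"
    proof (intro conjI ballI)
      show "swap (c + int a) \<circ> g \<in> Grass" by (rule st)
      show "plen (swap (c + int a) \<circ> g) = plen f + Suc a" using st(5)[OF ne] IH(2) by simp
      show "block_of (swap (c + int a) \<circ> g) (c + int (Suc a)) < 0"
        unfolding e' using st(3) IH(4) by simp
      fix j assume "j \<in> {0..<int (Suc a)}"
      then consider "j = int a" | "j \<in> {0..<int a}" by fastforce
      then show "block_of (swap (c + int a) \<circ> g) (c + j) = 0"
      proof cases
        case 1
        then show ?thesis using st(2) z by simp
      next
        case 2
        then have "c + j \<in> {c..<c + n} - {c + int a, c + int a + 1}" using a(2) by auto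
        then show ?thesis using st(4) IH(3) 2 by simp
      qed
    next
      fix x assume "x \<in> {c..<c + n} - {c..c + int (Suc a)}"
      then have "x \<in> {c..<c + n} - {c + int a, c + int a + 1}" "x \<in> {c..<c + n} - {c..c + int a}"
        by auto
      then show "block_of (swap (c + int a) \<circ> g) x = block_of f x" using st(4) IH(5) by simp
    qed
  }
  note all = this[folded e]
  {
    case 1 then show ?case using all by blast
  next
    case 2 then show ?case using all by blast
  next
    case 3 then show ?case using all by blast
  next
    case 4 then show ?case using all by blast
  next
    case 5 then show ?case using all by blast
  }
qed

lemma interval_word_down:
  assumes "f \<in> Grass" "block_of f (c + int a) < 0" "\<forall>j\<in>{0..<int a}. block_of f (c + j) = 0" "a \<le> k"
  shows "\<exists>v\<in>Grass. f = perm (interval_word c a) \<circ> v \<and> plen f = plen v + a \<and> block_of v c < 0 \<and>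
    (\<forall>j\<in>{1..int a}. block_of v (c + j) = 0) \<and>
        (\<forall>x\<in>{c..<c + n} - {c..c + int a}. block_of v x = block_of f x)"
  using assms
proof (induction a arbitrary: f)
  case 0
  then show ?case by (intro bexI[of _ f]) (auto simp: interval_word_def)
next
  case (Suc a)
  note f = Suc.prems(1)
  define i where "i = c + int a"
  have z: "block_of f i = 0" "block_of f (i + 1) < 0"
    using Suc.prems by (auto simp: i_def algebra_simps)
  then have ne: "block_of f i \<noteq> block_of f (i + 1)" by simp
  have s: "c \<le> i" "i + 1 < c + n" using Suc.prems(4) by (auto simp: i_def)
  note st = block_of_step[OF f ne s]
  define g where "g = swap i \<circ> f"
  have "\<exists>v\<in>Grass. g = perm (interval_word c a) \<circ> v \<and> plen g = plen v + a \<and> block_of v c < 0 \<and>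
    (\<forall>j\<in>{1..int a}. block_of v (c + j) = 0) \<and>
        (\<forall>x\<in>{c..<c + n} - {c..c + int a}. block_of v x = block_of g x)"
  proof (rule Suc.IH)
    show "g \<in> Grass" "block_of g (c + int a) < 0" "a \<le> k"
      using st(1,2) z Suc.prems(4) by (auto simp: g_def i_def)
    show "\<forall>j\<in>{0..<int a}. block_of g (c + j) = 0"
    proof
      fix j assume j: "j \<in> {0..<int a}"
      then have "c + j \<in> {c..<c + n} - {i, i + 1}" using s by (auto simp: i_def)
      then show "block_of g (c + j) = 0" using st(4) j Suc.prems(3) by (auto simp: g_def)
    qed
  qed
  then obtain v where v: "v \<in> Grass" "g = perm (interval_word c a) \<circ> v" "plen g = plen v + a"
      "block_of v c < 0"
    "\<forall>j\<in>{1..int a}. block_of v (c + j) = 0"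
        "\<forall>x\<in>{c..<c + n} - {c..c + int a}. block_of v x = block_of g x" by blast
  have "f = swap i \<circ> g" by (simp add: g_def)
  then have 1: "f = perm (interval_word c (Suc a)) \<circ> v"
    unfolding v(2) interval_word_Suc i_def by (simp only: perm.simps comp_assoc)
  have 2: "plen f = plen v + Suc a" using st(6) z v(3) by (simp add: g_def)
  have 3: "block_of v (c + int a + 1) = 0"
  proof -
    have "c + int a + 1 \<in> {c..<c + n} - {c..c + int a}" using s by (auto simp: i_def)
    then show ?thesis using v(6) st(3) z by (simp add: g_def i_def)
  qed
  have 4: "\<forall>j\<in>{1..int (Suc a)}. block_of v (c + j) = 0"
  proof
    fix j assume "j \<in> {1..int (Suc a)}"
    then consider "j = int a + 1" | "j \<in> {1..int a}" by fastforce
    then show "block_of v (c + j) = 0" using 3 v(5) by cases (auto simp: add.assoc)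
  qed
  have 5: "\<forall>x\<in>{c..<c + n} - {c..c + int (Suc a)}. block_of v x = block_of f x"
  proof
    fix x assume "x \<in> {c..<c + n} - {c..c + int (Suc a)}"
    then have "x \<in> {c..<c + n} - {i, i + 1}" "x \<in> {c..<c + n} - {c..c + int a}"
      by (auto simp: i_def)
    then show "block_of v x = block_of f x" using st(4) v(6) by (simp add: g_def)
  qed
  show ?case using v(1,4) 1 2 4 5 by blast
qed

text \<open>
  If \<open>f = w\<^sub>\<lambda>\<close>, then \<open>m\<close> is the number of parts of \<open>\<lambda>\<close> and \<open>a\<close> in the next definition is the smallest
  part. Both can be read off from the blocks without knowing \<open>\<lambda>\<close>.
\<close>

definition has_rows :: "nat \<Rightarrow> (int \<Rightarrow> int) \<Rightarrow> bool" where
  "has_rows m f \<longleftrightarrow> (\<forall>x\<le>- int m. block_of f x < 0) \<and> block_of f (1 - int m) = 0"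

definition has_last_part :: "nat \<Rightarrow> nat \<Rightarrow> (int \<Rightarrow> int) \<Rightarrow> bool" where
  "has_last_part m a f \<longleftrightarrow> (\<forall>j\<in>{0..<int a}. block_of f (1 - int m + j) = 0) \<and>
      block_of f (1 - int m + int a) \<noteq> 0"

lemma has_rows_le: "has_rows m f \<Longrightarrow> \<forall>x\<le>- int m'. block_of f x < 0 \<Longrightarrow> m \<le> m'"
  unfolding has_rows_def by (rule ccontr) (drule spec[of _ "1 - int m"], auto)

lemma has_rows_unique: "has_rows m f \<Longrightarrow> has_rows m' f \<Longrightarrow> m = m'"
  using has_rows_le[of m f m'] has_rows_le[of m' f m] by (auto simp: has_rows_def)

lemma has_last_part_le: "has_last_part m a f \<Longrightarrow> \<forall>j\<in>{0..<int a'}. block_of f (1 - int m + j) = 0 \<Longrightarrow>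
    a' \<le> a"
  unfolding has_last_part_def by (rule ccontr) auto

lemma has_last_part_unique: "has_last_part m a f \<Longrightarrow> has_last_part m a' f \<Longrightarrow> a = a'"
  using has_last_part_le[of m a f a'] has_last_part_le[of m a' f a]
  by (auto simp: has_last_part_def)

lemma has_rows_window: "f \<in> Aff \<Longrightarrow> has_rows m f \<Longrightarrow> x < 1 - int m + n \<Longrightarrow> block_of f x \<le> 0"
proof -
  assume f: "f \<in> Aff" and "has_rows m f" "x < 1 - int m + n"
  then have "block_of f (x + n * (- 1)) < 0" by (simp add: has_rows_def)
  then show ?thesis unfolding block_of_shift[OF f] by simp
qed

lemma block_of_id: "block_of id x = block x"
  by (simp add: block_of_def)

lemma has_rows_id: "has_rows 0 id"
proof -
  have 1: "block 1 = 0" using n_ge_2 by (subst block_iff) simp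
  have "block x < 0" if "x \<le> 0" for x
  proof (rule ccontr)
    assume "\<not> block x < 0"
    then consider "block x = 0" | "block 1 < block x" using 1 by linarith
    then show False
    proof cases
      case 1
      then show False using that by (subst (asm) block_iff) simp
    next
      case 2
      then show False using block_less that by fastforce
    qed
  qed
  then show ?thesis using 1 by (simp add: has_rows_def block_of_id)
qed

section \<open>Charge of the Maya diagram and removal of the last row\<close>

lemma block_of_sum_step: "f \<in> Aff \<Longrightarrow> (\<Sum>x\<in>{c + 1..<c + 1 + n}. block_of f x) =
    (\<Sum>x\<in>{c..<c + n}. block_of f x) + 1"
proof -
  assume f: "f \<in> Aff"
  have 1: "{c..<c + n} = insert c {c + 1..<c + n}"
      "{c + 1..<c + 1 + n} = insert (c + n) {c + 1..<c + n}"
    using n_ge_2 by auto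
  have "block_of f (c + n) = block_of f c + 1" using block_of_shift[OF f, of c 1] by simp
  then show ?thesis unfolding 1 by simp
qed

lemma block_of_sum_shift: "f \<in> Aff \<Longrightarrow> (\<Sum>x\<in>{c..<c + n}. block_of f x) =
    (\<Sum>x\<in>{0..<n}. block_of f x) + c"
proof (induction c rule: int_induct[where k = 0])
  case (step1 i)
  then show ?case using block_of_sum_step[of f i] by simp
next
  case (step2 i)
  then show ?case using block_of_sum_step[of f "i - 1"] by (simp add: algebra_simps)
qed simp

text \<open>A generator s_i permutes the indices within the window that starts at i, and moving the
  window by one adds 1, so the sum is the same as for the identity. It makes the number of rows
  non-negative in \<open>has_rows_exists\<close> and recognizes the identity in
  \<open>peel\<close>.\<close>

lemma block_of_sum: "(\<Sum>x\<in>{c..<c + n}. block_of (perm u) x) = c - 1"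
proof (induction u arbitrary: c)
  case Nil
  have "(\<Sum>x\<in>{1..<1 + n}. block_of id x) = 0"
    by (intro sum.neutral) (auto simp: block_of_id block_iff)
  then have "(\<Sum>x\<in>{c..<c + n}. block_of id x) = c - 1"
    using block_of_sum_shift[of id c] block_of_sum_shift[of id 1] by simp
  then show ?case by (simp add: id_def)
next
  case (Cons i u)
  have Aff: "perm (i # u) \<in> Aff" by (rule perm_Aff)
  have "(\<Sum>x\<in>{i..<i + n}. block_of (perm (i # u)) x) = (\<Sum>x\<in>{i..<i + n}. block_of (perm u) x)"
  proof (rule sum.reindex_bij_witness[where i = "swap i" and j = "swap i"])
    fix x assume x: "x \<in> {i..<i + n}"
    show "swap i (swap i x) = x" by (rule swap_swap)
    then show "swap i (swap i x) = x" .
    have "swap i x \<in> {i..<i + n}"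
      using x swap_fix[of x i] n_ge_2 by (cases "x = i \<or> x = i + 1") (auto simp: swap_self)
    then show "swap i x \<in> {i..<i + n}" "swap i x \<in> {i..<i + n}" by auto
    show "block_of (perm u) (swap i x) = block_of (perm (i # u)) x" by (simp add: block_of_comp)
  qed
  then have "(\<Sum>x\<in>{c..<c + n}. block_of (perm (i # u)) x) = c - 1"
    using block_of_sum_shift[OF Aff, of c] block_of_sum_shift[OF Aff, of i] Cons[of i] by simp
  then show ?case .
qed

lemma has_rows_exists:
  assumes f: "f \<in> Aff"
  shows "\<exists>m. has_rows m f"
proof -
  obtain u where u: "f = perm u" using f by (rule Aff_cases)
  have bd: "\<bar>perm v x - x\<bar> \<le> int (length v)" for v x
  proof (induction v)
    case (Cons i v)
    have "\<bar>swap i y - y\<bar> \<le> 1" for y by (simp add: swap_def)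
    from this[of "perm v x"] Cons show ?case by simp
  qed simp
  define l where "l = int (length u)"
  have fb: "x - l \<le> finv f x" "finv f x \<le> x + l" for x
    using bd[of "rev u" x] unfolding u finv_perm l_def by auto
  have neg: "block_of f x < 0" if "x \<le> - l" for x
  proof -
    have "block (finv f x) < 0"
      using fb[of x] that has_rows_id by (auto simp: has_rows_def block_of_id)
    then show ?thesis by (simp add: block_of_def)
  qed
  have "\<exists>d. 0 \<le> block_of f (int d - l)"
  proof
    have "1 \<le> finv f (l + 1)" using fb[of "l + 1"] by simp
    then have "0 \<le> block (finv f (l + 1))"
      using n_ge_2 by (simp add: block_def pos_imp_zdiv_nonneg_iff)
    then show "0 \<le> block_of f (int (nat (2 * l + 1)) - l)" by (simp add: block_of_def l_def)
  qed
  \<comment> \<open>The first place of non-negative index, counted from -l so that the minimum is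
    taken over natural numbers; l bounds the distance by which the word can move an integer.\<close>
  define d where "d = (LEAST d. 0 \<le> block_of f (int d - l))"
  have d: "0 \<le> block_of f (int d - l)" unfolding d_def using \<open>\<exists>d. _\<close> by (rule LeastI_ex)
  define c where "c = int d - l - 1"
  have lt: "block_of f x < 0" if "x \<le> c" for x
  proof (cases "x \<le> - l")
    case False
    then have "x = int (nat (x + l)) - l" "nat (x + l) < d" using that by (auto simp: c_def)
    then show ?thesis using not_less_Least[of "nat (x + l)" "\<lambda>d. 0 \<le> block_of f (int d - l)"]
      unfolding d_def by (metis not_le)
  qed (rule neg)
  have le: "block_of f x \<le> 0" if "x \<in> {c + 1..<c + 1 + n}" for x
  proof -
    have "block_of f (x + n * (- 1)) < 0" using that by (intro lt) simp
    then show ?thesis unfolding block_of_shift[OF f] by simp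
  qed
  have "block_of f (c + 1) = 0" using d le[of "c + 1"] n_ge_2 by (simp add: c_def)
  \<comment> \<open>The charge of the window above c is c, and none of its terms is
    positive.\<close>
  moreover have "c \<le> 0"
  proof -
    have "c = (\<Sum>x\<in>{c + 1..<c + 1 + n}. block_of f x)"
      unfolding u using block_of_sum[of u "c + 1"] by simp
    also have "\<dots> \<le> 0" using le by (intro sum_nonpos) auto
    finally show ?thesis .
  qed
  ultimately have "has_rows (nat (- c)) f" using lt by (simp add: has_rows_def add.commute)
  then show ?thesis ..
qed

text \<open>Such an f preserves every block and increases within each, so it ascends at every
  position, and only the identity has no descent.\<close>

lemma block_of_eq_block_id:
  assumes f: "f \<in> Grass" and "\<forall>x\<in>{1..n}. block_of f x = 0"
  shows "f = id"
proof -
  note fG = Grass_Aff[OF f]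
  have b: "block_of f x = block x" for x
  proof -
    obtain r q where x: "x = r + n * q" "1 \<le> r" "r \<le> n" by (rule window_cases)
    have "block r = 0" using x by (simp add: block_iff)
    then show ?thesis using assms(2) x block_of_shift[OF fG, of r q] block_shift[of r q] by simp
  qed
  have "block (f x) = block x" for x using b[of "f x"] fG by (simp add: block_of_def)
  then have bf: "block (f n) = block n" "block (f 1) = block 1" by auto
  have asc: "f i < f (i + 1)" for i
  proof (cases "block i = block (i + 1)")
    case True
    then show ?thesis using Grass_mono[OF f, of i "i + 1"] by simp
  next
    case False
    have "\<not> block (i + 1) < block i" using block_less[of "i + 1" i] by auto
    then have "block (f i) < block (f (i + 1))" using False \<open>\<And>x. block (f x) = block x\<close> by simp
    then show ?thesis by (rule block_less)
  qed
  have "plen f = 0"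
  proof (rule ccontr)
    assume "plen f \<noteq> 0"
    moreover obtain u where u: "perm u = f" "length u = plen f" using plen_obtain[OF fG] by metis
    ultimately obtain v i where v: "u = v @ [i]" by (metis length_0_conv rev_exhaust)
    then have "f \<circ> swap i = perm v" using u by (auto simp: perm_append)
    then have "plen (f \<circ> swap i) < plen f" using plen_le[of v] u v by simp
    then show False using plen_right(1)[OF fG asc, of i] by simp
  qed
  then show ?thesis using plen_eq_0[OF fG] by simp
qed

lemma peel:
  assumes f: "f \<in> Grass" "f \<noteq> id"
  obtains m a v where "has_rows (Suc m) f" "has_last_part (Suc m) a f" "1 \<le> a" "a \<le> k" "v \<in> Grass"
      "has_rows m v"
    "f = perm (row_word m a) \<circ> v" "plen f = plen v + a" "\<forall>j\<in>{1..int a}. block_of v (j - int m) = 0"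
proof -
  note fG = Grass_Aff[OF f(1)]
  obtain M where M: "has_rows M f" using has_rows_exists[OF fG] by blast
  obtain u where u: "f = perm u" using fG by (rule Aff_cases)
  define c where "c = 1 - int M"
  have le: "block_of f x \<le> 0" if "x < c + n" for x
    using has_rows_window[OF fG M] that by (simp add: c_def)
  have s: "(\<Sum>x\<in>{c..<c + n}. block_of f x) = - int M"
    unfolding u using block_of_sum[of u c] by (simp add: c_def)
  \<comment> \<open>If the window contained only zeros, its charge would give M = 0 and f would be
    the identity. The least offset with a nonzero index is the length of the last row.\<close>
  have ex: "\<exists>d. d < k + 1 \<and> block_of f (c + int d) \<noteq> 0"
  proof (rule ccontr)
    assume none: "\<nexists>d. d < k + 1 \<and> block_of f (c + int d) \<noteq> 0"
    have z: "block_of f x = 0" if "x \<in> {c..<c + n}" for x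
    proof -
      have "x = c + int (nat (x - c))" "nat (x - c) < k + 1" using that by auto
      then show ?thesis using none by metis
    qed
    then have "M = 0" using s by simp
    then have "\<forall>x\<in>{1..n}. block_of f x = 0" using z by (auto simp: c_def)
    then show False using block_of_eq_block_id[OF f(1)] f(2) by blast
  qed
  define a where "a = (LEAST d. d < k + 1 \<and> block_of f (c + int d) \<noteq> 0)"
  have a: "a < k + 1" "block_of f (c + int a) \<noteq> 0" using LeastI_ex[OF ex] by (auto simp: a_def)
  have z: "block_of f (c + j) = 0" if "j \<in> {0..<int a}" for j
  proof -
    have "j = int (nat j)" "nat j < a" using that by auto
    then show ?thesis
      using not_less_Least[of "nat j" "\<lambda>d. d < k + 1 \<and> block_of f (c + int d) \<noteq> 0"] a(1)
      unfolding a_def[symmetric] by (metis less_trans)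
  qed
  have neg: "block_of f (c + int a) < 0" using a le[of "c + int a"] by simp
  have "0 < a"
  proof (rule ccontr)
    assume "\<not> 0 < a"
    then show False using a M by (simp add: has_rows_def c_def)
  qed
  have "M \<noteq> 0"
  proof
    assume "M = 0"
    then have "(\<Sum>x\<in>{c..<c + n}. block_of f x) < (\<Sum>x\<in>{c..<c + n}. 0)" if "c + int a \<in> {c..<c + n}"
      using that neg le by (intro sum_strict_mono_ex1) auto
    then show False using s \<open>M = 0\<close> a(1) by simp
  qed
  then obtain m where m: "M = Suc m" by (metis not0_implies_Suc)
  have c: "c = - int m" by (simp add: c_def m)
  obtain v where v: "v \<in> Grass" "f = perm (interval_word c a) \<circ> v" "plen f = plen v + a"
      "block_of v c < 0"
    "\<forall>j\<in>{1..int a}. block_of v (c + j) = 0"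
        "\<forall>x\<in>{c..<c + n} - {c..c + int a}. block_of v x = block_of f x"
    using interval_word_down[OF f(1) neg] z a(1) by auto
  have "\<forall>x\<in>{c..<c + n}. block_of v x \<le> 0"
  proof
    fix x assume x: "x \<in> {c..<c + n}"
    then consider "x = c" | "x - c \<in> {1..int a}" | "x \<in> {c..<c + n} - {c..c + int a}" by fastforce
    then show "block_of v x \<le> 0"
    proof cases
      case 2
      then show ?thesis using v(5)[rule_format, of "x - c"] by simp
    qed (use v(4,6) le x in auto)
  qed
  then have "block_of v x < 0" if "x < c" for x
    using block_of_lower[OF Grass_Aff[OF v(1)]] that by blast
  then have "block_of v x < 0" if "x \<le> c" for x using that v(4) by (cases "x = c") auto
  moreover have "block_of v (1 - int m) = 0" using v(5)[rule_format, of 1] \<open>0 < a\<close> by (simp add: c)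
  ultimately have "has_rows m v" by (simp add: has_rows_def c)
  moreover have "has_last_part (Suc m) a f" using z a(2) by (simp add: has_last_part_def c)
  ultimately show thesis
    using that[of m a v] M v a(1) \<open>0 < a\<close> by (simp add: m row_word_interval_word c add.commute)
qed

section \<open>Leading terms in the Pieri rule\<close>

lemma foldr_grass_act_Grass [simp]: "w \<in> Grass \<Longrightarrow> foldr grass_act u w \<in> Grass"
  by (induction u) auto

lemma plen_grass_act_le: "f \<in> Grass \<Longrightarrow> plen (grass_act i f) \<le> plen f + 1"
  using plen_comp_le[of f "[i]"] Grass_Aff by (auto simp: grass_act_def)

lemma plen_foldr_grass_act_le: "w \<in> Grass \<Longrightarrow> plen (foldr grass_act u w) \<le> plen w + length u"
proof (induction u)
  case (Cons i u)
  then show ?case using plen_grass_act_le[of "foldr grass_act u w" i] by simp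
qed simp

text \<open>Expand the product of the differences "\<open>grass_act i\<close> minus identity": a
  term that omits a letter evaluates E at an element of length below s, where E vanishes. Only the
  term with all letters remains.\<close>

lemma diff_word_vanish:
  assumes "\<And>f. f \<in> Grass \<Longrightarrow> plen f < s \<Longrightarrow> E f = 0" and w: "w \<in> Grass" and "plen w + length u \<le> s"
  shows "diff_word u E w = E (foldr grass_act u w)"
  using assms(1,3)
proof (induction u arbitrary: E s)
  case (Cons i u)
  define E' where "E' f = E (grass_act i f) - E f" for f
  have z: "E' f = 0" if "f \<in> Grass" "plen f < s - 1" for f
    using Cons.prems(1)[of f] Cons.prems(1)[of "grass_act i f"] plen_grass_act_le[of f i] that
    by (simp add: E'_def)
  have "diff_word (i # u) E w = diff_word u E' w" by (simp add: E'_def[abs_def])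
  also have "\<dots> = E' (foldr grass_act u w)" using Cons.IH[OF z] Cons.prems(2) by simp
  moreover have "E (foldr grass_act u w) = 0"
    using Cons.prems plen_foldr_grass_act_le[OF w, of u] w by simp
  ultimately show ?case by (simp add: E'_def)
qed simp

lemma foldr_grass_act_subword: "\<exists>u'. set u' \<subseteq> set u \<and> foldr grass_act u w = perm u' \<circ> w"
proof (induction u)
  case Nil
  show ?case by (intro exI[of _ "[]"]) auto
next
  case (Cons i u)
  then obtain u' where u': "set u' \<subseteq> set u" "foldr grass_act u w = perm u' \<circ> w" by blast
  have "grass_act i (perm u' \<circ> w) = perm u' \<circ> w \<or> grass_act i (perm u' \<circ> w) = perm (i # u') \<circ> w"
    by (simp only: grass_act_def perm.simps comp_assoc) simp
  then consider "foldr grass_act (i # u) w = perm u' \<circ> w" |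
      "foldr grass_act (i # u) w = perm (i # u') \<circ> w"
    using u'(2) by auto
  then show ?case
  proof cases
    case 1
    then show ?thesis using u'(1) by (intro exI[of _ u'] conjI) auto
  next
    case 2
    then show ?thesis using u'(1) by (intro exI[of _ "i # u'"] conjI) auto
  qed
qed

text \<open>The complement of W\<degree> is stable under \<open>left_max\<close>, so a path that
  ends in W\<degree> stayed in it, and along such a path both operators agree.\<close>

lemma foldr_grass_act_left_max:
  assumes "w \<in> Aff" "foldr left_max u w \<in> Grass"
  shows "foldr grass_act u w = foldr left_max u w"
  using assms(2)
proof (induction u)
  case (Cons i u)
  define x where "x = foldr left_max u w"
  have "x \<in> Aff" using assms(1) by (simp add: x_def)
  then have x: "x \<in> Grass" using left_max_not_Grass[of x i] Cons.prems by (auto simp: x_def)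
  then have "foldr grass_act u w = x" using Cons.IH by (simp add: x_def)
  moreover have "left_max i x \<in> Grass" using Cons.prems by (simp add: x_def)
  then have "grass_act i x = left_max i x" by (auto simp: grass_act_alt[OF x] left_max_def)
  ultimately show ?case by (simp add: x_def)
qed simp

lemma block_of_perm_comp: "v \<in> Aff \<Longrightarrow> block_of (perm u \<circ> v) x = block_of v (perm (rev u) x)"
  by (simp add: block_of_def finv_mult finv_perm)

lemma block_of_grass_act_cases:
    "f \<in> Aff \<Longrightarrow> block_of (grass_act i f) x = block_of f x \<or> block_of (grass_act i f) x =
        block_of f (swap i x)"
  by (simp add: grass_act_def block_of_comp)

lemma block_of_neg_grass_act:
  assumes f: "f \<in> Aff" "\<forall>x\<le>c. block_of f x < 0"
  shows "\<not> n dvd c - i \<Longrightarrow> \<forall>x\<le>c. block_of (grass_act i f) x < 0"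
      "\<forall>x\<le>c - 1. block_of (grass_act i f) x < 0"
proof -
  have s: "swap i x \<le> x + 1" for x by (simp add: swap_def)
  show "\<forall>x\<le>c - 1. block_of (grass_act i f) x < 0"
  proof (intro allI impI)
    fix x assume "x \<le> c - 1"
    then have "x \<le> c" "swap i x \<le> c" using s[of x] by simp_all
    then show "block_of (grass_act i f) x < 0"
      using block_of_grass_act_cases[OF f(1), of i x] f(2) by auto
  qed
  assume "\<not> n dvd c - i"
  then have s: "swap i x \<le> c" if "x \<le> c" for x using perm_cut[of "[i]" c x] that by simp
  show "\<forall>x\<le>c. block_of (grass_act i f) x < 0"
  proof (intro allI impI)
    fix x assume x: "x \<le> c"
    then show "block_of (grass_act i f) x < 0"
      using block_of_grass_act_cases[OF f(1), of i x] f(2) s[OF x] by auto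
  qed
qed

lemma block_of_neg_foldr_grass_act:
  assumes "f \<in> Grass" "\<forall>x\<le>c. block_of f x < 0" "\<forall>i\<in>set u. \<not> n dvd c - i"
  shows "\<forall>x\<le>c. block_of (foldr grass_act u f) x < 0"
  using assms(3)
proof (induction u)
  case (Cons i u)
  then show ?case
    using block_of_neg_grass_act(1)[of "foldr grass_act u f" c i] assms(1) Grass_Aff by simp
qed (use assms in simp)

text \<open>
  The residue \<open>c - 1\<close> of a second new row would have to be added after the residue \<open>c\<close>, which a
  cyclically decreasing word does not allow.
\<close>

lemma strip_has_rows:
  assumes v: "v \<in> Grass" "\<forall>x\<le>c. block_of v x < 0" and A: "A \<subset> I"
  shows "\<forall>x\<le>c - 1. block_of (foldr grass_act (cyc_word A) v) x < 0"
proof (cases "\<forall>i\<in>set (cyc_word A). \<not> n dvd c - i")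
  case True
  then show ?thesis using block_of_neg_foldr_grass_act[OF v True] by simp
next
  case False
  then obtain i u1 u2 where i: "n dvd c - i" "cyc_word A = u1 @ i # u2"
    by (metis split_list)
  have vA: "set (cyc_word A) \<subseteq> I" "distinct (cyc_word A)"
      "sorted_wrt (\<lambda>a b. b \<noteq> (a + 1) mod n) (cyc_word A)"
    using cyc_word[OF A] A by (auto simp: cyc_decreasing_iff)
  have "\<not> n dvd c - j" if j: "j \<in> set u2" for j
  proof
    assume "n dvd c - j"
    then have "n dvd (c - j) - (c - i)" using i(1) by (rule dvd_diff)
    then have "i = j" using I_dvd[of i j] vA(1) i(2) j by auto
    then show False using vA(2) i(2) j by simp
  qed
  then have 1: "\<forall>x\<le>c. block_of (foldr grass_act u2 v) x < 0"
    using block_of_neg_foldr_grass_act[OF v, of u2] by blast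
  define w where "w = grass_act i (foldr grass_act u2 v)"
  have w: "w \<in> Grass" "\<forall>x\<le>c - 1. block_of w x < 0"
    using v(1) block_of_neg_grass_act(2)[OF Grass_Aff 1, of i] by (simp_all add: w_def)
  have "\<not> n dvd (c - 1) - j" if j: "j \<in> set u1" for j
  proof
    assume "n dvd (c - 1) - j"
    then have "n dvd (c - i) - ((c - 1) - j)" by (rule dvd_diff[OF i(1)])
    then have "n dvd (j + 1) - i" by (simp add: algebra_simps)
    then have "(j + 1) mod n = i mod n" by (simp only: mod_eq_dvd_iff)
    moreover have "i mod n = i" using vA(1) i(2) by (auto simp: index_set_def)
    moreover have "i \<noteq> (j + 1) mod n" using vA(3) i(2) j by (auto simp: sorted_wrt_append)
    ultimately show False by simp
  qed
  then have "\<forall>x\<le>c - 1. block_of (foldr grass_act u1 w) x < 0"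
    using block_of_neg_foldr_grass_act[OF w, of u1] by blast
  then show ?thesis by (simp add: i(2) w_def)
qed

text \<open>
  If the residue of \<open>p = c + j\<close> is not in \<open>A\<close>, the word preserves \<open>{..p}\<close>, so that too few values up
  to \<open>p\<close> are available to fill the new row.
\<close>

lemma strip_has_last_part:
  assumes v: "v \<in> Grass" "\<forall>x\<le>c. block_of v x < 0" and A: "A \<subset> I"
    and z: "\<forall>j\<in>{0..<int a}. block_of (foldr grass_act (cyc_word A) v) (c + j) = 0" and j: "j < a"
  shows "(c + int j) mod n \<in> A"
proof (rule ccontr)
  assume nA: "(c + int j) mod n \<notin> A"
  define p where "p = c + int j"
  obtain u where u: "set u \<subseteq> set (cyc_word A)" "foldr grass_act (cyc_word A) v = perm u \<circ> v"
    using foldr_grass_act_subword by blast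
  have "\<forall>i\<in>set (rev u). \<not> n dvd p - i"
  proof
    fix i assume "i \<in> set (rev u)"
    then have i: "i \<in> A" "i mod n = i" using u(1) cyc_word(1)[OF A] A by (auto simp: index_set_def)
    show "\<not> n dvd p - i"
    proof
      assume "n dvd p - i"
      then have "p mod n = i mod n" by (simp only: mod_eq_dvd_iff)
      then show False using i nA by (simp add: p_def)
    qed
  qed
  note cut = perm_cut[OF this]
  have "perm (rev u) ` {c..p} \<subseteq> {c + 1..p}"
  proof clarify
    fix x assume x: "x \<in> {c..p}"
    then have "block_of (perm u \<circ> v) x = 0"
      using z[rule_format, of "x - c"] j u(2) by (simp add: p_def)
    then have "block_of v (perm (rev u) x) = 0"
      using block_of_perm_comp[OF Grass_Aff[OF v(1)]] by simp
    then have "\<not> perm (rev u) x \<le> c" using v(2) by force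
    then show "perm (rev u) x \<in> {c + 1..p}" using cut[of x] x by simp
  qed
  moreover have "inj_on (perm (rev u)) {c..p}"
    using bij_perm by (meson bij_is_inj inj_on_subset subset_UNIV)
  ultimately have "card {c..p} \<le> card {c + 1..p}" by (intro card_inj_on_le) auto
  then show False by (simp add: p_def)
qed

lemma strip_minimal:
  assumes A: "A \<subset> I" "card A = a" and sub: "\<And>j. j < a' \<Longrightarrow> (c + int j) mod n \<in> A"
  shows "a' \<le> a" "a' = a \<Longrightarrow> A = (\<lambda>j. (c + int j) mod n) ` {..<a}"
proof -
  define im where "im b = (\<lambda>j. (c + int j) mod n) ` {..<b}" for b :: nat
  have fin: "finite A" using A(1) by (auto simp: index_set_def intro: finite_subset)
  have ca: "card (im b) = b" if "b \<le> k + 1" for b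
  proof -
    have "j = j'" if "j < b" "j' < b" "(c + int j) mod n = (c + int j') mod n" for j j'
    proof -
      have "n dvd (c + int j) - (c + int j')" using that by (simp only: mod_eq_dvd_iff)
      then show ?thesis
        using that \<open>b \<le> k + 1\<close> I_dvd[of "int j" "int j'"] by (simp add: index_set_def)
    qed
    then show ?thesis unfolding im_def by (subst card_image) (auto simp: inj_on_def)
  qed
  have "card A < card I" using A(1) by (intro psubset_card_mono) (auto simp: index_set_def)
  then have lt: "card A < k + 1" by (simp add: index_set_def)
  have le: "b \<le> card A" if "b \<le> a'" "b \<le> k + 1" for b
  proof -
    have "im b \<subseteq> A" using sub that(1) by (auto simp: im_def)
    then show ?thesis using card_mono[OF fin, of "im b"] ca[OF that(2)] by simp
  qed
  \<comment> \<open>Otherwise k + 1 consecutive residues, all of I, would lie in the proper subset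
    A.\<close>
  have "a' \<le> k + 1" using le[of "k + 1"] lt by (cases "k + 1 \<le> a'") auto
  then show "a' \<le> a" using le[of a'] A(2) by simp
  assume "a' = a"
  then have "im a \<subseteq> A" using sub by (auto simp: im_def)
  then show "A = (\<lambda>j. (c + int j) mod n) ` {..<a}"
    using card_subset_eq[OF fin, of "im a"] ca[of a] A(2) lt by (simp add: im_def)
qed

text \<open>A is the letter set of the row word, and the length grows by the number a of letters, so
  no letter is idle and the Demazure action is the plain product.\<close>

lemma full_strip:
  assumes v: "v \<in> Grass" and f: "f \<in> Grass" "f = perm (row_word m a) \<circ> v"
      "plen f = plen v + a" and a: "a \<le> k"
    and A: "A = (\<lambda>j. (- int m + int j) mod n) ` {..<a}" "A \<subset> I"
  shows "foldr grass_act (cyc_word A) v = f"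
proof -
  define u where "u = map (\<lambda>j. (- int m + int j) mod n) (rev [0..<a])"
  have u: "u = map (\<lambda>i. i mod n) (row_word m a)" by (simp add: u_def row_word_def algebra_simps)
  have vA: "set (cyc_word A) = A" "distinct (cyc_word A)"
      "sorted_wrt (\<lambda>a b. b \<noteq> (a + 1) mod n) (cyc_word A)"
    using cyc_word[OF A(2)] by (auto simp: cyc_decreasing_iff)
  have su: "set u = A" by (auto simp: u_def A(1))
  have du: "distinct u" "sorted_wrt (\<lambda>a b. b \<noteq> (a + 1) mod n) u"
    using cyc_interval[OF a, of "- int m"] by (simp_all add: u_def)
  have "perm (cyc_word A) = perm u"
    using vA su du A(2) by (intro perm_cyc_unique) auto
  then have "perm (cyc_word A) = perm (row_word m a)" by (simp only: u reduce_letters(2))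
  moreover have "length (cyc_word A) = a"
    using distinct_card[OF vA(2)] distinct_card[OF du(1)] vA(1) su by (simp add: u_def)
  ultimately have "foldr left_max (cyc_word A) v = f"
    using foldr_left_max_additive[OF Grass_Aff[OF v], of "cyc_word A"] f by simp
  then show ?thesis using foldr_grass_act_left_max[OF Grass_Aff[OF v], of "cyc_word A"] f(1) by simp
qed

text \<open>
  Induction on length, number of rows and last row, in lexicographic order: all other terms of
  \<open>h\<^sub>b\<close> applied to the element without its last row \<open>b\<close> are smaller.
\<close>

lemma Pieri_unique:
  fixes E :: "(int \<Rightarrow> int) \<Rightarrow> 'r::comm_ring_1"
  assumes P: "\<And>w r. w \<in> Grass \<Longrightarrow> r \<in> {1..k} \<Longrightarrow>
      h r * E w = (\<Sum>A | A \<subset> I \<and> card A = r. diff_word (cyc_word A) E w)"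
    and E0: "E id = 0" and f: "f \<in> Grass"
  shows "E f = 0"
proof (cases "f = id")
  case False
  define R where "R = less_than <*lex*> less_than <*lex*> less_than"
  have wf: "wf R" unfolding R_def by (intro wf_lex_prod wf_less_than)
  have main: "x = (plen f, m, a) \<Longrightarrow> f \<in> Grass \<Longrightarrow> f \<noteq> id \<Longrightarrow> has_rows m f \<Longrightarrow> has_last_part m a f \<Longrightarrow> E f =
      0" for x f m a
    using wf
  proof (induction x arbitrary: f m a rule: wf_induct_rule)
    case (less x)
    note f = less.prems(2,3)
    obtain m' b v where mb: "has_rows (Suc m') f" "has_last_part (Suc m') b f" and b: "1 \<le> b"
        "b \<le> k"
      and v: "v \<in> Grass" "has_rows m' v" "f = perm (row_word m' b) \<circ> v" "plen f = plen v + b"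
      using peel[OF f] by metis
    have m: "m = Suc m'" using has_rows_unique[OF less.prems(4) mb(1)] .
    have a: "a = b" using has_last_part_unique less.prems(5) mb(2) m by blast
    \<comment> \<open>\<open>peel\<close> supplies rows and a last part only for elements other than
      the identity; at the identity \<open>E0\<close> takes over.\<close>
    have IH: "E y = 0" if y: "y \<in> Grass"
        "y \<noteq> id \<Longrightarrow> has_rows my y \<Longrightarrow> has_last_part my ay y \<Longrightarrow> ((plen y, my, ay), x) \<in> R"
      and r: "y \<noteq> id \<Longrightarrow> has_rows my y" "y \<noteq> id \<Longrightarrow> has_last_part my ay y" for y my ay
    proof (cases "y = id")
      case False
      show ?thesis using less.IH[OF y(2)[OF False r[OF False]] refl y(1) False r[OF False]] .
    qed (simp add: E0)
    have data: "\<exists>my ay. y \<noteq> id \<longrightarrow> has_rows my y \<and> has_last_part my ay y" if "y \<in> Grass" for y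
      using peel[OF that] by metis
    have small: "E y = 0" if y: "y \<in> Grass" "plen y < plen f" for y
    proof -
      obtain my ay where "y \<noteq> id \<longrightarrow> has_rows my y \<and> has_last_part my ay y"
        using data[OF y(1)] by blast
      then show ?thesis using IH[of y my ay] y less.prems(1) by (simp add: R_def)
    qed
    define A0 where "A0 = (\<lambda>j. (- int m' + int j) mod n) ` {..<b}"
    have neg: "\<forall>x\<le>- int m'. block_of v x < 0" using v(2) by (simp add: has_rows_def)
    have other: "E (foldr grass_act (cyc_word A) v) = 0" if A: "A \<subset> I" "card A = b" "A \<noteq> A0" for A
    proof -
      define y where "y = foldr grass_act (cyc_word A) v"
      have y: "y \<in> Grass" using v(1) by (simp add: y_def)
      have "length (cyc_word A) = b" using cyc_word[OF A(1)] A(2) distinct_card[of "cyc_word A"]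
        by (simp add: cyc_decreasing_def)
      then have Ly: "plen y \<le> plen f"
        using plen_foldr_grass_act_le[OF v(1), of "cyc_word A"] v(4) by (simp add: y_def)
      obtain my ay where my: "y \<noteq> id \<longrightarrow> has_rows my y \<and> has_last_part my ay y"
        using data[OF y] by blast
      have "my \<le> Suc m'" if "has_rows my y"
        using strip_has_rows[OF v(1) neg A(1)] that unfolding y_def[symmetric]
        by (intro has_rows_le[of my y "Suc m'"]) (auto simp: algebra_simps)
      moreover have "ay < b" if r: "has_last_part my ay y" "my = Suc m'"
      proof -
        have z: "\<forall>j\<in>{0..<int ay}. block_of (foldr grass_act (cyc_word A) v) (- int m' + j) = 0"
          using r by (simp add: has_last_part_def y_def)
        note sub = strip_has_last_part[OF v(1) neg A(1) z]
        show ?thesis using strip_minimal[OF A(1,2) sub] A(3) unfolding A0_def by fastforce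
      qed
      ultimately show ?thesis
        using IH[of y my ay] my y Ly m a less.prems(1) unfolding y_def[symmetric] R_def
        by (auto simp: le_less)
    qed
    have A0: "A0 \<subset> I" "card A0 = b"
    proof -
      have s: "A0 \<subseteq> I" using mod_n by (auto simp: A0_def index_set_def)
      have "A0 = set (map (\<lambda>j. (- int m' + int j) mod n) (rev [0..<b]))" by (auto simp: A0_def)
      then show "card A0 = b"
        using distinct_card[OF cyc_interval(1)[OF b(2), of "- int m'"]] by simp
      then have "A0 \<noteq> I" using b(2) by (auto simp: index_set_def)
      then show "A0 \<subset> I" using s by blast
    qed
    have fin: "finite {A. A \<subset> I \<and> card A = b}"
      by (rule finite_subset[of _ "Pow I"]) (auto simp: index_set_def)
    \<comment> \<open>The element v is shorter than f, so the left side of its Pieri rule vanishes;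
      on the right only the term of A0, which is E f, remains.\<close>
    have "0 = h b * E v" using small[OF v(1)] v(4) b by simp
    also have "\<dots> = (\<Sum>A | A \<subset> I \<and> card A = b. diff_word (cyc_word A) E v)"
      using P[OF v(1), of b] b by simp
    also have "\<dots> = (\<Sum>A | A \<subset> I \<and> card A = b. E (foldr grass_act (cyc_word A) v))"
    proof (rule sum.cong[OF refl])
      fix A assume "A \<in> {A. A \<subset> I \<and> card A = b}"
      then have "length (cyc_word A) = b" using cyc_word[of A] distinct_card[of "cyc_word A"]
        by (simp add: cyc_decreasing_def)
      then show "diff_word (cyc_word A) E v = E (foldr grass_act (cyc_word A) v)"
        using small v by (intro diff_word_vanish[where s = "plen f"]) auto
    qed
    also have "\<dots> = (\<Sum>A\<in>{A0}. E (foldr grass_act (cyc_word A) v))"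
      using A0 other by (intro sum.mono_neutral_right[OF fin]) auto
    also have "\<dots> = E f" using full_strip[OF v(1) f(1) v(3,4) b(2) A0_def A0(1)] by simp
    finally show "E f = 0" by simp
  qed
  obtain m a where "has_rows m f" "has_last_part m a f" using peel[OF f False] by metis
  then show ?thesis using main[OF refl f False] by blast
qed (simp add: E0)

section \<open>Bounded partitions\<close>

lemma partition_Grass:
  assumes "p \<in> bounded_partitions k"
  shows "perm (rows_word 0 p) \<in> Grass" "has_rows (length p) (perm (rows_word 0 p))"
    "p \<noteq> [] \<Longrightarrow> has_last_part (length p) (last p) (perm (rows_word 0 p))"
proof -
  have "perm (rows_word 0 p) \<in> Grass \<and> has_rows (length p) (perm (rows_word 0 p)) \<and>
    (p \<noteq> [] \<longrightarrow> has_last_part (length p) (last p) (perm (rows_word 0 p)))"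
    using assms
  proof (induction p rule: rev_induct)
    case Nil
    have "id \<in> Grass \<and> has_rows 0 id" using has_rows_id by simp
    then show ?case by (simp only: rows_word.simps perm.simps list.size simp_thms)
  next
    case (snoc a p)
    have p: "p \<in> bounded_partitions k" "1 \<le> a" "a \<le> k" and al: "\<forall>x\<in>set p. a \<le> x"
      using snoc.prems by (auto simp: bounded_partitions_def sorted_wrt_append)
    define m where "m = length p"
    define f where "f = perm (rows_word 0 p)"
    have f: "f \<in> Grass" "has_rows m f" "p \<noteq> [] \<Longrightarrow> has_last_part m (last p) f"
      using snoc.IH[OF p(1)] by (auto simp: f_def m_def)
    define c where "c = - int m"
    have e: "perm (rows_word 0 (p @ [a])) = perm (interval_word c a) \<circ> f"
      by (simp add: rows_word_append perm_append f_def m_def c_def row_word_interval_word)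
    have neg: "block_of f c < 0" using f(2) by (simp add: has_rows_def c_def)
    \<comment> \<open>The weak decrease of the parts enters here: the last row of p leaves at least
      a zeros to the right of the bead at c, and for empty p the indices at 1, ..., n are all
      0.\<close>
    have z: "\<forall>j\<in>{1..int a}. block_of f (c + j) = 0"
    proof (cases "p = []")
      case True
      then show ?thesis using p(3) by (auto simp: f_def c_def m_def block_of_id block_iff)
    next
      case False
      have "a \<le> last p" using al False by simp
      then show ?thesis using f(3)[OF False] unfolding has_last_part_def c_def
        by (auto dest!: bspec[of _ _ "j - 1" for j])
    qed
    define g where "g = perm (interval_word c a) \<circ> f"
    note up = interval_word_up[OF f(1) neg z p(3), folded g_def]
    have gG: "g \<in> Aff" using up(1) Grass_Aff by blast
    have "block_of g x \<le> 0" if x: "x \<in> {c..<c + n}" for x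
    proof -
      consider "x - c \<in> {0..<int a}" | "x = c + int a" | "x \<in> {c..<c + n} - {c..c + int a}"
        using x by fastforce
      then show ?thesis
      proof cases
        case 1
        then show ?thesis using up(3)[rule_format, of "x - c"] by simp
      next
        case 2
        then show ?thesis using up(4) by simp
      next
        case 3
        then show ?thesis
          using up(5) has_rows_window[OF Grass_Aff[OF f(1)] f(2), of x] by (simp add: c_def)
      qed
    qed
    then have "block_of g x < 0" if "x < c" for x using block_of_lower[OF gG] that by blast
    then have "has_rows (Suc m) g"
      using up(3)[rule_format, of 0] p(2) by (simp add: has_rows_def c_def)
    moreover have "has_last_part (Suc m) a g" using up(3,4) by (simp add: has_last_part_def c_def)
    ultimately show ?case using up(1) unfolding e g_def[symmetric] by (simp add: m_def)
  qed
  then show "perm (rows_word 0 p) \<in> Grass" "has_rows (length p) (perm (rows_word 0 p))"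
    "p \<noteq> [] \<Longrightarrow> has_last_part (length p) (last p) (perm (rows_word 0 p))" by auto
qed

lemma partition_inj:
  "p \<in> bounded_partitions k \<Longrightarrow> q \<in> bounded_partitions k \<Longrightarrow> perm (rows_word 0 p) =
      perm (rows_word 0 q) \<Longrightarrow> p = q"
proof (induction p arbitrary: q rule: rev_induct)
  case Nil
  have "has_rows (length q) (perm (rows_word 0 []))"
    using partition_Grass(2)[OF Nil.prems(2)] Nil.prems(3) by metis
  then have "length q = length ([] :: nat list)"
    by (rule has_rows_unique[OF _ partition_Grass(2)[OF Nil.prems(1)]])
  then show ?case by simp
next
  case (snoc a p)
  have l: "length (p @ [a]) = length q"
    using has_rows_unique[OF partition_Grass(2)[OF snoc.prems(1)]]
        partition_Grass(2)[OF snoc.prems(2)]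
      snoc.prems(3) by metis
  then obtain q' b where q: "q = q' @ [b]"
    by (metis append_is_Nil_conv length_0_conv not_Cons_self2 rev_exhaust)
  have lq: "length p = length q'" using l q by simp
  have "a = b"
    using has_last_part_unique[of "length q" a
        "perm (rows_word 0 q)" b] partition_Grass(3)[OF snoc.prems(1)]
      partition_Grass(3)[OF snoc.prems(2)] l snoc.prems(3) q by simp
  moreover have "perm (row_word (length p) a) (perm (rows_word 0 p) x) =
      perm (row_word (length p) a) (perm (rows_word 0 q') x)" for x
    using fun_cong[OF snoc.prems(3), of x] \<open>a = b\<close> lq by (simp add: q rows_word_append perm_append)
  then have "perm (rows_word 0 p) = perm (rows_word 0 q')"
    using Aff_eq_iff[of "perm (row_word (length p) a)"] by auto
  moreover have "p \<in> bounded_partitions k" "q' \<in> bounded_partitions k"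
    using snoc.prems(1,2) q by (auto simp: bounded_partitions_def sorted_wrt_append)
  ultimately show ?case using snoc.IH q by blast
qed

text \<open>Rows are removed by \<open>peel\<close>, which also records that v has a zeros after its
  bead at -m. So the last part of the partition of v is at least a, and appending a keeps the parts
  sorted.\<close>

lemma partition_surj:
  "f \<in> Grass \<Longrightarrow> has_rows m f \<Longrightarrow> \<exists>p\<in>bounded_partitions k. length p = m \<and> f = perm (rows_word 0 p)"
proof (induction m arbitrary: f)
  case 0
  have "f = id"
  proof (rule ccontr)
    assume "f \<noteq> id"
    then obtain m where "has_rows (Suc m) f" using peel[OF 0(1)] by metis
    then show False using has_rows_unique[OF 0(2)] by blast
  qed
  then show ?case by (intro bexI[of _ "[]"]) (auto simp: bounded_partitions_def)
next
  case (Suc m)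
  have "f \<noteq> id" using has_rows_unique[OF Suc.prems(2)] has_rows_id by auto
  then obtain m' a v where "has_rows (Suc m') f" and a: "1 \<le> a" "a \<le> k" and v: "v \<in> Grass"
      "has_rows m' v"
    "f = perm (row_word m' a) \<circ> v" "\<forall>j\<in>{1..int a}. block_of v (j - int m') = 0"
    using peel[OF Suc.prems(1)] by metis
  then have m': "m' = m" using has_rows_unique Suc.prems(2) by blast
  obtain p where p: "p \<in> bounded_partitions k" "length p = m" "v = perm (rows_word 0 p)"
    using Suc.IH v(1,2) m' by blast
  have "a \<le> x" if x: "x \<in> set p" for x
  proof -
    have ne: "p \<noteq> []" using x by auto
    have "\<forall>j\<in>{0..<int a}. block_of v (1 - int m + j) = 0"
      using v(4) m' by (auto dest!: bspec[of _ _ "j + 1" for j] simp: algebra_simps)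
    then have "a \<le> last p" using has_last_part_le partition_Grass(3)[OF p(1) ne] p by blast
    moreover have "last p \<le> x"
    proof -
      have "sorted_wrt (\<ge>) (butlast p @ [last p])"
        using p(1) ne by (simp add: bounded_partitions_def)
      then show ?thesis
        using x ne by (metis (no_types, lifting) append_butlast_last_id list.set_intros(1)
            order_refl set_ConsD sorted_wrt_append Un_iff set_append list.set(1) empty_iff)
    qed
    ultimately show ?thesis by simp
  qed
  then have "p @ [a] \<in> bounded_partitions k"
    using p(1) a by (auto simp: bounded_partitions_def sorted_wrt_append)
  moreover have "f = perm (rows_word 0 (p @ [a]))"
    using v(3) p m' by (simp add: rows_word_append perm_append)
  ultimately show ?case using p(2) by (intro bexI[of _ "p @ [a]"]) auto
qed

lemma partition_bij: "bij_betw (\<lambda>p. perm (rows_word 0 p)) (bounded_partitions k) Grass"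
proof (rule bij_betw_imageI)
  show "inj_on (\<lambda>p. perm (rows_word 0 p)) (bounded_partitions k)"
    by (rule inj_onI) (rule partition_inj)
  show "(\<lambda>p. perm (rows_word 0 p)) ` bounded_partitions k = Grass"
  proof (intro equalityI subsetI)
    fix f assume f: "f \<in> Grass"
    then obtain m where "has_rows m f" using has_rows_exists[OF Grass_Aff] by blast
    with f obtain p where "p \<in> bounded_partitions k" "f = perm (rows_word 0 p)"
      using partition_surj by blast
    then show "f \<in> (\<lambda>p. perm (rows_word 0 p)) ` bounded_partitions k" by (rule rev_image_eqI)
  qed (use partition_Grass(1) in auto)
qed

lemma K_k_Schur_sum_lower_sum:
  assumes p: "p \<in> bounded_partitions k"
  shows "K_k_Schur_sum k g p = lower_sum (g \<circ> elt) (perm (rows_word 0 p))"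
proof -
  have bij: "bij_betw (\<lambda>q. perm (rows_word 0 q)) {q \<in> bounded_partitions k. part_le k q p}
      {v \<in> Grass. bleq v (perm (rows_word 0 p))}"
  proof (rule bij_betw_subset[OF partition_bij, THEN bij_betw_cong[THEN iffD1, rotated]])
    show "(\<lambda>q. perm (rows_word 0 q)) ` {q \<in> bounded_partitions k. part_le k q p} =
        {v \<in> Grass. bleq v (perm (rows_word 0 p))}"
    proof -
      have "part_le k q p \<longleftrightarrow> bleq (perm (rows_word 0 q)) (perm (rows_word 0 p))" for q
        by (simp add: part_le_def part_elem_elt bruhat_le_elt)
      then show ?thesis using partition_bij unfolding bij_betw_def by auto
    qed
  qed auto
  have "K_k_Schur_sum k g p =
      (\<Sum>q\<in>{q \<in> bounded_partitions k. part_le k q p}. (g \<circ> elt) (perm (rows_word 0 q)))"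
    by (simp add: K_k_Schur_sum_def part_elem_elt)
  also have "\<dots> = (\<Sum>v\<in>{v \<in> Grass. bleq v (perm (rows_word 0 p))}. (g \<circ> elt) v)"
    by (rule sum.reindex_bij_betw[OF bij])
  finally show ?thesis by (simp add: lower_sum_def)
qed

section \<open>Factorization of lower sums\<close>

lemma lower_sum_id: "lower_sum F id = F id"
proof -
  have "{v. v \<in> Grass \<and> bleq v id} = {id}" using bleq_plen[of _ id] by auto
  then show ?thesis by (simp add: lower_sum_def)
qed

lemma diff_word_linear: "diff_word u (\<lambda>f. F f - c * F' f) w =
    diff_word u F w - c * diff_word u F' w"
proof (induction u arbitrary: F F')
  case (Cons i u)
  have "(\<lambda>f. (F (grass_act i f) - c * F' (grass_act i f)) - (F f - c * F' f)) =
    (\<lambda>f. (F (grass_act i f) - F f) - c * (F' (grass_act i f) - F' f))" by (auto simp: algebra_simps)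
  then show ?case by (simp add: Cons)
qed simp

lemma lower_sum_rect_shift_factor:
  assumes g: "K_k_Schur_family k g" and t: "t \<le> k" and w: "w \<in> Grass"
  shows "lower_sum (g \<circ> elt) (rect_shift t w) =
      lower_sum (g \<circ> elt) (rect_perm t) * lower_sum (g \<circ> elt) w"
proof -
  define F where "F = lower_sum (g \<circ> elt)"
  define E where "E w = (F \<circ> rect_shift t) w - F (rect_perm t) * F w" for w
  have "E w = 0"
  proof (rule Pieri_unique[OF _ _ w])
    have "g (elt id) = 1" using g by (simp add: K_k_Schur_family_def one_elt)
    then show "E id = 0" by (simp add: E_def F_def rect_shift_id lower_sum_id)
    fix w r assume w: "w \<in> Grass" and r: "r \<in> {1..k}"
    have P: "complete_sf r * F v = (\<Sum>A | A \<subset> I \<and> card A = r. diff_word (cyc_word A) F v)" if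
        "v \<in> Grass" for v
      using Pieri_lower_sum[OF g that r] by (simp add: F_def)
    have "complete_sf r * E w =
        complete_sf r * (F \<circ> rect_shift t) w - F (rect_perm t) * (complete_sf r * F w)"
      by (simp add: E_def algebra_simps)
    also have "complete_sf r * (F \<circ> rect_shift t) w =
        (\<Sum>A | A \<subset> I \<and> card A = r. diff_word (cyc_word A) (F \<circ> rect_shift t) w)"
      using Pieri_rect_shift[OF P[unfolded F_def] w t] by (simp add: F_def)
    also have "complete_sf r * F w = (\<Sum>A | A \<subset> I \<and> card A = r. diff_word (cyc_word A) F w)"
      by (rule P[OF w])
    finally show "complete_sf r * E w = (\<Sum>A | A \<subset> I \<and> card A = r. diff_word (cyc_word A) E w)"
      by (simp only: E_def[abs_def] diff_word_linear sum_subtractf sum_distrib_left)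
  qed
  then show ?thesis by (simp add: E_def F_def)
qed

lemma k_rectangle_bounded: "1 \<le> t \<Longrightarrow> t \<le> k \<Longrightarrow> k_rectangle k t \<in> bounded_partitions k"
  by (auto simp: k_rectangle_def bounded_partitions_def sorted_wrt_iff_nth_less)

lemma part_union_bounded:
  "p \<in> bounded_partitions k \<Longrightarrow> q \<in> bounded_partitions k \<Longrightarrow> part_union p q \<in> bounded_partitions k"
  by (auto simp: part_union_def bounded_partitions_def sorted_wrt_rev)

end

theorem theorem1p4:
  fixes k t :: nat and p :: "nat list" and g :: "int list set \<Rightarrow> symfun"
  assumes "1 \<le> k"
    and "K_k_Schur_family k g"
    and "p \<in> bounded_partitions k"
    and "1 \<le> t" and "t \<le> k"
  shows "K_k_Schur_sum k g (part_union (k_rectangle k t) p) =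
    K_k_Schur_sum k g (k_rectangle k t) * K_k_Schur_sum k g p"
proof -
  interpret affine_index k by unfold_locales (rule assms(1))
  note R = k_rectangle_bounded[OF assms(4,5)]
  have "K_k_Schur_sum k g (part_union (k_rectangle k t) p) =
      lower_sum (g \<circ> elt) (rect_shift t (perm (rows_word 0 p)))"
    using K_k_Schur_sum_lower_sum[OF part_union_bounded[OF R assms(3)]]
        perm_part_union[OF assms(3,5)] by simp
  also have "\<dots> = lower_sum (g \<circ> elt) (rect_perm t) * lower_sum (g \<circ> elt) (perm (rows_word 0 p))"
    by (rule lower_sum_rect_shift_factor[OF assms(2,5) partition_Grass(1)[OF assms(3)]])
  also have "lower_sum (g \<circ> elt) (rect_perm t) = K_k_Schur_sum k g (k_rectangle k t)"
    using K_k_Schur_sum_lower_sum[OF R, of g] rect_perm_eq[OF assms(5)]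
    by (simp only: k_rectangle_def)
  finally show ?thesis unfolding K_k_Schur_sum_lower_sum[OF assms(3)] .
qed

end
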